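(* Let $(R,{}^-)$ be a unital associative $\Bbbk$-superalgebra with superinvolution and let $m,n\ge 1$ be integers with $(m,n)\neq(1,1),(2,1)$. Then $\mathrm H_2(\mathfrak{osp}_{m|2n}(R,{}^-),\Bbbk)\cong{}_{-}\mathrm{HD}_1(R,{}^-)$ as $\Bbbk$-modules.
   Context: **Base conventions.** $\Bbbk$ is a unital commutative associative ring in which $2$ is invertible; all modules and (super)algebras are over $\Bbbk$. Superalgebras are $\mathbb{Z}/2\mathbb{Z}$-graded, $|x|$ is the degree of a homogeneous $x$, and formulas involving degrees are for homogeneous elements, extended linearly. A Lie superalgebra has an even bilinear bracket with $[x,y]=-(-1)^{|x||y|}[y,x]$ and $(-1)^{|x||z|}[[x,y],z]+(-1)^{|y||x|}[[y,z],x]+(-1)^{|z||y|}[[z,x],y]=0$. A superinvolution on $R$ is a degree-preserving $\Bbbk$-linear map $a\mapsto\bar a$ with $\overline{ab}=(-1)^{|a||b|}\bar b\bar a$, $\bar{\bar a}=a$. In $R$, $[a,b]=ab-(-1)^{|a||b|}ba$. Put $\rho(a)=(-1)^{|a|}a$. **$\mathfrak{osp}_{m|2n}(R,{}^-)$.** $\mathrm{M}_{m|2n}(R)$ is the superalgebra of $(m+2n)\times(m+2n)$ matrices over $R$ with usual matrix multiplication; $e_{ij}(a)$ (entry $a$ at $(i,j)$) has degree $|i|+|j|+|a|$, with $|i|=0$ for $i\le m$, $|i|=1$ for $i>m$. With blocks of sizes $m,n,n$ let $$\begin{pmatrix}A&B_1&C_2\\ C_1&D_{11}&D_{12}\\ B_2&D_{21}&D_{22}\end{pmatrix}^{\mathrm{osp}}=\begin{pmatrix}\overline{A}^t&-\overline{\rho(B_2)}^t&\overline{\rho(C_1)}^t\\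 \overline{\rho(C_2)}^t&\overline{D_{22}}^t&-\overline{D_{12}}^t\\ -\overline{\rho(B_1)}^t&-\overline{D_{21}}^t&\overline{D_{11}}^t\end{pmatrix}$$ ($\rho$ and ${}^-$ applied entrywise). $\widetilde{\mathfrak{osp}}_{m|2n}(R,{}^-)=\{X: X^{\mathrm{osp}}=-X\}$ is a Lie superalgebra under the supercommutator, and $\mathfrak{osp}_{m|2n}(R,{}^-)=[\widetilde{\mathfrak{osp}}_{m|2n}(R,{}^-),\widetilde{\mathfrak{osp}}_{m|2n}(R,{}^-)]$; this is a perfect Lie superalgebra. **Second homology.** For a Lie superalgebra $L$, $\mathrm H_2(L,\Bbbk)$ is the kernel of the map $(L\otimes_\Bbbk L)/B\to L$, $x\otimes y\mapsto[x,y]$, where $B$ is spanned by $x\otimes y+(-1)^{|x||y|}y\otimes x$ and $(-1)^{|x||z|}[x,y]\otimes z+(-1)^{|y||x|}[y,z]\otimes x+(-1)^{|z||y|}[z,x]\otimes y$ for homogeneous $x,y,z\in L$; for perfect $L$ this is the kernel of the universal central extension of $L$. **First $\mathbb{Z}/2\mathbb{Z}$-graded skew-dihedral homology.** Let $I_{\mathsf d}^-\subseteq R\otimes_\Bbbk R$ be the submodule spanned by $a\otimes b-\bar a\otimes\bar b$, $a\otimes b+(-1)^{|a||b|}b\otimes a$ and $(-1)^{|a||c|}ab\otimes c+(-1)^{|a||b|}bc\otimes a+(-1)^{|b||c|}ca\otimes b$; let $\langle R,R\rangle_{\mathsf d}^-=(R\otimes_\Bbbk R)/I_{\mathsf d}^-$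 with $\langle a,b\rangle_{\mathsf d}^-$ the class of $a\otimes b$. Then ${}_{-}\mathrm{HD}_1(R,{}^-)=\{\sum_i\langle a_i,b_i\rangle_{\mathsf d}^-:\ \sum_i[a_i,b_i]=\sum_i\overline{[a_i,b_i]}\}$. *)

theory Defs
  imports "HOL-Analysis.Finite_Cartesian_Product" "HOL-Library.Poly_Mapping"
    "HOL-Library.Set_Algebras" "HOL-Library.Z2"
begin

section \<open>Superalgebras with superinvolution\<close>

text \<open>Degrees are elements of the field \<open>bit\<close> of integers modulo 2, so that
  \<open>sgn_deg (d * e) x\<close> is $(-1)^{de} x$. A grading is given by its family of homogeneous
  submodules: \<open>x \<in> G d\<close> means that \<open>x\<close> is homogeneous of degree \<open>d\<close> (and 0 has every degree).
  For a grading \<open>G\<close>, \<open>hcomp G d x\<close> is the component of \<open>x\<close> of degree \<open>d\<close>; it is used to extend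
  formulas that involve degrees linearly.\<close>

definition sgn_deg :: "bit \<Rightarrow> 'a::ab_group_add \<Rightarrow> 'a"
  where "sgn_deg d x = (if d = 0 then x else - x)"

definition hcomp :: "(bit \<Rightarrow> 'a::ab_group_add set) \<Rightarrow> bit \<Rightarrow> 'a \<Rightarrow> 'a"
  where "hcomp G d x = (THE y. y \<in> G d \<and> x - y \<in> G (d + 1))"

definition rho :: "(bit \<Rightarrow> 'a::ab_group_add set) \<Rightarrow> 'a \<Rightarrow> 'a"
  where "rho G x = (\<Sum>d\<in>UNIV. sgn_deg d (hcomp G d x))"

definition supercomm ::
    "(bit \<Rightarrow> 'a::ab_group_add set) \<Rightarrow> ('a \<Rightarrow> 'a \<Rightarrow> 'a) \<Rightarrow> 'a \<Rightarrow> 'a \<Rightarrow> 'a"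
  where "supercomm G mul x y =
    (\<Sum>d\<in>UNIV. \<Sum>e\<in>UNIV. mul (hcomp G d x) (hcomp G e y)
      - sgn_deg (d * e) (mul (hcomp G e y) (hcomp G d x)))"

text \<open>The class \<open>ring\<close> does not provide a unit; it is required separately, because the
  class \<open>ring_1\<close> would exclude the zero algebra.\<close>

locale superalgebra_superinvolution = module sc
  for sc :: "'k::comm_ring_1 \<Rightarrow> 'r::ring \<Rightarrow> 'r" +
  fixes G :: "bit \<Rightarrow> 'r set"
    and bar :: "'r \<Rightarrow> 'r"
  assumes scale_mult_left: "sc c a * b = sc c (a * b)"
    and scale_mult_right: "a * sc c b = sc c (a * b)"
    and unital: "\<exists>u::'r. \<forall>a. u * a = a \<and> a * u = a"
    and grading_subspace: "subspace (G d)"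
    and grading_disjoint: "G 0 \<inter> G 1 = {0}"
    and grading_sum: "G 0 + G 1 = UNIV"
    and grading_mult: "a \<in> G d \<Longrightarrow> b \<in> G e \<Longrightarrow> a * b \<in> G (d + e)"
    and bar_linear: "module_hom sc sc bar"
    and bar_degree: "a \<in> G d \<Longrightarrow> bar a \<in> G d"
    and bar_mult: "a \<in> G d \<Longrightarrow> b \<in> G e \<Longrightarrow> bar (a * b) = sgn_deg (d * e) (bar b * bar a)"
    and bar_bar: "bar (bar a) = a"


section \<open>Quotients and tensor products of modules\<close>

text \<open>The elements of the quotient of \<open>F\<close> by a submodule \<open>W\<close> are the cosets of \<open>W\<close>.
  They are added by the elementwise addition of sets from \<open>Set_Algebras\<close>. In the scalar
  action the summand \<open>W\<close> is needed, since \<open>c\<close> times a coset of \<open>W\<close> may be a proper subset of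
  a coset.\<close>

definition cosets :: "'a::ab_group_add set \<Rightarrow> 'a set \<Rightarrow> 'a set set"
  where "cosets F W = {x +o W | x. x \<in> F}"

definition coset_scale :: "('k \<Rightarrow> 'a::ab_group_add \<Rightarrow> 'a) \<Rightarrow> 'a set \<Rightarrow> 'k \<Rightarrow> 'a set \<Rightarrow> 'a set"
  where "coset_scale sc W c X = sc c ` X + W"

definition coset_modules_isomorphic ::
    "('k \<Rightarrow> 'a::ab_group_add \<Rightarrow> 'a) \<Rightarrow> 'a set \<Rightarrow> 'a set set \<Rightarrow>
     ('k \<Rightarrow> 'b::ab_group_add \<Rightarrow> 'b) \<Rightarrow> 'b set \<Rightarrow> 'b set set \<Rightarrow> bool"
  where "coset_modules_isomorphic s W A s' W' A' \<longleftrightarrow>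
    (\<exists>f. bij_betw f A A' \<and>
      (\<forall>X\<in>A. \<forall>Y\<in>A. f (X + Y) = f X + f Y) \<and>
      (\<forall>c. \<forall>X\<in>A. f (coset_scale s W c X) = coset_scale s' W' c (f X)))"

text \<open>The free module on a set \<open>S\<close> consists of the finitely supported maps with support
  contained in \<open>S\<close>; \<open>gen x y\<close> is the basis element belonging to the pair \<open>(x, y)\<close>.\<close>

definition free_module :: "'a set \<Rightarrow> ('a \<Rightarrow>\<^sub>0 'k::zero) set"
  where "free_module S = {p. Poly_Mapping.keys p \<subseteq> S}"

definition free_scale :: "'k::comm_ring_1 \<Rightarrow> ('a \<Rightarrow>\<^sub>0 'k) \<Rightarrow> ('a \<Rightarrow>\<^sub>0 'k)"
  where "free_scale c p = Poly_Mapping.map ((*) c) p"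

definition free_lift ::
    "('k::comm_ring_1 \<Rightarrow> 'b::ab_group_add \<Rightarrow> 'b) \<Rightarrow> ('a \<Rightarrow> 'b) \<Rightarrow> ('a \<Rightarrow>\<^sub>0 'k) \<Rightarrow> 'b"
  where "free_lift sc f p =
    (\<Sum>u\<in>Poly_Mapping.keys p. sc (Poly_Mapping.lookup p u) (f u))"

definition gen :: "'a \<Rightarrow> 'b \<Rightarrow> ('a \<times> 'b \<Rightarrow>\<^sub>0 'k::comm_ring_1)"
  where "gen x y = Poly_Mapping.single (x, y) 1"

text \<open>For a submodule \<open>M\<close> of an ambient module, $M \otimes M$ is the quotient of
  \<open>free_module (M \<times> M)\<close> by the span of \<open>tensor_rels sc M\<close>, and $x \otimes y$ is the class
  of \<open>gen x y\<close>. Accordingly, the quotient of $M \otimes M$ by the submodule spanned by the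
  classes of a set \<open>S\<close> is the quotient of \<open>free_module (M \<times> M)\<close> by the span of
  \<open>tensor_rels sc M \<union> S\<close>; quotients of tensor products are written in this form below.\<close>

definition tensor_rels ::
    "('k::comm_ring_1 \<Rightarrow> 'a::ab_group_add \<Rightarrow> 'a) \<Rightarrow> 'a set \<Rightarrow> ('a \<times> 'a \<Rightarrow>\<^sub>0 'k) set"
  where "tensor_rels sc M =
    {gen (x + x') y - gen x y - gen x' y | x x' y. x \<in> M \<and> x' \<in> M \<and> y \<in> M} \<union>
    {gen x (y + y') - gen x y - gen x y' | x y y'. x \<in> M \<and> y \<in> M \<and> y' \<in> M} \<union>
    {gen (sc c x) y - free_scale c (gen x y) | c x y. x \<in> M \<and> y \<in> M} \<union>
    {gen x (sc c y) - free_scale c (gen x y) | c x y. x \<in> M \<and> y \<in> M}"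


section \<open>Second homology of Lie superalgebras\<close>

text \<open>A Lie superalgebra is given as a submodule \<open>L\<close> of an ambient graded module with
  bracket \<open>br\<close>; its homogeneous elements of degree \<open>d\<close> are those of \<open>L \<inter> G d\<close>.\<close>

definition H2_rels ::
    "('k::comm_ring_1 \<Rightarrow> 'a::ab_group_add \<Rightarrow> 'a) \<Rightarrow> (bit \<Rightarrow> 'a set) \<Rightarrow> ('a \<Rightarrow> 'a \<Rightarrow> 'a) \<Rightarrow>
     'a set \<Rightarrow> ('a \<times> 'a \<Rightarrow>\<^sub>0 'k) set"
  where "H2_rels sc G br L = module.span free_scale (tensor_rels sc L \<union>
    {gen x y + sgn_deg (d * e) (gen y x) | d e x y. x \<in> L \<inter> G d \<and> y \<in> L \<inter> G e} \<union>
    {sgn_deg (d * f) (gen (br x y) z) + sgn_deg (e * d) (gen (br y z) x)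
       + sgn_deg (f * e) (gen (br z x) y)
     | d e f x y z. x \<in> L \<inter> G d \<and> y \<in> L \<inter> G e \<and> z \<in> L \<inter> G f})"

text \<open>The map induced on cosets by a map \<open>f\<close> that is constant on each coset
  sends a coset \<open>X\<close> to the unique element of \<open>f ` X\<close>.\<close>

definition H2 ::
    "('k::comm_ring_1 \<Rightarrow> 'a::ab_group_add \<Rightarrow> 'a) \<Rightarrow> (bit \<Rightarrow> 'a set) \<Rightarrow> ('a \<Rightarrow> 'a \<Rightarrow> 'a) \<Rightarrow>
     'a set \<Rightarrow> ('a \<times> 'a \<Rightarrow>\<^sub>0 'k) set set"
  where "H2 sc G br L =
    {X \<in> cosets (free_module (L \<times> L)) (H2_rels sc G br L).
       the_elem (free_lift sc (\<lambda>(x, y). br x y) ` X) = 0}"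


section \<open>First skew-dihedral homology\<close>

definition HD1_rels ::
    "('k::comm_ring_1 \<Rightarrow> 'r::ring \<Rightarrow> 'r) \<Rightarrow> (bit \<Rightarrow> 'r set) \<Rightarrow> ('r \<Rightarrow> 'r) \<Rightarrow>
     ('r \<times> 'r \<Rightarrow>\<^sub>0 'k) set"
  where "HD1_rels sc G bar = module.span free_scale (tensor_rels sc UNIV \<union>
    {gen a b - gen (bar a) (bar b) | a b. True} \<union>
    {gen a b + sgn_deg (d * e) (gen b a) | d e a b. a \<in> G d \<and> b \<in> G e} \<union>
    {sgn_deg (d * f) (gen (a * b) c) + sgn_deg (d * e) (gen (b * c) a)
       + sgn_deg (e * f) (gen (c * a) b)
     | d e f a b c. a \<in> G d \<and> b \<in> G e \<and> c \<in> G f})"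

definition HD1 ::
    "('k::comm_ring_1 \<Rightarrow> 'r::ring \<Rightarrow> 'r) \<Rightarrow> (bit \<Rightarrow> 'r set) \<Rightarrow> ('r \<Rightarrow> 'r) \<Rightarrow>
     ('r \<times> 'r \<Rightarrow>\<^sub>0 'k) set set"
  where "HD1 sc G bar =
    {(\<Sum>i<N. gen (a i) (b i)) +o HD1_rels sc G bar | (N::nat) a b.
       (\<Sum>i<N. supercomm G (*) (a i) (b i)) = (\<Sum>i<N. bar (supercomm G (*) (a i) (b i)))}"


section \<open>Ortho-symplectic Lie superalgebras\<close>

text \<open>The rows and columns of the matrices are indexed by \<open>('m, 'n) idx\<close>. The three summands
  correspond to the blocks of sizes \<open>m\<close>, \<open>n\<close> and \<open>n\<close>, where \<open>m = CARD('m)\<close> and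
  \<open>n = CARD('n)\<close>.\<close>

type_synonym ('m, 'n) idx = "'m + 'n + 'n"

type_synonym ('r, 'm, 'n) mat = "'r ^ ('m, 'n) idx ^ ('m, 'n) idx"


fun idx_deg :: "('m, 'n) idx \<Rightarrow> bit" where
  "idx_deg (Inl _) = 0"
| "idx_deg (Inr _) = 1"

definition mat_scale :: "('k \<Rightarrow> 'r \<Rightarrow> 'r) \<Rightarrow> 'k \<Rightarrow> ('r, 'm::finite, 'n::finite) mat \<Rightarrow> ('r, 'm, 'n) mat"
  where "mat_scale sc c X = (\<chi> i j. sc c (X $ i $ j))"

text \<open>This is \<open>matrix_matrix_mult\<close>, which is only available over \<open>semiring_1\<close>.\<close>

definition mat_mult ::
    "('r::ring, 'm::finite, 'n::finite) mat \<Rightarrow> ('r, 'm, 'n) mat \<Rightarrow> ('r, 'm, 'n) mat"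
  where "mat_mult X Y = (\<chi> i j. \<Sum>k\<in>UNIV. X $ i $ k * Y $ k $ j)"

definition mat_grading :: "(bit \<Rightarrow> 'r set) \<Rightarrow> bit \<Rightarrow> ('r, 'm::finite, 'n::finite) mat set"
  where "mat_grading G d = {X. \<forall>i j. X $ i $ j \<in> G (d + idx_deg i + idx_deg j)}"

abbreviation mat_bracket :: "(bit \<Rightarrow> 'r::ring set) \<Rightarrow>
    ('r, 'm::finite, 'n::finite) mat \<Rightarrow> ('r, 'm, 'n) mat \<Rightarrow> ('r, 'm, 'n) mat"
  where "mat_bracket G \<equiv> supercomm (mat_grading G) mat_mult"

fun osp_entry :: "(bit \<Rightarrow> 'r::ring set) \<Rightarrow> ('r \<Rightarrow> 'r) \<Rightarrow> ('r, 'm::finite, 'n::finite) mat \<Rightarrow>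
    ('m, 'n) idx \<Rightarrow> ('m, 'n) idx \<Rightarrow> 'r" where
  "osp_entry G bar X (Inl i) (Inl j) = bar (X $ Inl j $ Inl i)"
| "osp_entry G bar X (Inl i) (Inr (Inl j)) = - bar (rho G (X $ Inr (Inr j) $ Inl i))"
| "osp_entry G bar X (Inl i) (Inr (Inr j)) = bar (rho G (X $ Inr (Inl j) $ Inl i))"
| "osp_entry G bar X (Inr (Inl i)) (Inl j) = bar (rho G (X $ Inl j $ Inr (Inr i)))"
| "osp_entry G bar X (Inr (Inl i)) (Inr (Inl j)) = bar (X $ Inr (Inr j) $ Inr (Inr i))"
| "osp_entry G bar X (Inr (Inl i)) (Inr (Inr j)) = - bar (X $ Inr (Inl j) $ Inr (Inr i))"
| "osp_entry G bar X (Inr (Inr i)) (Inl j) = - bar (rho G (X $ Inl j $ Inr (Inl i)))"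
| "osp_entry G bar X (Inr (Inr i)) (Inr (Inl j)) = - bar (X $ Inr (Inr j) $ Inr (Inl i))"
| "osp_entry G bar X (Inr (Inr i)) (Inr (Inr j)) = bar (X $ Inr (Inl j) $ Inr (Inl i))"

definition osp_op :: "(bit \<Rightarrow> 'r::ring set) \<Rightarrow> ('r \<Rightarrow> 'r) \<Rightarrow>
    ('r, 'm::finite, 'n::finite) mat \<Rightarrow> ('r, 'm, 'n) mat"
  where "osp_op G bar X = (\<chi> i j. osp_entry G bar X i j)"

definition osp_tilde :: "(bit \<Rightarrow> 'r::ring set) \<Rightarrow> ('r \<Rightarrow> 'r) \<Rightarrow>
    ('r, 'm::finite, 'n::finite) mat set"
  where "osp_tilde G bar = {X. osp_op G bar X = - X}"

definition osp :: "('k::comm_ring_1 \<Rightarrow> 'r::ring \<Rightarrow> 'r) \<Rightarrow> (bit \<Rightarrow> 'r set) \<Rightarrow> ('r \<Rightarrow> 'r) \<Rightarrow>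
    ('r, 'm::finite, 'n::finite) mat set"
  where "osp sc G bar = module.span (mat_scale sc)
    {mat_bracket G X Y | X Y. X \<in> osp_tilde G bar \<and> Y \<in> osp_tilde G bar}"

end

theory Submission
  imports Defs
begin

text \<open>Let $A$ be the matrix superalgebra with its superinvolution $x \mapsto x^*$, put $T(x) = x - x^*$,
  and let $U$ be $L \otimes L$ modulo the relations of $\mathrm{H}_2$. Let 1 stand for an even index,
  so that $e_{11} A e_{11}$ is $R$ with its superinvolution.

  As $L$ is perfect, $U$ is spanned by the tensors $T_{pq}(a) \otimes T_{rs}(b)$ with $p \neq q$ and
  $r \neq s$. A Cartan element $h$ acts on $U$ both by weights and as $z \mapsto h \otimes [z]$, so a
  tensor whose weight is invertible in the base ring is determined by its bracket. For the
  weights 0 and $\pm 3$ one factor is written as a bracket through an index of a new class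
  instead; such an index exists because $(m, n)$ is neither $(1, 1)$ nor $(2, 1)$. This leaves
  the tensors $T_{1p}(a) \otimes T_{p1}(b)$, which depend only on $ba$ up to a term
  $\lambda(a, b)$ that does not depend on $p$. The elements $\lambda(a, b)$ satisfy the defining
  relations of the skew-dihedral homology and generate the kernel of the bracket. The map
  $X \otimes Y \mapsto \sum \pm \langle X_{pq}, Y_{qp} \rangle$ is inverse to
  $\langle a, b \rangle \mapsto \lambda(a, b)$ up to the factor 2.

  Identities in $U$ are tested by homomorphisms to the circle group, which separate the points
  of every abelian group: each of them turns $\otimes$ into a 2-cocycle with values in a type,
  where equations can be used for rewriting.\<close>

section \<open>Separating points of a quotient by homomorphisms into the circle group\<close>

\<comment> \<open>The circle is divisible as a group but carries no action of the base ring. A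
  cocycle therefore keeps scalars only as a balance rule, and scalar relations are checked directly.
  The total weight of two units lies between -4 and 4. Inverting 2 makes 1, 2 and 4 invertible, but
  not 3, which arises when a unit of weight 2 meets one of weight 1. The classes are the m + n
  orbits of the index involution, and units between different classes multiply like ordinary matrix
  units. A detour needs a third class, which (1, 1) lacks. Between two different even indices, two
  detours through the same class are compared through a fourth class, which (2, 1) lacks. The
  bracket of lambda(a, b) is T of the supercommutator [a, b] at position (1, 1). It vanishes exactly
  when [a, b] is fixed by the involution, which is the kernel condition of the skew-dihedral side.
  Spanning alone would leave open whether the lambda(a, b) satisfy further relations; the supertrace
  map excludes them. Its factor 2 comes from the two matrix positions of each skew unit.\<close>
quotient_type circle = real / "\<lambda>x y::real. x - y \<in> \<int>"
proof (rule equivpI)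
  show "symp (\<lambda>x y::real. x - y \<in> \<int>)"
    by (rule sympI) (metis Ints_minus minus_diff_eq)
  show "transp (\<lambda>x y::real. x - y \<in> \<int>)"
    by (rule transpI) (metis Ints_add add_diff_eq diff_add_cancel)
qed (simp add: reflp_def)

instantiation circle :: ab_group_add
begin

lift_definition zero_circle :: circle is 0 .

lift_definition plus_circle :: "circle \<Rightarrow> circle \<Rightarrow> circle" is "(+)"
proof -
  fix a b c d :: real
  assume "a - b \<in> \<int>" "c - d \<in> \<int>"
  then have "(a - b) + (c - d) \<in> \<int>" by (rule Ints_add)
  then show "a + c - (b + d) \<in> \<int>" by (simp add: algebra_simps)
qed

lift_definition uminus_circle :: "circle \<Rightarrow> circle" is uminus
proof -
  fix a b :: real
  assume "a - b \<in> \<int>"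
  then have "- (a - b) \<in> \<int>" by (rule Ints_minus)
  then show "- a - - b \<in> \<int>" by simp
qed

lift_definition minus_circle :: "circle \<Rightarrow> circle \<Rightarrow> circle" is "(-)"
proof -
  fix a b c d :: real
  assume "a - b \<in> \<int>" "c - d \<in> \<int>"
  then have "(a - b) - (c - d) \<in> \<int>" by (rule Ints_diff)
  then show "a - c - (b - d) \<in> \<int>" by (simp add: algebra_simps)
qed

instance
  by standard (transfer; simp add: algebra_simps)+

end

text \<open>Graphs of homomorphisms from a subgroup to \<open>\<real>/\<int>\<close>, with the values lifted to \<open>\<real>\<close>.\<close>

definition circle_graph :: "('b::ab_group_add \<times> real) set \<Rightarrow> bool"
  where "circle_graph \<Gamma> \<longleftrightarrow> (\<forall>p\<in>\<Gamma>. \<forall>q\<in>\<Gamma>. p - q \<in> \<Gamma>) \<and> (\<forall>r\<in>\<int>. (0, r) \<in> \<Gamma>) \<and>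
    (\<forall>r. (0, r) \<in> \<Gamma> \<longrightarrow> r \<in> \<int>)"

lemma circle_graph_diff: "circle_graph \<Gamma> \<Longrightarrow> p \<in> \<Gamma> \<Longrightarrow> q \<in> \<Gamma> \<Longrightarrow> p - q \<in> \<Gamma>"
  unfolding circle_graph_def by blast

lemma circle_graph_uminus: "circle_graph \<Gamma> \<Longrightarrow> p \<in> \<Gamma> \<Longrightarrow> - p \<in> \<Gamma>"
  using circle_graph_diff[of \<Gamma> "(0, 0)" p]
  by (metis Ints_0 circle_graph_def diff_0 zero_prod_def)

lemma circle_graph_add: "circle_graph \<Gamma> \<Longrightarrow> p \<in> \<Gamma> \<Longrightarrow> q \<in> \<Gamma> \<Longrightarrow> p + q \<in> \<Gamma>"
  using circle_graph_diff[of \<Gamma> p "- q"] circle_graph_uminus[of \<Gamma> q] by simp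

context
  fixes sc :: "'k::comm_ring_1 \<Rightarrow> 'b::ab_group_add \<Rightarrow> 'b"
  assumes module_sc: "module sc"
begin

interpretation module sc
  by (rule module_sc)

lemma circle_graph_of_int:
  assumes "circle_graph \<Gamma>" "(g, c) \<in> \<Gamma>"
  shows "(sc (of_int k) g, of_int k * c) \<in> \<Gamma>"
proof (induction k rule: int_induct[where k = 0])
  case base
  then show ?case using assms(1) by (simp add: circle_graph_def)
next
  case (step1 k)
  then show ?case
    using circle_graph_add[OF assms(1) _ assms(2)] by (fastforce simp: algebra_simps)
next
  case (step2 k)
  then show ?case
    using circle_graph_diff[OF assms(1) _ assms(2)] by (fastforce simp: algebra_simps)
qed

text \<open>The subgroup generated by the graph and the point (y, t); integer multiples of y are
  formed with the scalars \<open>of_int k\<close>.\<close>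

definition extend_graph :: "('b \<times> real) set \<Rightarrow> 'b \<Rightarrow> real \<Rightarrow> ('b \<times> real) set"
  where "extend_graph \<Gamma> y t = {(g + sc (of_int k) y, c + of_int k * t) | g c k. (g, c) \<in> \<Gamma>}"

lemma extend_graph_memI: "(g, c) \<in> \<Gamma> \<Longrightarrow> (g + sc (of_int k) y, c + of_int k * t) \<in> extend_graph \<Gamma> y t"
  unfolding extend_graph_def by blast

lemma subset_extend_graph: "\<Gamma> \<subseteq> extend_graph \<Gamma> y t"
  using extend_graph_memI[where k = 0] by fastforce

lemma extend_graph_point: "circle_graph \<Gamma> \<Longrightarrow> (y, t) \<in> extend_graph \<Gamma> y t"
  using extend_graph_memI[of 0 0 \<Gamma> 1 y t] by (simp add: circle_graph_def)

text \<open>The fibre over 0 decides whether a subgroup is single-valued. A new element of this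
  fibre can only come from a multiple of y that already lies in the domain, so compatibility there
  is enough.\<close>

lemma circle_graph_extendI:
  assumes \<Gamma>: "circle_graph \<Gamma>"
    and single: "\<And>k c. (sc (of_int k) y, c) \<in> \<Gamma> \<Longrightarrow> of_int k * t - c \<in> \<int>"
  shows "circle_graph (extend_graph \<Gamma> y t)"
  unfolding circle_graph_def
proof (intro conjI ballI allI impI)
  fix p q
  assume "p \<in> extend_graph \<Gamma> y t" "q \<in> extend_graph \<Gamma> y t"
  then obtain g c k g' c' k'
    where p: "p = (g + sc (of_int k) y, c + of_int k * t)" "(g, c) \<in> \<Gamma>"
      and q: "q = (g' + sc (of_int k') y, c' + of_int k' * t)" "(g', c') \<in> \<Gamma>"
    unfolding extend_graph_def by blast
  have "(g - g', c - c') \<in> \<Gamma>"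
    using circle_graph_diff[OF \<Gamma> p(2) q(2)] by simp
  then have "((g - g') + sc (of_int (k - k')) y, (c - c') + of_int (k - k') * t) \<in> extend_graph \<Gamma> y t"
    by (rule extend_graph_memI)
  then show "p - q \<in> extend_graph \<Gamma> y t"
    by (simp add: p q algebra_simps)
next
  fix r :: real
  assume "r \<in> \<int>"
  then show "(0, r) \<in> extend_graph \<Gamma> y t"
    using \<Gamma> subset_extend_graph unfolding circle_graph_def by blast
next
  fix r
  assume "(0, r) \<in> extend_graph \<Gamma> y t"
  then obtain g c k where *: "0 = g + sc (of_int k) y" "r = c + of_int k * t" "(g, c) \<in> \<Gamma>"
    unfolding extend_graph_def by blast
  then have "(sc (of_int k) y, - c) \<in> \<Gamma>"
    using circle_graph_uminus[OF \<Gamma> *(3)] minus_unique[OF *(1)[symmetric]] by simp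
  from single[OF this] show "r \<in> \<int>"
    by (simp add: *(2) add.commute)
qed

text \<open>Divisibility of the circle. If no positive multiple of y lies in the domain, t is
  arbitrary, and 1/2 is a nonzero choice. Otherwise the least such multiple n y has a value s, and t
  has to solve n t = s modulo the integers.\<close>

lemma circle_graph_extend:
  assumes \<Gamma>: "circle_graph \<Gamma>" and y: "y \<notin> fst ` \<Gamma>"
  obtains t where "t \<notin> \<int>" "circle_graph (extend_graph \<Gamma> y t)"
proof (cases "\<exists>n>0. sc (of_nat n) y \<in> fst ` \<Gamma>")
  case False
  have "circle_graph (extend_graph \<Gamma> y (1 / 2))"
  proof (rule circle_graph_extendI[OF \<Gamma>])
    fix k c
    assume kc: "(sc (of_int k) y, c) \<in> \<Gamma>"
    have "k = 0"
    proof (rule ccontr)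
      assume "k \<noteq> 0"
      have "sc (of_nat (nat \<bar>k\<bar>)) y \<in> fst ` \<Gamma>"
      proof (cases "k \<ge> 0")
        case True
        then show ?thesis using kc by (auto intro: rev_image_eqI)
      next
        case False
        then show ?thesis using circle_graph_uminus[OF \<Gamma> kc] by (auto intro: rev_image_eqI)
      qed
      moreover have "nat \<bar>k\<bar> > 0" using \<open>k \<noteq> 0\<close> by simp
      ultimately show False using False by blast
    qed
    then show "of_int k * (1 / 2) - c \<in> \<int>"
      using kc \<Gamma> by (simp add: circle_graph_def)
  qed
  moreover have "(1 / 2 :: real) \<notin> \<int>"
    by (simp add: fraction_not_in_Ints)
  ultimately show ?thesis using that by blast
next
  case True
  define n where "n = (LEAST n. n > 0 \<and> sc (of_nat n) y \<in> fst ` \<Gamma>)"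
  have n: "n > 0" "sc (of_nat n) y \<in> fst ` \<Gamma>"
    using LeastI_ex[OF True] unfolding n_def by auto
  have "n \<noteq> 1" using n(2) y by (metis of_nat_1 scale_one)
  from n(2) obtain s0 where s0: "(sc (of_nat n) y, s0) \<in> \<Gamma>" by auto
  have s1: "(sc (of_nat n) y, s0 + 1) \<in> \<Gamma>"
    using circle_graph_add[OF \<Gamma> s0, of "(0, 1)"] \<Gamma> by (simp add: circle_graph_def)
  \<comment> \<open>Two solutions differ by 1/n, and n is at least 2 because y itself is outside the
    domain; so one of them is nonzero in the circle.\<close>
  have "s0 / n \<notin> \<int> \<or> (s0 + 1) / n \<notin> \<int>"
  proof (rule ccontr)
    assume "\<not> ?thesis"
    then have "(s0 + 1) / n - s0 / n \<in> \<int>" using Ints_diff by blast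
    then have "1 / real n \<in> \<int>" by (simp add: add_divide_distrib)
    then show False using n(1) \<open>n \<noteq> 1\<close> fraction_not_in_Ints[of "int n" 1, where 'a = real]
      by simp
  qed
  then obtain s where s: "(sc (of_nat n) y, s) \<in> \<Gamma>" "s / n \<notin> \<int>"
    using s0 s1 by blast
  have "circle_graph (extend_graph \<Gamma> y (s / n))"
  proof (rule circle_graph_extendI[OF \<Gamma>])
    fix k c
    assume kc: "(sc (of_int k) y, c) \<in> \<Gamma>"
    \<comment> \<open>Division with remainder by n: minimality of n forces the remainder to vanish,
      so every multiple of y in the domain is a multiple of n y.\<close>
    define j where "j = k div int n"
    define r where "r = nat (k mod int n)"
    have k: "k = j * int n + int r" using n(1) by (simp add: j_def r_def)
    have js: "(sc (of_int j) (sc (of_nat n) y), of_int j * s) \<in> \<Gamma>"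
      by (rule circle_graph_of_int[OF \<Gamma> s(1)])
    have "(sc (of_int k) y - sc (of_int j) (sc (of_nat n) y), c - of_int j * s) \<in> \<Gamma>"
      using circle_graph_diff[OF \<Gamma> kc js] by simp
    then have d: "(sc (of_nat r) y, c - of_int j * s) \<in> \<Gamma>"
      by (simp add: k algebra_simps)
    have "r < n" using n(1) by (simp add: r_def nat_less_iff)
    have "r = 0"
    proof (rule ccontr)
      assume "r \<noteq> 0"
      then have "n \<le> r" unfolding n_def
        by (intro Least_le) (use d in \<open>auto intro: rev_image_eqI\<close>)
      then show False using \<open>r < n\<close> by simp
    qed
    then have "c - of_int j * s \<in> \<int>" using d \<Gamma> by (simp add: circle_graph_def)
    then have "- (c - of_int j * s) \<in> \<int>" by (rule Ints_minus)
    moreover have "of_int k * (s / n) - c = - (c - of_int j * s)"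
      using n(1) \<open>r = 0\<close> by (simp add: k)
    ultimately show "of_int k * (s / n) - c \<in> \<int>" by simp
  qed
  with s(2) show ?thesis using that by blast
qed

lemma circle_graph_Union:
  assumes "chain\<^sub>\<subseteq> C" "C \<noteq> {}" "\<And>\<Gamma>. \<Gamma> \<in> C \<Longrightarrow> circle_graph \<Gamma>"
  shows "circle_graph (\<Union>C)"
  unfolding circle_graph_def
proof (intro conjI ballI allI impI)
  fix p q
  assume "p \<in> \<Union>C" "q \<in> \<Union>C"
  then obtain \<Gamma>1 \<Gamma>2 where "\<Gamma>1 \<in> C" "p \<in> \<Gamma>1" "\<Gamma>2 \<in> C" "q \<in> \<Gamma>2" by blast
  then obtain \<Gamma> where "\<Gamma> \<in> C" "p \<in> \<Gamma>" "q \<in> \<Gamma>"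
    using assms(1) unfolding chain_subset_def by blast
  then show "p - q \<in> \<Union>C" using assms(3) circle_graph_diff by blast
next
  fix r :: real
  assume "r \<in> \<int>"
  then show "(0, r) \<in> \<Union>C" using assms(2,3) unfolding circle_graph_def by blast
next
  fix r
  assume "(0, r) \<in> \<Union>C"
  then show "r \<in> \<int>" using assms(3) unfolding circle_graph_def by blast
qed

text \<open>Start from the homomorphism that is 0 on W and nonzero at x, and take a maximal graph by
  Zorn. By \<open>circle_graph_extend\<close> a maximal graph has full domain.\<close>

lemma separating_hom_ex:
  assumes W: "0 \<in> W" "\<And>u v. u \<in> W \<Longrightarrow> v \<in> W \<Longrightarrow> u - v \<in> W" and x: "x \<notin> W"
  obtains f :: "'b \<Rightarrow> circle" where "additive f" "\<And>u. u \<in> W \<Longrightarrow> f u = 0" "f x \<noteq> 0"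
proof -
  have W0: "circle_graph (W \<times> \<int>)"
    using W by (auto simp: circle_graph_def)
  have "x \<notin> fst ` (W \<times> (\<int> :: real set))" using x by auto
  from circle_graph_extend[OF W0 this] obtain t
    where t: "t \<notin> \<int>" "circle_graph (extend_graph (W \<times> \<int>) x t)" .
  define A where "A = {\<Gamma>. circle_graph \<Gamma> \<and> extend_graph (W \<times> \<int>) x t \<subseteq> \<Gamma>}"
  have "\<exists>M\<in>A. \<forall>X\<in>A. M \<subseteq> X \<longrightarrow> X = M"
  proof (rule subset_Zorn_nonempty)
    show "A \<noteq> {}" using t(2) by (auto simp: A_def)
    fix C
    assume C: "C \<noteq> {}" "subset.chain A C"
    then have "chain\<^sub>\<subseteq> C" by (metis subset_chain_def chain_subset_def)
    then show "\<Union>C \<in> A"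
      using circle_graph_Union[of C] C unfolding A_def subset_chain_def by blast
  qed
  then obtain M where M: "circle_graph M" "extend_graph (W \<times> \<int>) x t \<subseteq> M"
    and max: "\<And>X. circle_graph X \<Longrightarrow> M \<subseteq> X \<Longrightarrow> X = M"
    unfolding A_def by (smt (verit) mem_Collect_eq subset_trans)
  have total: "\<exists>r. (z, r) \<in> M" for z
  proof (rule ccontr)
    assume "\<nexists>r. (z, r) \<in> M"
    then have "z \<notin> fst ` M" by auto
    from circle_graph_extend[OF M(1) this] obtain t' where "circle_graph (extend_graph M z t')" .
    from max[OF this subset_extend_graph] extend_graph_point[OF M(1)]
    show False using \<open>\<nexists>r. (z, r) \<in> M\<close> by blast
  qed
  define v where "v = (\<lambda>z. SOME r. (z, r) \<in> M)"
  have v: "(z, v z) \<in> M" for z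
    unfolding v_def by (rule someI_ex[OF total])
  have uniq: "abs_circle r = abs_circle (v z)" if "(z, r) \<in> M" for z r
  proof -
    have "(z, r) - (z, v z) \<in> M" using circle_graph_diff[OF M(1) that v] .
    then have "r - v z \<in> \<int>" using M(1) by (simp add: circle_graph_def)
    then show ?thesis by (simp add: circle.abs_eq_iff)
  qed
  show ?thesis
  proof
    show "additive (\<lambda>z. abs_circle (v z))"
    proof
      fix a b
      have "(a + b, v a + v b) \<in> M"
        using circle_graph_add[OF M(1) v v, of a b] by simp
      from uniq[OF this] show "abs_circle (v (a + b)) = abs_circle (v a) + abs_circle (v b)"
        by (simp add: plus_circle.abs_eq)
    qed
    show "abs_circle (v u) = 0" if "u \<in> W" for u
    proof -
      have "(u, 0) \<in> M" using M(2) subset_extend_graph that by fastforce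
      from uniq[OF this] show ?thesis by (simp add: zero_circle_def)
    qed
    have "(x, t) \<in> M" using M(2) extend_graph_point[OF W0] by blast
    from uniq[OF this] have "abs_circle (v x) = abs_circle t" by simp
    also have "\<dots> \<noteq> 0" using t(1) by (simp add: zero_circle_def circle.abs_eq_iff)
    finally show "abs_circle (v x) \<noteq> 0" .
  qed
qed

lemma mem_subspace_by_homs:
  assumes "subspace W"
    and "\<And>f :: 'b \<Rightarrow> circle. additive f \<Longrightarrow> (\<And>u. u \<in> W \<Longrightarrow> f u = 0) \<Longrightarrow> f x = 0"
  shows "x \<in> W"
proof (rule ccontr)
  assume "x \<notin> W"
  then obtain f :: "'b \<Rightarrow> circle" where "additive f" "\<And>u. u \<in> W \<Longrightarrow> f u = 0" "f x \<noteq> 0"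
    using separating_hom_ex[of W x] subspace_0[OF assms(1)] subspace_diff[OF assms(1)] by metis
  with assms(2) show False by blast
qed

end

section \<open>Signs, gradings and supercommutators\<close>

declare add_bit_eq_xor [simp del] mult_bit_eq_and [simp del]

lemma bit_add_self [simp]: "d + d = 0" "d + (d + e) = e"
  and bit_mult_self [simp]: "d * d = d" "d * (d * e) = d * e"
  for d e :: bit
  by (cases d; cases e; simp)+

lemma sgn_deg_0 [simp]: "sgn_deg 0 x = x"
  and sgn_deg_1 [simp]: "sgn_deg 1 x = - x"
  by (simp_all add: sgn_deg_def)

lemma sgn_deg_zero [simp]: "sgn_deg d 0 = 0"
  by (simp add: sgn_deg_def)

lemma sgn_deg_add: "sgn_deg d (x + y) = sgn_deg d x + sgn_deg d y"
  by (simp add: sgn_deg_def)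

lemma sgn_deg_minus: "sgn_deg d (- x) = - sgn_deg d x"
  by (simp add: sgn_deg_def)

lemma sgn_deg_diff: "sgn_deg d (x - y) = sgn_deg d x - sgn_deg d y"
  by (simp add: sgn_deg_def)

lemma sgn_deg_sgn_deg [simp]: "sgn_deg d (sgn_deg e x) = sgn_deg (d + e) x"
  by (cases d; cases e) simp_all

lemma sgn_deg_sum: "sgn_deg d (sum f A) = (\<Sum>x\<in>A. sgn_deg d (f x))"
  by (simp add: sgn_deg_def sum_negf)

lemma sgn_deg_mult_left: "sgn_deg d x * y = sgn_deg d (x * y :: 'a::ring)"
  and sgn_deg_mult_right: "x * sgn_deg d y = sgn_deg d (x * y :: 'a::ring)"
  by (simp_all add: sgn_deg_def)

lemma (in additive) sgn_deg: "f (sgn_deg d x) = sgn_deg d (f x)"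
  by (simp add: sgn_deg_def minus)

lemma UNIV_bit: "(UNIV :: bit set) = {0, 1}"
  using bit.exhaust by auto

instance bit :: finite
  by standard (simp add: UNIV_bit)

lemma sum_bit: "(\<Sum>d\<in>UNIV. f d) = f (0::bit) + f 1"
  by (simp add: UNIV_bit)

lemma sum_delta2:
  fixes i :: "'a::finite" and j :: "'b::finite" and x :: "'c::comm_monoid_add"
  shows "(\<Sum>p\<in>UNIV. \<Sum>q\<in>UNIV. if p = i then if q = j then x else 0 else 0) = x"
proof -
  have "(\<Sum>q\<in>UNIV. if p = i then if q = j then x else 0 else 0) = (if p = i then x else 0)" for p
    by simp
  then show ?thesis by simp
qed

text \<open>Formulated for additive subgroups of any abelian group, so that the algebra and its
  matrices share the lemmas.\<close>

locale grading =
  fixes H :: "bit \<Rightarrow> 'a::ab_group_add set"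
  assumes H_0: "0 \<in> H d"
    and H_diff: "x \<in> H d \<Longrightarrow> y \<in> H d \<Longrightarrow> x - y \<in> H d"
    and H_disjoint: "H 0 \<inter> H 1 = {0}"
    and H_sum: "H 0 + H 1 = UNIV"
begin

lemma H_minus: "x \<in> H d \<Longrightarrow> - x \<in> H d"
  using H_diff[of 0 d x] H_0 by simp

lemma H_add: "x \<in> H d \<Longrightarrow> y \<in> H d \<Longrightarrow> x + y \<in> H d"
  using H_diff[of x d "- y"] H_minus by simp

lemma H_sgn_deg: "x \<in> H d \<Longrightarrow> sgn_deg e x \<in> H d"
  by (simp add: sgn_deg_def H_minus)

lemma hcomp_unique:
  assumes "y \<in> H d" "x - y \<in> H (d + 1)"
  shows "hcomp H d x = y"
  unfolding hcomp_def
proof (rule the_equality)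
  fix z
  assume z: "z \<in> H d \<and> x - z \<in> H (d + 1)"
  have "z - y \<in> H d" using z assms H_diff by blast
  moreover have "z - y \<in> H (d + 1)"
    using H_diff[of "x - y" "d + 1" "x - z"] z assms by simp
  ultimately have "z - y \<in> H 0 \<inter> H 1" by (cases d) auto
  then show "z = y" using H_disjoint by auto
qed (use assms in simp)

lemma hcomp_both: "hcomp H d x \<in> H d \<and> x - hcomp H d x \<in> H (d + 1)"
proof -
  have "x \<in> H 0 + H 1" using H_sum by simp
  then obtain a b where ab: "a \<in> H 0" "b \<in> H 1" "x = a + b"
    by (auto elim: set_plus_elim)
  have "\<exists>y. y \<in> H d \<and> x - y \<in> H (d + 1)"
  proof (cases d)
    assume "d = 0"
    then show ?thesis using ab by (intro exI[of _ a]) simp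
  next
    assume "d = 1"
    then show ?thesis using ab by (intro exI[of _ b]) simp
  qed
  then show ?thesis using hcomp_unique by metis
qed

lemma hcomp_mem [simp]: "hcomp H d x \<in> H d"
  using hcomp_both by blast

lemma hcomp_decomp: "hcomp H 0 x + hcomp H 1 x = x"
proof -
  have "hcomp H 1 x = x - hcomp H 0 x"
    by (rule hcomp_unique) (use hcomp_both[of 0 x] in \<open>auto\<close>)
  then show ?thesis by simp
qed

lemma hcomp_homogeneous: "x \<in> H d \<Longrightarrow> hcomp H e x = (if e = d then x else 0)"
proof (cases "e = d")
  case False
  assume "x \<in> H d"
  moreover have "e + 1 = d" using False by (cases e; cases d) auto
  ultimately show ?thesis using False H_0 by (simp add: hcomp_unique)
qed (simp add: hcomp_unique H_0)

lemma hcomp_add: "hcomp H d (x + y) = hcomp H d x + hcomp H d y"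
proof (rule hcomp_unique)
  show "x + y - (hcomp H d x + hcomp H d y) \<in> H (d + 1)"
    using H_add[of "x - hcomp H d x" "d + 1" "y - hcomp H d y"] hcomp_both[of d x] hcomp_both[of d y]
    by (simp add: algebra_simps)
qed (simp add: H_add)

lemma hcomp_commute:
  assumes "additive h" "\<And>d x. x \<in> H d \<Longrightarrow> h x \<in> H d"
  shows "hcomp H d (h x) = h (hcomp H d x)"
proof (rule hcomp_unique)
  show "h x - h (hcomp H d x) \<in> H (d + 1)"
    using assms(2)[of "x - hcomp H d x" "d + 1"] hcomp_both by (simp add: additive.diff[OF assms(1)])
qed (simp add: assms(2))

lemma homogeneous_induct [consumes 2, case_names homogeneous add]:
  assumes "x \<in> S" "\<And>d x. x \<in> S \<Longrightarrow> hcomp H d x \<in> S"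
    and "\<And>d x. x \<in> H d \<Longrightarrow> x \<in> S \<Longrightarrow> Q x"
    and "\<And>x y. x \<in> S \<Longrightarrow> y \<in> S \<Longrightarrow> Q x \<Longrightarrow> Q y \<Longrightarrow> Q (x + y)"
  shows "Q x"
proof -
  have "Q (hcomp H 0 x + hcomp H 1 x)"
    by (intro assms(4) assms(3)[OF hcomp_mem] assms(2) assms(1))
  then show ?thesis by (simp add: hcomp_decomp)
qed

lemma homogeneous_cases [consumes 0, case_names homogeneous add]:
  assumes "\<And>d x. x \<in> H d \<Longrightarrow> P x" "\<And>x y. P x \<Longrightarrow> P y \<Longrightarrow> P (x + y)"
  shows "P x"
  using assms hcomp_mem hcomp_decomp by metis

lemma homogeneous_disjoint: "x \<in> H 0 \<Longrightarrow> y \<in> H 1 \<Longrightarrow> x + y = 0 \<Longrightarrow> x = 0 \<and> y = 0"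
  using hcomp_add[of 0 x y] hcomp_add[of 1 x y] hcomp_homogeneous[of x 0] hcomp_homogeneous[of y 1]
    hcomp_homogeneous[of 0 0] H_0 by auto

lemma homogeneous_cases2 [consumes 0, case_names homogeneous add_left add_right]:
  assumes "\<And>d e x y. x \<in> H d \<Longrightarrow> y \<in> H e \<Longrightarrow> Q x y"
    and "\<And>x x' y. Q x y \<Longrightarrow> Q x' y \<Longrightarrow> Q (x + x') y"
    and "\<And>x y y'. Q x y \<Longrightarrow> Q x y' \<Longrightarrow> Q x (y + y')"
  shows "Q x y"
proof (induction x rule: homogeneous_cases)
  case x: (homogeneous d x)
  show ?case by (induction y rule: homogeneous_cases) (use assms x in blast)+
qed (rule assms(2))

lemma rho_homogeneous: "x \<in> H d \<Longrightarrow> rho H x = sgn_deg d x"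
  by (cases d) (simp_all add: rho_def sum_bit hcomp_homogeneous)

lemma rho_add: "rho H (x + y) = rho H x + rho H y"
  by (simp add: rho_def sum_bit hcomp_add)

end

locale graded_mult = grading H
  for H :: "bit \<Rightarrow> 'a::ab_group_add set" +
  fixes mul :: "'a \<Rightarrow> 'a \<Rightarrow> 'a"
  assumes mul_add_left: "mul (x + y) z = mul x z + mul y z"
    and mul_add_right: "mul x (y + z) = mul x y + mul x z"
begin

lemma mul_left_additive: "additive (\<lambda>x. mul x y)"
  by standard (rule mul_add_left)

lemma mul_right_additive: "additive (mul x)"
  by standard (rule mul_add_right)

lemmas mul_0_left [simp] = additive.zero[OF mul_left_additive]
lemmas mul_0_right [simp] = additive.zero[OF mul_right_additive]
lemmas mul_minus_left = additive.minus[OF mul_left_additive]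
lemmas mul_minus_right = additive.minus[OF mul_right_additive]
lemmas mul_diff_left = additive.diff[OF mul_left_additive]
lemmas mul_diff_right = additive.diff[OF mul_right_additive]

lemma supercomm_homogeneous:
  "x \<in> H d \<Longrightarrow> y \<in> H e \<Longrightarrow> supercomm H mul x y = mul x y - sgn_deg (d * e) (mul y x)"
  by (cases d; cases e) (simp_all add: supercomm_def sum_bit hcomp_homogeneous)

lemma supercomm_add_left: "supercomm H mul (x + y) z = supercomm H mul x z + supercomm H mul y z"
  by (simp add: supercomm_def sum_bit hcomp_add mul_add_left mul_add_right algebra_simps)

lemma supercomm_add_right: "supercomm H mul x (y + z) = supercomm H mul x y + supercomm H mul x z"
  by (simp add: supercomm_def sum_bit hcomp_add mul_add_left mul_add_right algebra_simps)

end

section \<open>Free modules\<close>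

lemma lookup_free_scale [simp]:
  "Poly_Mapping.lookup (free_scale c p) u = c * Poly_Mapping.lookup p u"
  by (simp add: free_scale_def map.rep_eq when_def)

lemma module_free_scale: "module (free_scale :: 'k::comm_ring_1 \<Rightarrow> ('a \<Rightarrow>\<^sub>0 'k) \<Rightarrow> _)"
  by standard (auto intro!: poly_mapping_eqI simp: lookup_add algebra_simps)

interpretation free: module "free_scale :: 'k::comm_ring_1 \<Rightarrow> ('a \<Rightarrow>\<^sub>0 'k) \<Rightarrow> _"
  by (rule module_free_scale)

lemma free_module_expand:
  "p = (\<Sum>u\<in>Poly_Mapping.keys p. free_scale (Poly_Mapping.lookup p u) (Poly_Mapping.single u 1))"
proof (rule poly_mapping_eqI)
  fix v
  show "Poly_Mapping.lookup p v = Poly_Mapping.lookup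
    (\<Sum>u\<in>Poly_Mapping.keys p. free_scale (Poly_Mapping.lookup p u) (Poly_Mapping.single u 1)) v"
    by (simp add: lookup_sum lookup_single when_def if_distrib[of "\<lambda>x. _ * x"] sum.delta
        in_keys_iff cong: if_cong)
qed

lemma free_module_induct [consumes 1, case_names zero gen add]:
  assumes "p \<in> free_module (A \<times> B)"
    and "P 0"
    and "\<And>c x y. x \<in> A \<Longrightarrow> y \<in> B \<Longrightarrow> P (free_scale c (gen x y))"
    and "\<And>p q. P p \<Longrightarrow> P q \<Longrightarrow> P (p + q)"
  shows "P p"
proof -
  have "P (\<Sum>u\<in>S. free_scale (Poly_Mapping.lookup p u) (Poly_Mapping.single u 1))"
    if "S \<subseteq> Poly_Mapping.keys p" for S
    using finite_subset[OF that finite_keys] that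
  proof (induction S)
    case empty
    then show ?case using assms(2) by simp
  next
    case (insert u S)
    have "u \<in> A \<times> B" using insert assms(1) by (auto simp: free_module_def)
    then have "P (free_scale (Poly_Mapping.lookup p u) (Poly_Mapping.single u 1))"
      using assms(3) by (auto simp: gen_def)
    then show ?case using insert assms(4) by simp
  qed
  from this[OF subset_refl] show ?thesis using free_module_expand by metis
qed

lemma free_lift_superset:
  assumes "module sc" "finite S" "Poly_Mapping.keys p \<subseteq> S"
  shows "free_lift sc f p = (\<Sum>u\<in>S. sc (Poly_Mapping.lookup p u) (f u))"
  unfolding free_lift_def
  by (rule sum.mono_neutral_left)
    (use assms in \<open>auto simp: in_keys_iff module.scale_zero_left\<close>)

lemma free_lift_add:
  assumes "module sc"
  shows "free_lift sc f (p + q) = free_lift sc f p + free_lift sc f q"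
proof -
  let ?S = "Poly_Mapping.keys p \<union> Poly_Mapping.keys q"
  have "Poly_Mapping.keys (p + q) \<subseteq> ?S" by (rule Poly_Mapping.keys_add)
  then show ?thesis
    by (simp add: free_lift_superset[OF assms, of ?S] lookup_add
        module.scale_left_distrib[OF assms] sum.distrib)
qed

lemma free_lift_scale:
  assumes "module sc"
  shows "free_lift sc f (free_scale c p) = sc c (free_lift sc f p)"
proof -
  have "Poly_Mapping.keys (free_scale c p) \<subseteq> Poly_Mapping.keys p"
    by (auto simp: in_keys_iff)
  then show ?thesis
    by (simp add: free_lift_superset[OF assms, of "Poly_Mapping.keys p"]
        module.scale_sum_right[OF assms] module.scale_scale[OF assms])
qed

lemma free_lift_gen:
  assumes "module sc"
  shows "free_lift sc f (gen x y) = f (x, y)"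
  by (simp add: free_lift_superset[OF assms, of "{(x, y)}"] gen_def module.scale_one[OF assms])

lemma module_hom_free_lift: "module sc \<Longrightarrow> module_hom free_scale sc (free_lift sc f)"
  by (simp add: module_hom_iff module_free_scale free_lift_add free_lift_scale)

lemma gen_in_free_module: "x \<in> A \<Longrightarrow> y \<in> B \<Longrightarrow> gen x y \<in> free_module (A \<times> B)"
  by (auto simp: gen_def free_module_def)

lemma subspace_free_module: "free.subspace (free_module S :: ('a \<Rightarrow>\<^sub>0 'k::comm_ring_1) set)"
  unfolding free.subspace_def free_module_def
proof (intro conjI ballI allI)
  fix c :: 'k and p q :: "'a \<Rightarrow>\<^sub>0 'k"
  assume p: "p \<in> {p. Poly_Mapping.keys p \<subseteq> S}"
  have "Poly_Mapping.keys (free_scale c p) \<subseteq> Poly_Mapping.keys p"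
    by (auto simp: in_keys_iff)
  then show "free_scale c p \<in> {p. Poly_Mapping.keys p \<subseteq> S}"
    using p by blast
  assume "q \<in> {p. Poly_Mapping.keys p \<subseteq> S}"
  then show "p + q \<in> {p. Poly_Mapping.keys p \<subseteq> S}"
    using p Poly_Mapping.keys_add[of p q] by blast
qed simp

lemma tensor_rels_add:
  assumes "tensor_rels sc M \<subseteq> S" "x \<in> M" "x' \<in> M" "y \<in> M"
  shows "gen (x + x') y - gen x y - gen x' y \<in> S" "gen y (x + x') - gen y x - gen y x' \<in> S"
  by (rule subsetD[OF assms(1)], unfold tensor_rels_def, use assms(2-) in blast)+

lemma tensor_rels_scale:
  assumes "tensor_rels sc M \<subseteq> S" "x \<in> M" "y \<in> M"
  shows "gen (sc c x) y - free_scale c (gen x y) \<in> S" "gen x (sc c y) - free_scale c (gen x y) \<in> S"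
  by (rule subsetD[OF assms(1)], unfold tensor_rels_def, use assms(2-) in blast)+

text \<open>Modulo the tensor relations, coefficients are absorbed into the first factor.\<close>

lemma free_module_mod_tensor_rels_induct [consumes 2, case_names cong gen add]:
  assumes p: "p \<in> free_module (M \<times> M)"
    and M: "module sc" "module.subspace sc M"
    and W: "free.subspace W" "tensor_rels sc M \<subseteq> W"
    and cong: "\<And>p q. P p \<Longrightarrow> q - p \<in> W \<Longrightarrow> P q"
    and gen: "\<And>x y. x \<in> M \<Longrightarrow> y \<in> M \<Longrightarrow> P (gen x y)"
    and add: "\<And>p q. P p \<Longrightarrow> P q \<Longrightarrow> P (p + q)"
  shows "P p"
proof -
  interpret sc: module sc by (rule M(1))
  have scaled: "P (free_scale c (gen x y))" if "x \<in> M" "y \<in> M" for c x y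
  proof (rule cong)
    show "P (gen (sc c x) y)" using gen that sc.subspace_scale[OF M(2)] by blast
    have "gen (sc c x) y - free_scale c (gen x y) \<in> W"
      by (rule tensor_rels_scale(1)[OF W(2) that])
    from free.subspace_neg[OF W(1) this]
    show "free_scale c (gen x y) - gen (sc c x) y \<in> W" by simp
  qed
  show ?thesis
    using p
  proof (induction rule: free_module_induct)
    case zero
    then show ?case using scaled[of 0 0 0] sc.subspace_0[OF M(2)] by simp
  qed (use scaled add in auto)
qed

section \<open>Matrices over a superalgebra with superinvolution\<close>

context superalgebra_superinvolution
begin

sublocale G: graded_mult G "(*)"
proof
  show "0 \<in> G d" for d using grading_subspace subspace_0 by blast
  show "x - y \<in> G d" if "x \<in> G d" "y \<in> G d" for x y d
    using that grading_subspace subspace_diff by blast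
qed (use grading_disjoint grading_sum in \<open>auto simp: algebra_simps\<close>)

sublocale bar: module_hom sc sc bar
  by (rule bar_linear)

lemma bar_additive: "additive bar"
  by standard (rule bar.add)

lemma bar_sgn_deg: "bar (sgn_deg d x) = sgn_deg d (bar x)"
  by (rule additive.sgn_deg[OF bar_additive])

lemma sc_G: "x \<in> G d \<Longrightarrow> sc c x \<in> G d"
  using grading_subspace subspace_scale by blast

lemma hcomp_sc: "hcomp G d (sc c x) = sc c (hcomp G d x)"
  by (rule G.hcomp_commute) (auto simp: additive_def scale_right_distrib sc_G)

lemma rho_sc: "rho G (sc c x) = sc c (rho G x)"
  by (simp add: rho_def sum_bit hcomp_sc scale_right_diff_distrib)

definition un :: 'r
  where "un = (SOME u. \<forall>a. u * a = a \<and> a * u = a)"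

lemma un_mult [simp]: "un * a = a" "a * un = a"
  using someI_ex[OF unital] unfolding un_def by auto

text \<open>Let u and v be the even and odd parts of the unit. Comparing degrees in u a + v a = a
  shows that v annihilates every homogeneous a, hence v = v (u + v) = 0.\<close>

lemma un_G [simp]: "un \<in> G 0"
proof -
  let ?u = "hcomp G 0 un" and ?v = "hcomp G 1 un"
  have v: "?v * a = 0" if "a \<in> G d" for a d
  proof -
    have "?u * a + ?v * a = a"
      by (simp add: G.hcomp_decomp flip: distrib_right)
    then have eq: "?v * a = a - ?u * a" by (simp add: algebra_simps)
    have "?u * a \<in> G (0 + d)" "?v * a \<in> G (1 + d)"
      using that by (intro grading_mult; simp)+
    then have "a - ?u * a \<in> G d" "?v * a \<in> G (1 + d)"
      using that G.H_diff by auto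
    with eq have "?v * a \<in> G 0 \<inter> G 1" by (cases d) auto
    then show ?thesis using grading_disjoint by auto
  qed
  have "?v * (?u + ?v) = 0"
    using v[of ?u 0] v[of ?v 1] by (simp add: distrib_left)
  then have "?v = 0" by (simp add: G.hcomp_decomp)
  then have "?u = un" using G.hcomp_decomp[of un] by simp
  then show ?thesis using G.hcomp_mem[of 0 un] by simp
qed

lemma bar_un [simp]: "bar un = un"
proof -
  have "bar (un * bar un) = bar (bar un) * bar un"
    using bar_mult[of un 0 "bar un" 0] bar_degree[OF un_G] by simp
  then show ?thesis by (simp add: bar_bar)
qed

end

section \<open>Index combinatorics and matrix units of the ortho-symplectic form\<close>

fun ip :: "('m, 'n) idx \<Rightarrow> ('m, 'n) idx" where
  "ip (Inl i) = Inl i"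
| "ip (Inr (Inl k)) = Inr (Inr k)"
| "ip (Inr (Inr k)) = Inr (Inl k)"

text \<open>Labels the second symplectic block; the sign of the alternating form enters
  \<open>star_sgn\<close> through it.\<close>

fun tau :: "('m, 'n) idx \<Rightarrow> bit" where
  "tau (Inl i) = 0"
| "tau (Inr (Inl k)) = 0"
| "tau (Inr (Inr k)) = 1"

text \<open>The classes are the orbits of \<open>ip\<close>, the permutation by which
  \<open>st\<close> mirrors matrix positions. Two units whose indices lie in different classes do
  not see each other's mirror images.\<close>

fun cl :: "('m, 'n) idx \<Rightarrow> 'm + 'n" where
  "cl (Inl i) = Inl i"
| "cl (Inr (Inl k)) = Inr k"
| "cl (Inr (Inr k)) = Inr k"

lemma idx_cases [case_names orth sympl sympl']:
  obtains i where "p = Inl i" | k where "p = Inr (Inl k)" | k where "p = Inr (Inr k)"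
  by (metis sum.exhaust)

lemma ip_ip [simp]: "ip (ip p) = p"
  by (cases p rule: idx_cases) simp_all

lemma ip_eq_iff [simp]: "ip p = ip q \<longleftrightarrow> p = q"
  by (metis ip_ip)

lemma idx_deg_ip [simp]: "idx_deg (ip p) = idx_deg p"
  by (cases p rule: idx_cases) simp_all

lemma cl_ip [simp]: "cl (ip p) = cl p"
  by (cases p rule: idx_cases) simp_all

lemma ip_eq_Inl [simp]: "ip p = Inl i \<longleftrightarrow> p = Inl i" "Inl i = ip p \<longleftrightarrow> p = Inl i"
  by (cases p rule: idx_cases; auto)+

lemma cl_eq_iff: "cl p = cl q \<longleftrightarrow> p = q \<or> p = ip q"
  by (cases p rule: idx_cases; cases q rule: idx_cases) auto

lemma bij_ip: "bij ip"
  by (metis bijI' ip_ip)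

lemma surj_cl: "\<exists>p. cl p = c"
  by (cases c) (auto intro: exI[of _ "Inl _"] exI[of _ "Inr (Inl _)"])

text \<open>The signs in the definition of \<^const>\<open>osp_op\<close>, for a matrix of degree \<open>d\<close>.\<close>

definition star_sgn :: "bit \<Rightarrow> ('m, 'n) idx \<Rightarrow> ('m, 'n) idx \<Rightarrow> bit"
  where "star_sgn d i j =
    tau i + tau j + (1 + idx_deg i) * idx_deg j + (d + 1) * (idx_deg i + idx_deg j)"

definition E :: "('m, 'n) idx \<Rightarrow> ('m, 'n) idx \<Rightarrow> 'r::ring \<Rightarrow> ('r, 'm::finite, 'n::finite) mat"
  where "E p q a = (\<chi> i j. if i = p \<and> j = q then a else 0)"

lemma E_nth [simp]: "E p q a $ i $ j = (if i = p \<and> j = q then a else 0)"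
  by (simp add: E_def)

lemma mat_eq_iff: "X = Y \<longleftrightarrow> (\<forall>i j. X $ i $ j = Y $ i $ j)"
  by (simp add: vec_eq_iff)

lemma E_add: "E p q (a + b) = E p q a + E p q b"
  by (simp add: mat_eq_iff)

lemma mat_expand: "(X :: ('r::ring, 'm::finite, 'n::finite) mat) = (\<Sum>p\<in>UNIV. \<Sum>q\<in>UNIV. E p q (X $ p $ q))"
proof -
  have "(\<Sum>p\<in>UNIV. \<Sum>q\<in>UNIV. if i = p \<and> j = q then X $ p $ q else 0)
      = (\<Sum>p\<in>UNIV. \<Sum>q\<in>UNIV. if p = i then if q = j then X $ i $ j else 0 else 0)" for i j
    by (intro sum.cong refl) auto
  then show ?thesis by (simp add: mat_eq_iff sum_delta2)
qed

lemma mat_mult_nth: "mat_mult X Y $ i $ j = (\<Sum>k\<in>UNIV. X $ i $ k * Y $ k $ j)"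
  by (simp add: mat_mult_def)

lemma mat_mult_assoc: "mat_mult (mat_mult X Y) Z = mat_mult X (mat_mult Y Z)"
proof -
  have "(\<Sum>k\<in>UNIV. (\<Sum>l\<in>UNIV. X $ i $ l * Y $ l $ k) * Z $ k $ j)
      = (\<Sum>l\<in>UNIV. X $ i $ l * (\<Sum>k\<in>UNIV. Y $ l $ k * Z $ k $ j))" for i j
    unfolding sum_distrib_left sum_distrib_right
    by (subst sum.swap) (simp add: mult.assoc)
  then show ?thesis by (simp add: mat_eq_iff mat_mult_nth)
qed

lemma mat_mult_add_left: "mat_mult (X + Y) Z = mat_mult X Z + mat_mult Y Z"
  and mat_mult_add_right: "mat_mult X (Y + Z) = mat_mult X Y + mat_mult X Z"
  by (simp_all add: mat_eq_iff mat_mult_nth algebra_simps sum.distrib)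

lemma E_mult_nth: "mat_mult (E p q a) Y $ i $ j = (if i = p then a * Y $ q $ j else 0)"
proof -
  have "(\<Sum>k\<in>UNIV. (if i = p \<and> k = q then a else 0) * Y $ k $ j)
      = (\<Sum>k\<in>UNIV. if k = q then (if i = p then a * Y $ k $ j else 0) else 0)"
    by (rule sum.cong) auto
  then show ?thesis by (simp add: mat_mult_nth)
qed

lemma mult_E_nth: "mat_mult Y (E p q a) $ i $ j = (if j = q then Y $ i $ p * a else 0)"
proof -
  have "(\<Sum>k\<in>UNIV. Y $ i $ k * (if k = p \<and> j = q then a else 0))
      = (\<Sum>k\<in>UNIV. if k = p then (if j = q then Y $ i $ k * a else 0) else 0)"
    by (rule sum.cong) auto
  then show ?thesis by (simp add: mat_mult_nth)
qed

text \<open>The elements \<open>i1\<close> and \<open>k1\<close> name one orthogonal and one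
  symplectic index; they serve as the base point \<open>o1\<close> and as the reference index
  \<open>q0\<close>.\<close>

locale osp_setup = superalgebra_superinvolution sc G bar
  for sc :: "'k::comm_ring_1 \<Rightarrow> 'r::ring \<Rightarrow> 'r"
    and G :: "bit \<Rightarrow> 'r set"
    and bar :: "'r \<Rightarrow> 'r" +
  fixes i1 :: "'m::finite" and k1 :: "'n::finite"
  assumes two_unit: "(2::'k) dvd 1"
    and dims: "(CARD('m), CARD('n)) \<notin> {(1, 1), (2, 1)}"
begin

abbreviation GG :: "bit \<Rightarrow> ('r, 'm, 'n) mat set"
  where "GG \<equiv> mat_grading G"

abbreviation br :: "('r, 'm, 'n) mat \<Rightarrow> ('r, 'm, 'n) mat \<Rightarrow> ('r, 'm, 'n) mat"
  where "br \<equiv> mat_bracket G"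

abbreviation st :: "('r, 'm, 'n) mat \<Rightarrow> ('r, 'm, 'n) mat"
  where "st \<equiv> osp_op G bar"

abbreviation K :: "('r, 'm, 'n) mat set"
  where "K \<equiv> osp_tilde G bar"

abbreviation L :: "('r, 'm, 'n) mat set"
  where "L \<equiv> osp sc G bar"

abbreviation msc :: "'k \<Rightarrow> ('r, 'm, 'n) mat \<Rightarrow> ('r, 'm, 'n) mat"
  where "msc \<equiv> mat_scale sc"

lemma mat_grading_sum: "GG 0 + GG 1 = UNIV"
proof -
  have "X \<in> GG 0 + GG 1" for X :: "('r, 'm, 'n) mat"
  proof -
    define Y where "Y d = (\<chi> i j. hcomp G (d + idx_deg i + idx_deg j) (X $ i $ j))" for d
    have "Y 0 \<in> GG 0" "Y 1 \<in> GG 1" by (simp_all add: Y_def mat_grading_def)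
    moreover have "hcomp G d x + hcomp G (1 + d) x = x" for d x
      using G.hcomp_decomp[of x] by (cases d) (auto simp: add.commute)
    then have "X = Y 0 + Y 1" by (simp add: mat_eq_iff Y_def add.assoc)
    ultimately show ?thesis by (metis set_plus_intro)
  qed
  then show ?thesis by auto
qed

sublocale GG: graded_mult GG mat_mult
proof
  show "GG 0 + GG 1 = UNIV" by (rule mat_grading_sum)
  show "GG 0 \<inter> GG 1 = {0}"
  proof -
    have "x = 0" if "x \<in> G (0 + d)" "x \<in> G (1 + d)" for d x
      using that grading_disjoint by (cases d) auto
    then have "x = 0" if "x \<in> G (0 + d + e)" "x \<in> G (1 + d + e)" for d e x
      using that by (metis add.assoc)
    then show ?thesis
      by (fastforce simp: mat_grading_def mat_eq_iff G.H_0 simp del: add_0)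
  qed
qed (auto simp: mat_grading_def G.H_0 G.H_diff mat_mult_add_left mat_mult_add_right)

sublocale msc: module msc
  by standard (simp_all add: mat_scale_def mat_eq_iff scale_right_distrib scale_left_distrib)

lemma msc_nth [simp]: "msc c X $ i $ j = sc c (X $ i $ j)"
  by (simp add: mat_scale_def)

lemma msc_GG: "X \<in> GG d \<Longrightarrow> msc c X \<in> GG d"
  by (simp add: mat_grading_def sc_G)

lemma msc_E: "msc c (E p q a) = E p q (sc c a)"
  by (simp add: mat_eq_iff)

lemma subspace_GG: "msc.subspace (GG d)"
  by (auto intro!: msc.subspaceI simp: GG.H_0 GG.H_add msc_GG)

lemma mat_mult_msc_left: "mat_mult (msc c X) Y = msc c (mat_mult X Y)"
  and mat_mult_msc_right: "mat_mult X (msc c Y) = msc c (mat_mult X Y)"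
  by (simp_all add: mat_eq_iff mat_mult_nth scale_mult_left scale_mult_right scale_sum_right)

lemma hcomp_msc: "hcomp GG d (msc c X) = msc c (hcomp GG d X)"
  by (rule GG.hcomp_commute) (auto simp: additive_def msc.scale_right_distrib msc_GG)

lemma mat_mult_GG: "X \<in> GG d \<Longrightarrow> Y \<in> GG e \<Longrightarrow> mat_mult X Y \<in> GG (d + e)"
proof -
  assume X: "X \<in> GG d" and Y: "Y \<in> GG e"
  have "X $ i $ k * Y $ k $ j \<in> G (d + e + idx_deg i + idx_deg j)" for i j k
  proof -
    have "X $ i $ k * Y $ k $ j \<in> G ((d + idx_deg i + idx_deg k) + (e + idx_deg k + idx_deg j))"
      using X Y by (intro grading_mult) (auto simp: mat_grading_def)
    also have "(d + idx_deg i + idx_deg k) + (e + idx_deg k + idx_deg j) = d + e + idx_deg i + idx_deg j"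
      by (cases "idx_deg k") (auto simp: algebra_simps)
    finally show ?thesis .
  qed
  then have "mat_mult X Y $ i $ j \<in> G (d + e + idx_deg i + idx_deg j)" for i j
    unfolding mat_mult_nth by (intro subspace_sum grading_subspace)
  then show ?thesis by (simp add: mat_grading_def)
qed

lemma br_GG: "X \<in> GG d \<Longrightarrow> Y \<in> GG e \<Longrightarrow> br X Y \<in> GG (d + e)"
  using mat_mult_GG[of X d Y e] mat_mult_GG[of Y e X d]
  by (simp add: GG.supercomm_homogeneous GG.H_diff GG.H_sgn_deg add.commute)

lemma msc_sgn_deg: "msc c (sgn_deg d X) = sgn_deg d (msc c X)"
  by (simp add: sgn_deg_def)

lemma br_msc_left: "br (msc c X) Y = msc c (br X Y)"
  and br_msc_right: "br X (msc c Y) = msc c (br X Y)"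
  by (simp_all add: supercomm_def sum_bit hcomp_msc mat_mult_msc_left mat_mult_msc_right
      msc.scale_right_distrib msc.scale_right_diff_distrib msc_sgn_deg)

lemma br_skew: "X \<in> GG d \<Longrightarrow> Y \<in> GG e \<Longrightarrow> br X Y = - sgn_deg (d * e) (br Y X)"
  by (simp add: GG.supercomm_homogeneous sgn_deg_diff mult.commute)

lemma br_jacobi:
  assumes "X \<in> GG d" "Y \<in> GG e" "Z \<in> GG f"
  shows "sgn_deg (d * f) (br (br X Y) Z) + sgn_deg (e * d) (br (br Y Z) X)
    + sgn_deg (f * e) (br (br Z X) Y) = 0"
proof -
  have XY: "br X Y \<in> GG (d + e)" and YZ: "br Y Z \<in> GG (e + f)" and ZX: "br Z X \<in> GG (f + d)"
    using assms by (auto intro: br_GG)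
  have "br (br X Y) Z = mat_mult (br X Y) Z - sgn_deg ((d + e) * f) (mat_mult Z (br X Y))"
    "br (br Y Z) X = mat_mult (br Y Z) X - sgn_deg ((e + f) * d) (mat_mult X (br Y Z))"
    "br (br Z X) Y = mat_mult (br Z X) Y - sgn_deg ((f + d) * e) (mat_mult Y (br Z X))"
    using assms XY YZ ZX by (simp_all only: GG.supercomm_homogeneous)
  moreover have "br X Y = mat_mult X Y - sgn_deg (d * e) (mat_mult Y X)"
    "br Y Z = mat_mult Y Z - sgn_deg (e * f) (mat_mult Z Y)"
    "br Z X = mat_mult Z X - sgn_deg (f * d) (mat_mult X Z)"
    using assms by (simp_all only: GG.supercomm_homogeneous)
  ultimately show ?thesis
    by (cases d; cases e; cases f)
      (simp_all add: GG.mul_diff_left GG.mul_diff_right GG.mul_minus_left GG.mul_minus_right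
        GG.mul_add_left GG.mul_add_right mat_mult_assoc)
qed

end

context osp_setup
begin

subsection \<open>The orthosymplectic superinvolution\<close>

lemma st_nth:
  assumes "X \<in> GG d"
  shows "st X $ i $ j = sgn_deg (star_sgn d i j) (bar (X $ ip j $ ip i))"
proof -
  have r: "rho G (X $ i $ j) = sgn_deg (d + idx_deg i + idx_deg j) (X $ i $ j)" for i j
    using assms by (intro G.rho_homogeneous) (simp add: mat_grading_def)
  show ?thesis
    by (cases i rule: idx_cases; cases j rule: idx_cases; cases d)
      (simp_all add: osp_op_def star_sgn_def r bar.neg)
qed

lemma osp_entry_add: "osp_entry G bar (X + Y) i j = osp_entry G bar X i j + osp_entry G bar Y i j"
  by (cases i rule: idx_cases; cases j rule: idx_cases) (simp_all add: G.rho_add bar.add)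

lemma osp_entry_msc: "osp_entry G bar (msc c X) i j = sc c (osp_entry G bar X i j)"
  by (cases i rule: idx_cases; cases j rule: idx_cases) (simp_all add: rho_sc bar.scale)

lemma st_add: "st (X + Y) = st X + st Y"
  by (simp add: osp_op_def mat_eq_iff osp_entry_add)

lemma st_msc: "st (msc c X) = msc c (st X)"
  by (simp add: osp_op_def mat_eq_iff osp_entry_msc)

sublocale st: module_hom msc msc st
  by (simp add: module_hom_iff msc.module_axioms st_add st_msc)

lemma st_additive: "additive st"
  by standard (rule st_add)

lemmas st_sgn_deg = additive.sgn_deg[OF st_additive]

lemma st_GG: "X \<in> GG d \<Longrightarrow> st X \<in> GG d"
proof -
  assume X: "X \<in> GG d"
  have "sgn_deg e (bar (X $ ip j $ ip i)) \<in> G (d + idx_deg i + idx_deg j)" for i j e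
  proof (intro G.H_sgn_deg bar_degree)
    have "X $ ip j $ ip i \<in> G (d + idx_deg (ip j) + idx_deg (ip i))"
      using X unfolding mat_grading_def by blast
    then show "X $ ip j $ ip i \<in> G (d + idx_deg i + idx_deg j)"
      by (simp add: algebra_simps)
  qed
  then show ?thesis by (simp add: mat_grading_def st_nth[OF X])
qed

lemma star_sgn_involutive: "star_sgn d i j + star_sgn d (ip j) (ip i) = 0"
  by (cases i rule: idx_cases; cases j rule: idx_cases; cases d) (simp_all add: star_sgn_def)

lemma st_st [simp]: "st (st X) = X"
proof (induction X rule: GG.homogeneous_cases)
  case (homogeneous d X)
  then show ?case
    by (simp add: mat_eq_iff st_nth[OF st_GG[OF homogeneous]] st_nth[OF homogeneous] bar_sgn_deg
        bar_bar star_sgn_involutive)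
next
  case (add X Y)
  then show ?case by (simp add: st_add)
qed

text \<open>The sign count behind \<open>st_mult\<close>: the Koszul sign of the two entries that
  meet at the intermediate index k turns the sign of the product into the signs of the
  factors.\<close>

lemma star_sgn_mult:
  "star_sgn (d + e) i j + (d + idx_deg j + idx_deg k) * (e + idx_deg k + idx_deg i)
    = d * e + star_sgn e i (ip k) + star_sgn d (ip k) j"
  by (cases i rule: idx_cases; cases j rule: idx_cases; cases k rule: idx_cases; cases d; cases e)
    (simp_all add: star_sgn_def)

lemma st_mult:
  assumes X: "X \<in> GG d" and Y: "Y \<in> GG e"
  shows "st (mat_mult X Y) = sgn_deg (d * e) (mat_mult (st Y) (st X))"
proof -
  have *: "sgn_deg (star_sgn (d + e) i j) (bar (X $ ip j $ k * Y $ k $ ip i))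
    = sgn_deg (d * e) (st Y $ i $ ip k * st X $ ip k $ j)" for i j k
  proof -
    have "X $ ip j $ k \<in> G (d + idx_deg j + idx_deg k)" "Y $ k $ ip i \<in> G (e + idx_deg k + idx_deg i)"
      using X Y unfolding mat_grading_def by (metis (mono_tags, lifting) idx_deg_ip mem_Collect_eq)+
    then have "bar (X $ ip j $ k * Y $ k $ ip i)
      = sgn_deg ((d + idx_deg j + idx_deg k) * (e + idx_deg k + idx_deg i))
          (bar (Y $ k $ ip i) * bar (X $ ip j $ k))"
      by (rule bar_mult)
    then show ?thesis
      by (simp only: st_nth[OF X] st_nth[OF Y] sgn_deg_mult_left sgn_deg_mult_right sgn_deg_sgn_deg
          star_sgn_mult ip_ip) (simp only: add.assoc add.commute add.left_commute)
  qed
  have "st (mat_mult X Y) $ i $ j = sgn_deg (d * e) (mat_mult (st Y) (st X)) $ i $ j" for i j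
  proof -
    have "st (mat_mult X Y) $ i $ j
      = (\<Sum>k\<in>UNIV. sgn_deg (star_sgn (d + e) i j) (bar (X $ ip j $ k * Y $ k $ ip i)))"
      by (simp add: st_nth[OF mat_mult_GG[OF X Y]] mat_mult_nth bar.sum sgn_deg_sum)
    also have "\<dots> = (\<Sum>k\<in>UNIV. sgn_deg (d * e) (st Y $ i $ ip k * st X $ ip k $ j))"
      by (simp only: *)
    also have "\<dots> = (\<Sum>k\<in>UNIV. sgn_deg (d * e) (st Y $ i $ k * st X $ k $ j))"
      by (rule sum.reindex_bij_betw[OF bij_ip])
    also have "\<dots> = sgn_deg (d * e) (mat_mult (st Y) (st X) $ i $ j)"
      by (simp add: mat_mult_nth sgn_deg_sum)
    finally show ?thesis by (simp add: sgn_deg_def)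
  qed
  then show ?thesis by (simp add: mat_eq_iff)
qed

lemma E_GG: "a \<in> G d \<Longrightarrow> E p q a \<in> GG (d + idx_deg p + idx_deg q)"
  by (simp add: mat_grading_def G.H_0 add.assoc)

definition dual :: "bit \<Rightarrow> ('m, 'n) idx \<Rightarrow> ('m, 'n) idx \<Rightarrow> 'r \<Rightarrow> 'r"
  where "dual d p q a = sgn_deg (star_sgn (d + idx_deg p + idx_deg q) (ip q) (ip p)) (bar a)"

lemma st_E: "a \<in> G d \<Longrightarrow> st (E p q a) = E (ip q) (ip p) (dual d p q a)"
  by (auto simp: mat_eq_iff st_nth[OF E_GG[of a d]] dual_def)

lemma dual_G: "a \<in> G d \<Longrightarrow> dual d p q a \<in> G d"
  by (simp add: dual_def G.H_sgn_deg bar_degree)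

subsection \<open>The skew elements\<close>

definition T :: "('r, 'm, 'n) mat \<Rightarrow> ('r, 'm, 'n) mat"
  where "T X = X - st X"

definition tt :: "('m, 'n) idx \<Rightarrow> ('m, 'n) idx \<Rightarrow> 'r \<Rightarrow> ('r, 'm, 'n) mat"
  where "tt p q a = T (E p q a)"

definition hf :: 'k
  where "hf = (SOME c. 2 * c = 1)"

lemma two_hf: "2 * hf = 1"
proof -
  have "\<exists>c::'k. 2 * c = 1" using two_unit unfolding dvd_def by metis
  then show ?thesis unfolding hf_def by (rule someI_ex)
qed

lemma hf_hf [simp]: "hf + hf = 1"
  by (rule two_hf[unfolded mult_2])

lemma sc_hf_add: "sc hf a + sc hf a = a"
  using scale_left_distrib[of hf hf a] by simp

lemma msc_hf_add: "msc hf X + msc hf X = X"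
  using msc.scale_left_distrib[of hf hf X] by simp

lemma T_add: "T (X + Y) = T X + T Y"
  by (simp add: T_def st_add)

lemma T_msc: "T (msc c X) = msc c (T X)"
  by (simp add: T_def st_msc msc.scale_right_diff_distrib)

lemma T_additive: "additive T"
  by standard (rule T_add)

lemmas T_minus = additive.minus[OF T_additive]
lemmas T_diff = additive.diff[OF T_additive]
lemmas T_zero [simp] = additive.zero[OF T_additive]
lemmas T_sum = additive.sum[OF T_additive]
lemmas T_sgn_deg = additive.sgn_deg[OF T_additive]

lemma T_GG: "X \<in> GG d \<Longrightarrow> T X \<in> GG d"
  by (simp add: T_def GG.H_diff st_GG)

lemma K_iff: "X \<in> K \<longleftrightarrow> st X = - X"
  by (simp add: osp_tilde_def)

lemma T_K [simp]: "T X \<in> K"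
  by (simp add: K_iff T_def st.diff)

lemma T_st: "T (st X) = - T X"
  by (simp add: T_def)

text \<open>Invertibility of 2 makes every skew matrix a value of \<open>T\<close>, so that brackets
  of skew matrices can be computed with \<open>br_T\<close>.\<close>

lemma K_T_half: "X \<in> K \<Longrightarrow> T (msc hf X) = X"
  by (simp add: K_iff T_def st_msc msc_hf_add)

lemma subspace_K: "msc.subspace K"
  by (auto intro!: msc.subspaceI simp: K_iff st_add st_msc st.zero)

lemma hcomp_K: "X \<in> K \<Longrightarrow> hcomp GG d X \<in> K"
  using GG.hcomp_commute[OF st_additive st_GG, of d X] hcomp_msc[of d "-1" X] by (simp add: K_iff)

lemma K_homogeneous_induct [consumes 1, case_names homogeneous add]:
  assumes "X \<in> K" "\<And>d X. X \<in> GG d \<Longrightarrow> X \<in> K \<Longrightarrow> Q X" "\<And>X Y. Q X \<Longrightarrow> Q Y \<Longrightarrow> Q (X + Y)"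
  shows "Q X"
  by (rule GG.homogeneous_induct[OF assms(1)], erule hcomp_K, erule (1) assms(2), rule assms(3))

text \<open>Since \<open>st\<close> reverses products and negates Y, it commutes with bracketing by
  Y. Hence only the products of X itself with Y have to be computed, not those of
  \<open>st X\<close>.\<close>

lemma br_T:
  assumes X: "X \<in> GG d" and Y: "Y \<in> GG e" "Y \<in> K"
  shows "br (T X) Y = T (mat_mult X Y - sgn_deg (d * e) (mat_mult Y X))"
proof -
  have "st Y = - Y" using Y(2) by (simp add: K_iff)
  then show ?thesis
    unfolding GG.supercomm_homogeneous[OF T_GG[OF X] Y(1)]
    by (simp add: T_def st.diff st_sgn_deg st_mult[OF X Y(1)] st_mult[OF Y(1) X] GG.mul_diff_left
        GG.mul_diff_right GG.mul_minus_left GG.mul_minus_right sgn_deg_diff sgn_deg_minus mult.commute[of e d])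
qed

lemma br_K: "X \<in> K \<Longrightarrow> Y \<in> K \<Longrightarrow> br X Y \<in> K"
proof (induction X rule: K_homogeneous_induct)
  case X: (homogeneous d X)
  from \<open>Y \<in> K\<close> show ?case
  proof (induction Y rule: K_homogeneous_induct)
    case (homogeneous e Y)
    have "br (T (msc hf X)) Y \<in> K"
      by (subst br_T[OF msc_GG[OF X(1)] homogeneous]) simp
    then show ?case using K_T_half[OF X(2)] by simp
  next
    case (add Y Z)
    then show ?case by (simp add: GG.supercomm_add_right msc.subspace_add[OF subspace_K])
  qed
next
  case (add X Z)
  then show ?case by (simp add: GG.supercomm_add_left msc.subspace_add[OF subspace_K])
qed

lemma L_def: "L = msc.span {br X Y | X Y. X \<in> K \<and> Y \<in> K}"
  by (rule osp_def)

lemma subspace_L: "msc.subspace L"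
  unfolding L_def by (rule msc.subspace_span)

lemma L_0 [simp]: "0 \<in> L" by (rule msc.subspace_0[OF subspace_L])
lemma L_add: "X \<in> L \<Longrightarrow> Y \<in> L \<Longrightarrow> X + Y \<in> L" by (rule msc.subspace_add[OF subspace_L])
lemma L_diff: "X \<in> L \<Longrightarrow> Y \<in> L \<Longrightarrow> X - Y \<in> L" by (rule msc.subspace_diff[OF subspace_L])
lemma L_minus: "X \<in> L \<Longrightarrow> - X \<in> L" by (rule msc.subspace_neg[OF subspace_L])
lemma L_msc: "X \<in> L \<Longrightarrow> msc c X \<in> L" by (rule msc.subspace_scale[OF subspace_L])
lemma L_sum: "(\<And>x. x \<in> A \<Longrightarrow> f x \<in> L) \<Longrightarrow> sum f A \<in> L" by (rule msc.subspace_sum[OF subspace_L])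
lemma L_sgn_deg: "X \<in> L \<Longrightarrow> sgn_deg d X \<in> L" by (simp add: sgn_deg_def L_minus)

lemma br_K_L: "X \<in> K \<Longrightarrow> Y \<in> K \<Longrightarrow> br X Y \<in> L"
  unfolding L_def by (rule msc.span_base) blast

lemma L_subset_K: "L \<subseteq> K"
  unfolding L_def by (rule msc.span_minimal) (use br_K subspace_K in auto)

lemma L_K: "X \<in> L \<Longrightarrow> X \<in> K"
  using L_subset_K by blast

lemma br_L: "X \<in> L \<Longrightarrow> Y \<in> L \<Longrightarrow> br X Y \<in> L"
  using L_subset_K br_K_L by blast

lemma L_subset_subspace:
  assumes sub: "msc.subspace S"
    and br: "\<And>X Y d e. X \<in> K \<Longrightarrow> X \<in> GG d \<Longrightarrow> Y \<in> K \<Longrightarrow> Y \<in> GG e \<Longrightarrow> br X Y \<in> S"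
  shows "L \<subseteq> S"
proof -
  have "br X Y \<in> S" if "X \<in> K" "Y \<in> K" for X Y
    using that
  proof (induction X rule: K_homogeneous_induct)
    case X: (homogeneous d X)
    from \<open>Y \<in> K\<close> show ?case
    proof (induction Y rule: K_homogeneous_induct)
      case (homogeneous e Y)
      then show ?case using br X by blast
    next
      case (add Y Z)
      then show ?case unfolding GG.supercomm_add_right by (rule msc.subspace_add[OF sub])
    qed
  next
    case (add X Z)
    then show ?case unfolding GG.supercomm_add_left by (intro msc.subspace_add[OF sub]) auto
  qed
  then have "msc.span {br X Y | X Y. X \<in> K \<and> Y \<in> K} \<subseteq> S"
    by (intro msc.span_minimal sub) blast
  then show ?thesis by (rule ord_eq_le_trans[OF L_def])
qed

lemma hcomp_L:
  assumes "X \<in> L"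
  shows "hcomp GG d X \<in> L"
proof -
  let ?S = "{X. \<forall>d. hcomp GG d X \<in> L}"
  have h0: "hcomp GG d 0 = 0" for d
    using GG.hcomp_homogeneous[OF GG.H_0, of d d] by simp
  have "L \<subseteq> ?S"
  proof (rule L_subset_subspace)
    show "msc.subspace ?S"
      by (rule msc.subspaceI) (simp_all add: GG.hcomp_add hcomp_msc L_add L_msc h0)
    show "br X Y \<in> ?S" if "X \<in> K" "X \<in> GG d" "Y \<in> K" "Y \<in> GG e" for X Y d e
      using that br_K_L GG.hcomp_homogeneous[OF br_GG[OF that(2,4)]] by simp
  qed
  then show ?thesis using assms by blast
qed

lemma L_homogeneous_induct [consumes 1, case_names homogeneous add]:
  assumes "X \<in> L" "\<And>d X. X \<in> GG d \<Longrightarrow> X \<in> L \<Longrightarrow> Q X"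
    and "\<And>X Y. X \<in> L \<Longrightarrow> Y \<in> L \<Longrightarrow> Q X \<Longrightarrow> Q Y \<Longrightarrow> Q (X + Y)"
  shows "Q X"
  by (rule GG.homogeneous_induct[OF assms(1)], erule hcomp_L, erule (1) assms(2), rule assms(3))

subsection \<open>Skew matrix units\<close>

abbreviation o1 :: "('m, 'n) idx"
  where "o1 \<equiv> Inl i1"

lemma tt_K [simp]: "tt p q a \<in> K"
  by (simp add: tt_def)

lemma tt_GG: "a \<in> G d \<Longrightarrow> tt p q a \<in> GG (d + idx_deg p + idx_deg q)"
  by (simp add: tt_def T_GG E_GG)

lemma tt_nth_G: "a \<in> G d \<Longrightarrow> tt p q a $ p $ q \<in> G d"
proof -
  assume "a \<in> G d"
  then have "tt p q a $ p $ q \<in> G (d + idx_deg p + idx_deg q + idx_deg p + idx_deg q)"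
    using tt_GG unfolding mat_grading_def by blast
  then show ?thesis by (cases "idx_deg p"; cases "idx_deg q") (simp_all add: add.assoc)
qed

lemma tt_add: "tt p q (a + b) = tt p q a + tt p q b"
  by (simp add: tt_def E_add T_add)

lemma tt_additive: "additive (tt p q)"
  by standard (rule tt_add)

lemmas tt_minus = additive.minus[OF tt_additive]
lemmas tt_diff = additive.diff[OF tt_additive]
lemmas tt_zero [simp] = additive.zero[OF tt_additive]
lemmas tt_sgn_deg = additive.sgn_deg[OF tt_additive]

lemma tt_sc: "tt p q (sc c a) = msc c (tt p q a)"
  by (simp add: tt_def T_msc flip: msc_E)

text \<open>Every skew unit has a second description at the mirrored position, because
  \<open>T\<close> changes sign under \<open>st\<close>.\<close>

lemma tt_dual: "a \<in> G d \<Longrightarrow> tt p q a = tt (ip q) (ip p) (- dual d p q a)"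
  using T_st[of "E p q a"] by (simp add: tt_minus) (simp add: tt_def st_E)

lemma tt_nth: "a \<in> G d \<Longrightarrow> tt p q a $ i $ j =
    (if i = p \<and> j = q then a else 0) - (if i = ip q \<and> j = ip p then dual d p q a else 0)"
  by (simp add: tt_def T_def st_E)

lemma tt_nth_0:
  assumes "\<not> (i = p \<and> j = q)" "\<not> (i = ip q \<and> j = ip p)"
  shows "tt p q a $ i $ j = 0"
proof (induction a rule: G.homogeneous_cases)
  case (homogeneous d a)
  then show ?case using assms by (simp only: tt_nth[OF homogeneous]) auto
qed (simp add: tt_add)

lemma tt_nth_1:
  assumes "p \<noteq> ip q"
  shows "tt p q a $ p $ q = a"
proof (induction a rule: G.homogeneous_cases)
  case (homogeneous d a)
  then show ?case using assms by (simp only: tt_nth[OF homogeneous]) auto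
qed (simp add: tt_add)

text \<open>Summing over all positions meets each skew unit from both of its positions; the factor
  \<open>hf\<close> compensates.\<close>

lemma K_expand:
  assumes "X \<in> K"
  shows "X = (\<Sum>p\<in>UNIV. \<Sum>q\<in>UNIV. tt p q (sc hf (X $ p $ q)))"
proof -
  have "X = T (msc hf X)" using K_T_half[OF assms] by simp
  also have "\<dots> = T (\<Sum>p\<in>UNIV. \<Sum>q\<in>UNIV. E p q (msc hf X $ p $ q))"
    by (rule arg_cong[OF mat_expand])
  finally show ?thesis by (simp add: T_sum tt_def)
qed

lemma br_tt:
  assumes "a \<in> G d" "Y \<in> GG e" "Y \<in> K"
  shows "br (tt p q a) Y = T (mat_mult (E p q a) Y
    - sgn_deg ((d + idx_deg p + idx_deg q) * e) (mat_mult Y (E p q a)))"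
  unfolding tt_def by (rule br_T[OF E_GG[OF assms(1)] assms(2,3)])

lemma E_mult_tt:
  assumes "q \<noteq> ip s" "q = r"
  shows "mat_mult (E p q a) (tt r s b) = E p s (a * b)"
proof -
  have "a * tt r s b $ q $ j = (if j = s then a * b else 0)" for j
    using assms by (auto simp: tt_nth_0 tt_nth_1)
  then show ?thesis by (auto simp: mat_eq_iff E_mult_nth)
qed

lemma tt_mult_E:
  assumes "r \<noteq> ip p" "s = p"
  shows "mat_mult (tt r s b) (E p q a) = E r q (b * a)"
proof -
  have "p \<noteq> ip r" using assms(1) by auto
  then have "tt r s b $ i $ p * a = (if i = r then b * a else 0)" for i
    using assms by (auto simp: tt_nth_0 tt_nth_1)
  then show ?thesis by (auto simp: mat_eq_iff mult_E_nth)
qed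

lemma E_mult_tt_0: "q \<noteq> r \<Longrightarrow> q \<noteq> ip s \<Longrightarrow> mat_mult (E p q a) (tt r s b) = 0"
  by (auto simp: mat_eq_iff E_mult_nth tt_nth_0)

lemma tt_mult_E_0: "s \<noteq> p \<Longrightarrow> r \<noteq> ip p \<Longrightarrow> mat_mult (tt r s b) (E p q a) = 0"
proof -
  assume *: "s \<noteq> p" "r \<noteq> ip p"
  then have "p \<noteq> ip r" by auto
  with * show ?thesis by (auto simp: mat_eq_iff mult_E_nth tt_nth_0)
qed

text \<open>The conditions keep the mirrored halves of the units from contributing further products,
  so only the associative product along the path p, r, q remains.\<close>

lemma br_tt_path:
  assumes "p \<noteq> q" "r \<noteq> ip q" "r \<noteq> ip p"
  shows "br (tt p r a) (tt r q b) = tt p q (a * b)"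
proof (induction a b rule: G.homogeneous_cases2)
  case (homogeneous d e a b)
  show ?case
    using assms
    by (subst br_tt[OF homogeneous(1) tt_GG[OF homogeneous(2)] tt_K])
      (simp add: E_mult_tt tt_mult_E_0 tt_def[of p q])
qed (simp_all add: GG.supercomm_add_left GG.supercomm_add_right tt_add distrib_left distrib_right)

lemma br_tt_0:
  assumes "r \<noteq> q" "s \<noteq> p" "r \<noteq> ip s" "p \<noteq> ip q"
  shows "br (tt p r a) (tt q s b) = 0"
proof (induction a b rule: G.homogeneous_cases2)
  case (homogeneous d e a b)
  have "q \<noteq> ip p" using assms(4) by auto
  with assms show ?case
    by (subst br_tt[OF homogeneous(1) tt_GG[OF homogeneous(2)] tt_K])
      (simp add: E_mult_tt_0 tt_mult_E_0)
qed (simp_all add: GG.supercomm_add_left GG.supercomm_add_right tt_add)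

lemma br_tt_path':
  assumes "q \<noteq> r" "p \<noteq> ip q" "p \<noteq> ip r" "a \<in> G d" "b \<in> G e"
  shows "br (tt p r a) (tt q p b)
    = - sgn_deg ((d + idx_deg p + idx_deg r) * (e + idx_deg q + idx_deg p)) (tt q r (b * a))"
proof -
  have "br (tt q p b) (tt p r a) = tt q r (b * a)"
    using assms by (intro br_tt_path) auto
  then show ?thesis
    using br_skew[OF tt_GG[OF assms(4), of p r] tt_GG[OF assms(5), of q p]] by simp
qed

lemma br_tt_opposite:
  assumes "p \<noteq> q" "p \<noteq> ip q" "a \<in> G d" "b \<in> G e"
  shows "br (tt p q a) (tt q p b) = tt p p (a * b)
    - sgn_deg ((d + idx_deg p + idx_deg q) * (e + idx_deg p + idx_deg q)) (tt q q (b * a))"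
proof -
  have "q \<noteq> ip p" using assms(2) by auto
  then show ?thesis
    using assms
    by (subst br_tt[OF assms(3) tt_GG[OF assms(4)] tt_K])
      (simp add: E_mult_tt tt_mult_E tt_def[of p p] tt_def[of q q] T_diff T_sgn_deg algebra_simps)
qed

subsection \<open>Choosing indices in new classes\<close>

text \<open>Both excluded pairs enter here. Without (1, 1) there are at least three classes; two
  different orthogonal indices give m at least 2, and without (2, 1) this leaves at least four
  classes.\<close>

lemma card_classes: "CARD('m + 'n) \<ge> 3" "i \<noteq> j \<Longrightarrow> CARD('m + 'n) \<ge> 4"
  for i j :: 'm
proof -
  have pos: "CARD('m) > 0" "CARD('n) > 0" by (simp_all add: card_gt_0_iff)
  have c: "CARD('m + 'n) = CARD('m) + CARD('n)"
    by (simp add: card_Plus flip: UNIV_Plus_UNIV)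
  have d: "\<not> (CARD('m) = 1 \<and> CARD('n) = 1)" "\<not> (CARD('m) = 2 \<and> CARD('n) = 1)"
    using dims by auto
  show "CARD('m + 'n) \<ge> 3" using pos d unfolding c by presburger
  assume "i \<noteq> j"
  have "card {i, j} \<le> CARD('m)" by (intro card_mono) auto
  then have "CARD('m) \<ge> 2" using \<open>i \<noteq> j\<close> by simp
  then show "CARD('m + 'n) \<ge> 4" using pos d unfolding c by presburger
qed

lemma ex_class2:
  obtains r :: "('m, 'n) idx" where "cl r \<noteq> cl p" "cl r \<noteq> cl q"
proof -
  have "card {cl p, cl q} < CARD('m + 'n)"
    using card_classes(1) card_insert_le_m1[of 2 "{cl q}" "cl p"] by simp
  then have "{cl p, cl q} \<noteq> UNIV" by auto
  then obtain c where "c \<noteq> cl p" "c \<noteq> cl q" by auto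
  moreover obtain r :: "('m, 'n) idx" where "cl r = c" using surj_cl by blast
  ultimately show ?thesis by (intro that[of r]) simp_all
qed

lemma ex_class3:
  assumes "i \<noteq> j"
  obtains r :: "('m, 'n) idx" where "cl r \<noteq> Inl i" "cl r \<noteq> Inl j" "cl r \<noteq> cl p"
proof -
  have "card {Inl i, Inl j, cl p} \<le> 3"
    by (simp add: card_insert_if)
  moreover have "CARD('m + 'n) \<ge> 4"
    by (rule card_classes(2)[OF assms])
  ultimately have "{Inl i, Inl j, cl p} \<noteq> UNIV" by auto
  then obtain c where "c \<noteq> Inl i" "c \<noteq> Inl j" "c \<noteq> cl p" by auto
  moreover obtain r :: "('m, 'n) idx" where "cl r = c" using surj_cl by blast
  ultimately show ?thesis by (intro that[of r]) simp_all
qed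

text \<open>A path through a third class exhibits every off-diagonal unit as a bracket.\<close>

lemma tt_L:
  assumes "p \<noteq> q"
  shows "tt p q a \<in> L"
proof -
  obtain r where "cl r \<noteq> cl p" "cl r \<noteq> cl q" by (rule ex_class2)
  then have "br (tt p r a) (tt r q un) = tt p q a"
    using assms by (subst br_tt_path) (auto simp: cl_eq_iff)
  then show ?thesis using br_K_L[OF tt_K tt_K, of p r a r q un] by simp
qed

end

section \<open>Two-cocycles\<close>

text \<open>The values need not form a module over the base ring, so bilinearity is weakened to
  additivity together with the balance rule \<open>w_msc\<close>.\<close>

locale cocycle = osp_setup sc G bar i1 k1
  for sc :: "'k::comm_ring_1 \<Rightarrow> 'r::ring \<Rightarrow> 'r"
    and G :: "bit \<Rightarrow> 'r set"
    and bar :: "'r \<Rightarrow> 'r"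
    and i1 :: "'m::finite" and k1 :: "'n::finite" +
  fixes w :: "('r, 'm, 'n) mat \<Rightarrow> ('r, 'm, 'n) mat \<Rightarrow> 'v::ab_group_add"
  assumes w_add_left: "X \<in> L \<Longrightarrow> X' \<in> L \<Longrightarrow> Y \<in> L \<Longrightarrow> w (X + X') Y = w X Y + w X' Y"
    and w_add_right: "X \<in> L \<Longrightarrow> Y \<in> L \<Longrightarrow> Y' \<in> L \<Longrightarrow> w X (Y + Y') = w X Y + w X Y'"
    and w_msc: "X \<in> L \<Longrightarrow> Y \<in> L \<Longrightarrow> w (msc c X) Y = w X (msc c Y)"
    and w_skew: "X \<in> L \<Longrightarrow> X \<in> GG d \<Longrightarrow> Y \<in> L \<Longrightarrow> Y \<in> GG e \<Longrightarrow>
      w X Y + sgn_deg (d * e) (w Y X) = 0"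
    and w_jacobi: "X \<in> L \<Longrightarrow> X \<in> GG d \<Longrightarrow> Y \<in> L \<Longrightarrow> Y \<in> GG e \<Longrightarrow> Z \<in> L \<Longrightarrow> Z \<in> GG f \<Longrightarrow>
      sgn_deg (d * f) (w (br X Y) Z) + sgn_deg (e * d) (w (br Y Z) X)
        + sgn_deg (f * e) (w (br Z X) Y) = 0"
begin

lemma w_0_left [simp]: "Y \<in> L \<Longrightarrow> w 0 Y = 0"
  using w_add_left[of 0 0 Y] by simp

lemma w_0_right [simp]: "X \<in> L \<Longrightarrow> w X 0 = 0"
  using w_add_right[of X 0 0] by simp

lemma w_minus_left: "X \<in> L \<Longrightarrow> Y \<in> L \<Longrightarrow> w (- X) Y = - w X Y"
  using w_add_left[of X "- X" Y] by (simp add: L_minus add_eq_0_iff)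

lemma w_minus_right: "X \<in> L \<Longrightarrow> Y \<in> L \<Longrightarrow> w X (- Y) = - w X Y"
  using w_add_right[of X Y "- Y"] by (simp add: L_minus add_eq_0_iff)

lemma w_sgn_left: "X \<in> L \<Longrightarrow> Y \<in> L \<Longrightarrow> w (sgn_deg d X) Y = sgn_deg d (w X Y)"
  by (simp add: sgn_deg_def w_minus_left)

lemma w_sgn_right: "X \<in> L \<Longrightarrow> Y \<in> L \<Longrightarrow> w X (sgn_deg d Y) = sgn_deg d (w X Y)"
  by (simp add: sgn_deg_def w_minus_right)

lemma w_sum_left: "(\<And>x. x \<in> A \<Longrightarrow> f x \<in> L) \<Longrightarrow> Y \<in> L \<Longrightarrow> w (sum f A) Y = (\<Sum>x\<in>A. w (f x) Y)"
  by (induction A rule: infinite_finite_induct) (simp_all add: w_add_left L_sum)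

lemma w_sum_right: "(\<And>x. x \<in> A \<Longrightarrow> f x \<in> L) \<Longrightarrow> X \<in> L \<Longrightarrow> w X (sum f A) = (\<Sum>x\<in>A. w X (f x))"
  by (induction A rule: infinite_finite_induct) (simp_all add: w_add_right L_sum)

lemma w_swap:
  assumes "X \<in> L" "X \<in> GG d" "Y \<in> L" "Y \<in> GG e"
  shows "w X Y = - sgn_deg (d * e) (w Y X)"
  using w_skew[OF assms] by (simp add: eq_neg_iff_add_eq_0)

text \<open>The Jacobi relation in derivation form: it moves the first matrix of a bracket to the
  other argument and is the form in which all later arguments use the relation.\<close>

lemma w_br_left:
  assumes X: "X \<in> L" "X \<in> GG d" and Y: "Y \<in> L" "Y \<in> GG e" and Z: "Z \<in> L" "Z \<in> GG f"
  shows "w (br X Y) Z = w X (br Y Z) - sgn_deg (d * e) (w Y (br X Z))"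
proof -
  have 1: "w (br Y Z) X = - sgn_deg ((e + f) * d) (w X (br Y Z))"
    using X Y Z by (intro w_swap br_L br_GG) auto
  have 2: "w (br Z X) Y = - sgn_deg ((f + d) * e) (w Y (br Z X))"
    using X Y Z by (intro w_swap br_L br_GG) auto
  have "br Z X = - sgn_deg (f * d) (br X Z)"
    using X Z by (intro br_skew)
  then have 3: "w Y (br Z X) = - sgn_deg (f * d) (w Y (br X Z))"
    using X Y Z by (simp add: w_minus_right w_sgn_right br_L L_sgn_deg)
  from w_jacobi[OF X Y Z] show ?thesis
    unfolding 1 2 3 by (cases d; cases e; cases f) (simp_all add: algebra_simps eq_neg_iff_add_eq_0)
qed

lemma w_tt_add_left: "p \<noteq> q \<Longrightarrow> Y \<in> L \<Longrightarrow> w (tt p q (a + b)) Y = w (tt p q a) Y + w (tt p q b) Y"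
  by (simp add: tt_add w_add_left tt_L)

lemma w_tt_add_right: "p \<noteq> q \<Longrightarrow> X \<in> L \<Longrightarrow> w X (tt p q (a + b)) = w X (tt p q a) + w X (tt p q b)"
  by (simp add: tt_add w_add_right tt_L)

subsection \<open>Paths through an intermediate index\<close>

text \<open>The Jacobi relation along the path p, s, r, q: the outer units commute, so the middle
  factor b passes from one side to the other while the intermediate index changes.\<close>

lemma path_shift:
  assumes pq: "p \<noteq> q" and r: "cl r \<noteq> cl p" "cl r \<noteq> cl q" and s: "cl s \<noteq> cl p" "cl s \<noteq> cl q"
    and rs: "cl r \<noteq> cl s" and a: "a \<in> G d" and b: "b \<in> G e" and c: "c \<in> G f"
  shows "w (tt p r (a * b)) (tt r q c) = w (tt p s a) (tt s q (b * c))"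
proof -
  have ne: "p \<noteq> s" "s \<noteq> r" "r \<noteq> q" "s \<noteq> q" "s \<noteq> ip r" "s \<noteq> ip p" "r \<noteq> ip q" "r \<noteq> ip s" "s \<noteq> ip q"
    "p \<noteq> ip r" "p \<noteq> r"
    using r s rs by (auto simp: cl_eq_iff)
  have "br (tt p s a) (tt s r b) = tt p r (a * b)" "br (tt s r b) (tt r q c) = tt s q (b * c)"
    "br (tt p s a) (tt r q c) = 0"
    using pq ne by (auto intro!: br_tt_path br_tt_0)
  then show ?thesis
    using w_br_left[OF tt_L tt_GG[OF a] tt_L tt_GG[OF b] tt_L tt_GG[OF c], of p s s r r q] ne
    by (simp add: tt_L)
qed

text \<open>Instances of \<open>path_shift\<close> with unit entries: the intermediate class may be
  changed and the product may be collected on either side.\<close>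

lemma path_change:
  assumes pq: "p \<noteq> q" and r: "cl r \<noteq> cl p" "cl r \<noteq> cl q" and s: "cl s \<noteq> cl p" "cl s \<noteq> cl q"
    and rs: "cl r \<noteq> cl s" and a: "a \<in> G d" and b: "b \<in> G e"
  shows "w (tt p r a) (tt r q b) = w (tt p s a) (tt s q b)"
    and "w (tt p r a) (tt r q b) = w (tt p s un) (tt s q (a * b))"
    and "w (tt p r a) (tt r q b) = w (tt p s (a * b)) (tt s q un)"
proof -
  note sh = path_shift[OF pq r s rs]
  note sh' = path_shift[OF pq s r rs[symmetric]]
  show 1: "w (tt p r a) (tt r q b) = w (tt p s a) (tt s q b)"
    using sh[OF a un_G b] by simp
  show 2: "w (tt p r a) (tt r q b) = w (tt p s un) (tt s q (a * b))"
    using sh[OF un_G a b] by simp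
  have ab: "a * b \<in> G (d + e)" using a b by (rule grading_mult)
  show "w (tt p r a) (tt r q b) = w (tt p s (a * b)) (tt s q un)"
    using 2 sh[OF un_G ab un_G] sh[OF ab un_G un_G] by simp
qed

text \<open>If r and s lie in the same class, for instance as mirror images of each other,
  \<open>path_change\<close> does not compare them directly; both are compared with an index t of a
  fourth class.\<close>

lemma path_orth:
  assumes ij: "i \<noteq> j" and r: "cl r \<noteq> Inl i" "cl r \<noteq> Inl j" and s: "cl s \<noteq> Inl i" "cl s \<noteq> Inl j"
  shows "w (tt (Inl i) r a) (tt r (Inl j) b) = w (tt (Inl i) s (a * b)) (tt s (Inl j) un)"
proof -
  have ne: "Inl i \<noteq> r" "r \<noteq> Inl j" "Inl i \<noteq> s" "s \<noteq> Inl j" using r s by auto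
  have pq: "(Inl i :: ('m, 'n) idx) \<noteq> Inl j" using ij by simp
  have hom: "w (tt (Inl i) r a) (tt r (Inl j) b) = w (tt (Inl i) s (a * b)) (tt s (Inl j) un)"
    if a: "a \<in> G d" and b: "b \<in> G e" for a b d e
  proof (cases "cl r = cl s")
    case False
    then show ?thesis using path_change(3)[OF pq _ _ _ _ _ a b, of r s] r s by simp
  next
    case True
    obtain t :: "('m, 'n) idx" where t: "cl t \<noteq> Inl i" "cl t \<noteq> Inl j" "cl t \<noteq> cl r"
      by (rule ex_class3[OF ij])
    have ab: "a * b \<in> G (d + e)" using a b by (rule grading_mult)
    have "w (tt (Inl i) r a) (tt r (Inl j) b) = w (tt (Inl i) t (a * b)) (tt t (Inl j) un)"
      using path_change(3)[OF pq _ _ _ _ _ a b, of r t] r t by simp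
    also have "\<dots> = w (tt (Inl i) s (a * b)) (tt s (Inl j) un)"
      using path_change(1)[OF pq _ _ _ _ _ ab un_G, of t s] s t True by simp
    finally show ?thesis .
  qed
  show ?thesis
    by (induction a b rule: G.homogeneous_cases2)
      (use hom ne in \<open>auto simp: distrib_left distrib_right w_tt_add_left w_tt_add_right tt_L\<close>)
qed

subsection \<open>Opposite matrix units\<close>

definition M :: "('m, 'n) idx \<Rightarrow> 'r \<Rightarrow> 'r \<Rightarrow> 'v"
  where "M q a b = w (tt o1 q a) (tt q o1 b)"

lemma M_add_left: "q \<noteq> o1 \<Longrightarrow> M q (a + a') b = M q a b + M q a' b"
  by (simp add: M_def w_tt_add_left tt_L)

lemma M_add_right: "q \<noteq> o1 \<Longrightarrow> M q a (b + b') = M q a b + M q a b'"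
  by (simp add: M_def w_tt_add_right tt_L)

lemma M_right_additive: "q \<noteq> o1 \<Longrightarrow> additive (M q a)"
  by standard (rule M_add_right)

lemmas M_sgn_right = additive.sgn_deg[OF M_right_additive]

lemma M_swap:
  assumes "q \<noteq> o1" "a \<in> G d" "b \<in> G e"
  shows "w (tt q o1 b) (tt o1 q a) = - sgn_deg ((d + idx_deg q) * (e + idx_deg q)) (M q a b)"
  using w_swap[OF tt_L tt_GG[OF assms(3)] tt_L tt_GG[OF assms(2)], of q o1 o1 q] assms(1)
  by (simp add: M_def mult.commute)

text \<open>Writing the first unit as a bracket through \<open>o1\<close> reduces every opposite
  pair to pairs based at \<open>o1\<close>. The entry \<open>b'\<close> covers the case q =
  \<open>ip p\<close>, where the two positions of the second unit coincide and its entry is b minus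
  the dual of b.\<close>

lemma opposite_via_o1:
  assumes p: "p \<noteq> o1" and q: "q \<noteq> o1" and pq: "p \<noteq> q" and a: "a \<in> G d" and b: "b \<in> G e"
  defines "b' \<equiv> tt q p b $ q $ p"
  shows "w (tt p q a) (tt q p b) = w (tt p o1 un) (tt o1 p (a * b'))
    + sgn_deg (idx_deg p * (d + e + idx_deg p)) (M q a b')"
proof -
  let ?Z = "tt q p b"
  have b': "b' \<in> G e" unfolding b'_def using b by (rule tt_nth_G)
  have pn: "o1 \<noteq> ip p" "o1 \<noteq> ip q" "ip p \<noteq> o1" "ip q \<noteq> o1" using p q by auto
  have rows: "?Z $ q $ j = (if j = p then b' else 0)" "?Z $ j $ p = (if j = q then b' else 0)" for j
    using pq by (auto simp: b'_def intro!: tt_nth_0)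
  have zeros: "?Z $ o1 $ j = 0" "?Z $ j $ o1 = 0" for j
    using p q pn by (auto intro!: tt_nth_0)
  have XY: "br (tt p o1 un) (tt o1 q a) = tt p q a"
    using pq pn by (subst br_tt_path) auto
  have YZ: "br (tt o1 q a) ?Z = tt o1 p (a * b')"
  proof -
    have "mat_mult (E o1 q a) ?Z = E o1 p (a * b')" "mat_mult ?Z (E o1 q a) = 0"
      by (auto simp: mat_eq_iff E_mult_nth mult_E_nth rows zeros)
    then show ?thesis
      by (subst br_tt[OF a tt_GG[OF b] tt_K]) (simp add: tt_def[of o1 p])
  qed
  have XZ: "br (tt p o1 un) ?Z = - sgn_deg (idx_deg p * (e + idx_deg q + idx_deg p)) (tt q o1 b')"
  proof -
    have "mat_mult (E p o1 un) ?Z = 0" "mat_mult ?Z (E p o1 un) = E q o1 b'"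
      by (auto simp: mat_eq_iff E_mult_nth mult_E_nth rows zeros)
    then show ?thesis
      by (subst br_tt[OF un_G tt_GG[OF b] tt_K]) (simp add: tt_def[of q o1] T_minus T_sgn_deg)
  qed
  have "w (tt p q a) ?Z = w (tt p o1 un) (br (tt o1 q a) ?Z)
    - sgn_deg ((0 + idx_deg p + idx_deg o1) * (d + idx_deg o1 + idx_deg q))
        (w (tt o1 q a) (br (tt p o1 un) ?Z))"
    using w_br_left[OF tt_L tt_GG[OF un_G] tt_L tt_GG[OF a] tt_L tt_GG[OF b], of p o1 o1 q q p] p q pq
    by (simp only: XY) simp
  then show ?thesis
    unfolding YZ XZ using q
    by (cases "idx_deg p"; cases "idx_deg q"; cases d; cases e)
      (simp_all add: w_minus_right tt_L M_def)
qed

text \<open>The unit at (o1, q) is factored through r. The Jacobi relation then produces a pair at r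
  and an opposite pair at (r, q), which \<open>opposite_via_o1\<close> brings back to
  \<open>o1\<close>.\<close>

lemma M_rel:
  assumes q: "q \<noteq> o1" and r: "r \<noteq> o1" and qr: "cl q \<noteq> cl r"
    and a: "a \<in> G d" and b: "b \<in> G e" and c: "c \<in> G f"
  shows "M q (a * b) c = M r a (b * c)
    + sgn_deg (d * (e + f)) (M q b (c * a) - M r (b * c * a) un)"
proof -
  have ne: "r \<noteq> ip q" "q \<noteq> ip r" "r \<noteq> q" "o1 \<noteq> ip q" "o1 \<noteq> ip r"
    using qr q r by (auto simp: cl_eq_iff)
  have ca: "c * a \<in> G (f + d)" and bca: "b * c * a \<in> G (e + f + d)"
    using a b c by (auto intro!: grading_mult)
  have XY: "br (tt o1 r a) (tt r q b) = tt o1 q (a * b)"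
    using ne q by (subst br_tt_path) auto
  have YZ: "br (tt r q b) (tt q o1 c) = tt r o1 (b * c)"
    using ne q r by (subst br_tt_path) auto
  have XZ: "br (tt o1 r a) (tt q o1 c)
    = - sgn_deg ((d + idx_deg o1 + idx_deg r) * (f + idx_deg q + idx_deg o1)) (tt q r (c * a))"
    using ne q r a c by (intro br_tt_path') auto
  have 1: "M q (a * b) c = w (tt o1 r a) (br (tt r q b) (tt q o1 c))
    - sgn_deg ((d + idx_deg o1 + idx_deg r) * (e + idx_deg r + idx_deg q))
        (w (tt r q b) (br (tt o1 r a) (tt q o1 c)))"
    using w_br_left[OF tt_L tt_GG[OF a] tt_L tt_GG[OF b] tt_L tt_GG[OF c], of o1 r r q q o1] q r ne
    by (simp only: XY M_def) simp
  have 2: "w (tt r q b) (tt q r (c * a)) = w (tt r o1 un) (tt o1 r (b * c * a))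
    + sgn_deg (idx_deg r * (e + (f + d) + idx_deg r)) (M q b (c * a))"
    using opposite_via_o1[OF r q ne(3) b ca] ne by (simp add: tt_nth_1 mult.assoc)
  have 3: "w (tt r o1 un) (tt o1 r (b * c * a))
    = - sgn_deg ((e + f + d + idx_deg r) * (0 + idx_deg r)) (M r (b * c * a) un)"
    by (rule M_swap[OF r bca un_G])
  show ?thesis
    unfolding 1 YZ XZ using q r ne
    by (simp add: w_minus_right w_sgn_right tt_L L_sgn_deg 2 3 M_def[of r a])
      (cases "idx_deg r"; cases "idx_deg q"; cases d; cases e; cases f; simp add: algebra_simps)
qed

text \<open>In \<open>M_rel\<close> with b = c = \<open>un\<close> the two terms at r
  cancel.\<close>

lemma M_un:
  assumes q: "q \<noteq> o1"
  shows "M q a un = M q un a"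
proof (induction a rule: G.homogeneous_cases)
  case (homogeneous d a)
  obtain r :: "('m, 'n) idx" where "cl r \<noteq> cl q" "cl r \<noteq> cl o1" by (rule ex_class2)
  then have "r \<noteq> o1" "cl q \<noteq> cl r" by auto
  from M_rel[OF q this homogeneous un_G un_G] show ?case by simp
qed (simp add: q M_add_left M_add_right)

text \<open>The cocycle value of an element of \<open>L \<otimes> L\<close> whose bracket is
  \<open>T (E o1 o1 (a b - (-1)\<^sup>d\<^sup>e b a))\<close>.\<close>

definition lam :: "('m, 'n) idx \<Rightarrow> bit \<Rightarrow> bit \<Rightarrow> 'r \<Rightarrow> 'r \<Rightarrow> 'v"
  where "lam q d e a b = M q a b - sgn_deg (d * e) (M q un (b * a))"

text \<open>For different classes this is \<open>M_rel\<close> with middle factor \<open>un\<close>;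
  mirror images are compared through a third class.\<close>

lemma lam_indep:
  assumes q: "q \<noteq> o1" and r: "r \<noteq> o1" and a: "a \<in> G d" and b: "b \<in> G e"
  shows "lam q d e a b = lam r d e a b"
proof -
  have *: "lam q d e a b = lam r d e a b"
    if "q \<noteq> o1" "r \<noteq> o1" "cl q \<noteq> cl r" for q r
    using M_rel[OF that a un_G b] that
    by (simp add: lam_def M_un sgn_deg_diff algebra_simps)
  obtain s :: "('m, 'n) idx" where "cl s \<noteq> cl q" "cl s \<noteq> cl o1" by (rule ex_class2)
  then have s: "s \<noteq> o1" "cl q \<noteq> cl s" by auto
  show ?thesis
  proof (cases "cl q = cl r")
    case True
    then have "cl s \<noteq> cl r" using s by auto
    then show ?thesis using *[OF q s] *[OF s(1) r] by simp
  qed (use * q r in blast)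
qed

lemma lam_un_right: "q \<noteq> o1 \<Longrightarrow> lam q d 0 a un = 0"
  by (simp add: lam_def M_un)

text \<open>\<open>M_rel\<close> rewritten in terms of \<open>lam\<close>: the terms with a unit
  entry cancel, and independence of the index turns the summand at r into one at q.\<close>

lemma lam_cyclic:
  assumes q: "q \<noteq> o1" and a: "a \<in> G d" and b: "b \<in> G e" and c: "c \<in> G f"
  shows "lam q (d + e) f (a * b) c = lam q d (e + f) a (b * c) + sgn_deg (d * (e + f)) (lam q e (f + d) b (c * a))"
proof -
  obtain r :: "('m, 'n) idx" where "cl r \<noteq> cl q" "cl r \<noteq> cl o1" by (rule ex_class2)
  then have r: "r \<noteq> o1" "cl q \<noteq> cl r" by auto
  have bc: "b * c \<in> G (e + f)" and ca: "c * a \<in> G (f + d)"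
    using a b c by (auto intro!: grading_mult)
  have 1: "lam q d (e + f) a (b * c) = lam r d (e + f) a (b * c)"
    by (rule lam_indep[OF q r(1) a bc])
  show ?thesis
    unfolding 1 using M_rel[OF q r a b c] q r
    by (simp add: lam_def sgn_deg_diff M_un mult.assoc)
      (cases d; cases e; cases f; simp add: algebra_simps)
qed

text \<open>Take c = \<open>un\<close> in the cyclic identity; its left side is then the value of
  \<open>lam\<close> at (a b, un), which is 0.\<close>

lemma lam_skew:
  assumes q: "q \<noteq> o1" and a: "a \<in> G d" and b: "b \<in> G e"
  shows "lam q d e a b = - sgn_deg (d * e) (lam q e d b a)"
  using lam_cyclic[OF q a b un_G] lam_un_right[OF q, of "d + e" "a * b"]
  by (simp add: eq_neg_iff_add_eq_0)

lemma lam_jacobi: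
  assumes q: "q \<noteq> o1" and a: "a \<in> G d" and b: "b \<in> G e" and c: "c \<in> G f"
  shows "sgn_deg (d * f) (lam q (d + e) f (a * b) c) + sgn_deg (d * e) (lam q (e + f) d (b * c) a)
    + sgn_deg (e * f) (lam q (f + d) e (c * a) b) = 0"
proof -
  have bc: "b * c \<in> G (e + f)" and ca: "c * a \<in> G (f + d)"
    using a b c by (auto intro!: grading_mult)
  show ?thesis
    unfolding lam_cyclic[OF q a b c] lam_skew[OF q bc a] lam_skew[OF q ca b]
    by (cases d; cases e; cases f) (simp_all add: algebra_simps)
qed

text \<open>Rewriting both units at their mirrored positions turns a pair at one symplectic index
  into the swapped pair at its mirror image.\<close>

lemma M_dual:
  assumes a: "a \<in> G d" and b: "b \<in> G e"
  shows "M (Inr (Inl k)) a b = - sgn_deg (d * e) (M (Inr (Inr k)) (bar b) (bar a))"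
proof -
  let ?q = "Inr (Inl k) :: ('m, 'n) idx" and ?q' = "Inr (Inr k) :: ('m, 'n) idx"
  have 1: "tt o1 ?q a = tt ?q' o1 (sgn_deg d (bar a))"
    using tt_dual[OF a, of o1 ?q] by (cases d) (simp_all add: dual_def star_sgn_def)
  have 2: "tt ?q o1 b = tt o1 ?q' (sgn_deg (e + 1) (bar b))"
    using tt_dual[OF b, of ?q o1] by (cases e) (simp_all add: dual_def star_sgn_def)
  have 3: "w (tt ?q' o1 (bar a)) (tt o1 ?q' (bar b)) = - sgn_deg ((e + 1) * (d + 1)) (M ?q' (bar b) (bar a))"
    using M_swap[OF _ bar_degree[OF b] bar_degree[OF a], of ?q'] by simp
  show ?thesis
    unfolding M_def[of ?q] 1 2
    by (simp add: tt_sgn_deg w_sgn_left w_sgn_right tt_L L_sgn_deg 3)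
      (cases d; cases e; simp)
qed

text \<open>The origin of the relation between a \<otimes> b and its image under the involution:
  \<open>M_dual\<close> compares the two indices of one symplectic class, and \<open>lam\<close> has
  the same value at both.\<close>

lemma lam_bar:
  assumes a: "a \<in> G d" and b: "b \<in> G e" and q: "q \<noteq> o1"
  shows "lam q d e (bar a) (bar b) = lam q d e a b"
proof -
  let ?q = "Inr (Inl k1) :: ('m, 'n) idx" and ?q' = "Inr (Inr k1) :: ('m, 'n) idx"
  have a': "bar a \<in> G d" and b': "bar b \<in> G e" using a b by (auto intro: bar_degree)
  have ba: "b * a \<in> G (e + d)" using a b by (auto intro: grading_mult)
  have 1: "M ?q a b = - sgn_deg (d * e) (M ?q' (bar b) (bar a))"
    by (rule M_dual[OF a b])
  have 2: "M ?q un (b * a) = - sgn_deg (d * e) (M ?q' un (bar a * bar b))"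
    using M_dual[OF un_G ba, of k1] by (simp add: bar_mult[OF b a] M_sgn_right mult.commute M_un)
  have "lam ?q d e a b = - sgn_deg (d * e) (lam ?q' e d (bar b) (bar a))"
    unfolding lam_def 1 2 by (cases d; cases e) simp_all
  also have "\<dots> = lam ?q' d e (bar a) (bar b)"
    using lam_skew[OF _ a' b', of ?q'] by simp
  also have "\<dots> = lam q d e (bar a) (bar b)"
    using q by (intro lam_indep a' b') auto
  finally have "lam ?q d e a b = lam q d e (bar a) (bar b)" .
  moreover have "lam ?q d e a b = lam q d e a b"
    using q by (intro lam_indep a b) auto
  ultimately show ?thesis by simp
qed

lemma tt_orth: "tt (Inl i) (Inl j) a = - tt (Inl j) (Inl i) (bar a)"
proof (induction a rule: G.homogeneous_cases)
  case (homogeneous d a)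
  then show ?case using tt_dual[OF homogeneous, of "Inl i" "Inl j"]
    by (simp add: dual_def star_sgn_def tt_minus)
qed (simp add: tt_add bar.add)

text \<open>For an orthogonal index both units are negated and barred when mirrored, and swapping
  them back costs another sign. This later removes the bar-symmetric coefficients that the bracket
  cannot see.\<close>

lemma M_orth_skew:
  assumes "i \<noteq> i1"
  shows "M (Inl i) un a = - M (Inl i) un (bar a)"
proof -
  have ne: "Inl i \<noteq> o1" using assms by simp
  have *: "M (Inl i) un a = - M (Inl i) un (bar a)" if a: "a \<in> G d" for a d
  proof -
    have "M (Inl i) un a = w (tt (Inl i) o1 un) (tt o1 (Inl i) (bar a))"
      unfolding M_def tt_orth[of i1 i un] tt_orth[of i i1 a] using ne
      by (simp add: w_minus_left w_minus_right tt_L L_minus)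
    also have "\<dots> = - M (Inl i) un (bar a)"
      using M_swap[OF ne bar_degree[OF a] un_G] ne by (simp add: M_un)
    finally show ?thesis .
  qed
  show ?thesis
    by (induction a rule: G.homogeneous_cases) (use * ne in \<open>auto simp: M_add_right bar.add\<close>)
qed

end

text \<open>The diagonal entry of the Cartan element \<open>hh k\<close> at p, as an
  integer.\<close>

fun wt :: "'n \<Rightarrow> ('m, 'n) idx \<Rightarrow> int" where
  "wt k (Inl i) = 0"
| "wt k (Inr (Inl l)) = (if l = k then 1 else 0)"
| "wt k (Inr (Inr l)) = (if l = k then -1 else 0)"

lemma wt_ip [simp]: "wt k (ip p) = - wt k p"
  by (cases p rule: idx_cases) simp_all

context osp_setup
begin

subsection \<open>Weights\<close>

text \<open>Defined by supports and not as an eigenspace of \<open>hh k\<close>, since different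
  integers may have the same image in the base ring.\<close>

definition wsp :: "'n \<Rightarrow> int \<Rightarrow> ('r, 'm, 'n) mat set"
  where "wsp k n = {X. \<forall>p q. X $ p $ q \<noteq> 0 \<longrightarrow> wt k p - wt k q = n}"

lemma tt_wsp: "tt p q a \<in> wsp k (wt k p - wt k q)"
  unfolding wsp_def
proof (intro CollectI allI impI)
  fix i j
  assume "tt p q a $ i $ j \<noteq> 0"
  then have "(i = p \<and> j = q) \<or> (i = ip q \<and> j = ip p)" using tt_nth_0 by blast
  then show "wt k i - wt k j = wt k p - wt k q" by auto
qed

lemma wsp_add: "X \<in> wsp k n \<Longrightarrow> Y \<in> wsp k n \<Longrightarrow> X + Y \<in> wsp k n"
  unfolding wsp_def by (simp add: mem_Collect_eq) (metis add.right_neutral)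

lemma wsp_minus: "X \<in> wsp k n \<Longrightarrow> - X \<in> wsp k n"
  by (simp add: wsp_def)

lemma wsp_msc: "X \<in> wsp k n \<Longrightarrow> msc c X \<in> wsp k n"
proof -
  assume X: "X \<in> wsp k n"
  have "X $ p $ q \<noteq> 0" if "sc c (X $ p $ q) \<noteq> 0" for p q
    using that by auto
  then show ?thesis using X unfolding wsp_def by simp
qed

lemma wsp_mult:
  assumes "X \<in> wsp k m" "Y \<in> wsp k n"
  shows "mat_mult X Y \<in> wsp k (m + n)"
  unfolding wsp_def
proof (intro CollectI allI impI)
  fix p q
  assume "mat_mult X Y $ p $ q \<noteq> 0"
  then obtain l where "X $ p $ l * Y $ l $ q \<noteq> 0"
    unfolding mat_mult_nth by (meson sum.neutral)
  then have "X $ p $ l \<noteq> 0" "Y $ l $ q \<noteq> 0" by auto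
  then have "wt k p - wt k l = m" "wt k l - wt k q = n"
    using assms unfolding wsp_def by blast+
  then show "wt k p - wt k q = m + n" by simp
qed

lemma br_wsp:
  assumes "X \<in> wsp k m" "X \<in> GG d" "Y \<in> wsp k n" "Y \<in> GG e"
  shows "br X Y \<in> wsp k (m + n)"
proof -
  have "mat_mult Y X \<in> wsp k (m + n)"
    using wsp_mult[OF assms(3,1)] by (simp add: add.commute)
  then have "- sgn_deg (d * e) (mat_mult Y X) \<in> wsp k (m + n)"
    by (simp add: sgn_deg_def wsp_minus)
  then show ?thesis
    unfolding GG.supercomm_homogeneous[OF assms(2,4)] diff_conv_add_uminus
    by (rule wsp_add[OF wsp_mult[OF assms(1,3)]])
qed

lemma br_tt_wsp: "br (tt p q a) (tt r s b) \<in> wsp k (wt k p - wt k q + (wt k r - wt k s))"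
proof (induction a b rule: G.homogeneous_cases2)
  case (homogeneous d e a b)
  show ?case by (rule br_wsp[OF tt_wsp tt_GG[OF homogeneous(1)] tt_wsp tt_GG[OF homogeneous(2)]])
qed (simp_all add: tt_add GG.supercomm_add_left GG.supercomm_add_right wsp_add)

definition hh :: "'n \<Rightarrow> ('r, 'm, 'n) mat"
  where "hh k = tt (Inr (Inl k)) (Inr (Inl k)) un"

lemma hh_GG: "hh k \<in> GG 0"
  using tt_GG[OF un_G, of "Inr (Inl k)" "Inr (Inl k)"] by (simp add: hh_def add.assoc)

lemma tt_o1_un: "tt (Inl i) (Inl i) un = 0"
  by (simp add: tt_def T_def st_E[OF un_G] dual_def star_sgn_def)

text \<open>A diagonal skew matrix need not lie in L. This one is a bracket of opposite units
  through an orthogonal index, whose own diagonal term vanishes because \<open>un\<close> is fixed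
  by the involution.\<close>

lemma hh_L: "hh k \<in> L"
proof -
  have "br (tt (Inr (Inl k)) (Inl i1) un) (tt (Inl i1) (Inr (Inl k)) un) = hh k"
    by (subst br_tt_opposite[OF _ _ un_G un_G]) (simp_all add: hh_def tt_o1_un)
  then show ?thesis using br_K_L[OF tt_K tt_K] by metis
qed

lemma hh_nth: "hh k $ i $ j = (if i = j then sc (of_int (wt k i)) un else 0)"
  unfolding hh_def tt_nth[OF un_G]
  by (cases i rule: idx_cases) (auto simp: dual_def star_sgn_def split: if_splits)

lemma br_hh:
  assumes "X \<in> wsp k n"
  shows "br (hh k) X = msc (of_int n) X"
proof -
  have "br (hh k) X $ p $ q = sc (of_int (wt k p - wt k q)) (X $ p $ q)" for p q X
  proof (induction X rule: GG.homogeneous_cases)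
    case (homogeneous d X)
    have 1: "mat_mult (hh k) X $ p $ q = sc (of_int (wt k p)) (X $ p $ q)"
      by (simp add: mat_mult_nth hh_nth if_distrib[of "\<lambda>x. x * _"] scale_mult_left sum.delta'
          cong: if_cong)
    have 2: "mat_mult X (hh k) $ p $ q = sc (of_int (wt k q)) (X $ p $ q)"
      by (simp add: mat_mult_nth hh_nth if_distrib[of "\<lambda>x. _ * x"] scale_mult_right sum.delta
          cong: if_cong)
    show ?case
      by (simp add: GG.supercomm_homogeneous[OF hh_GG homogeneous] 1 2 scale_left_diff_distrib)
  qed (simp add: GG.supercomm_add_right scale_right_distrib)
  moreover have "sc (of_int (wt k p - wt k q)) (X $ p $ q) = sc (of_int n) (X $ p $ q)" for p q
    using assms by (cases "X $ p $ q = 0") (auto simp: wsp_def)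
  ultimately show ?thesis by (simp add: mat_eq_iff)
qed

definition unit_weight :: "int \<Rightarrow> bool"
  where "unit_weight n \<longleftrightarrow> n \<noteq> 0 \<and> (\<exists>c::'k. c * of_int n = 1)"

lemma unit_weightI: "n \<in> {1, -1, 2, -2, 4, -4} \<Longrightarrow> unit_weight n"
proof -
  assume n: "n \<in> {1, -1, 2, -2, 4, -4}"
  have "(hf * hf) * (2 * 2) = (2 * hf) * (2 * hf)" by (simp only: ac_simps)
  then have h4: "(hf * hf) * 4 = 1" by (simp add: two_hf)
  have h2: "hf * 2 = 1" using two_hf by (simp add: mult.commute)
  have "\<exists>c::'k. c * of_int n = 1"
    using n h2 h4
    by (auto intro: exI[of _ 1] exI[of _ "-1"] exI[of _ hf] exI[of _ "- hf"] exI[of _ "hf * hf"] exI[of _ "- (hf * hf)"])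
  then show ?thesis using n by (auto simp: unit_weight_def)
qed

text \<open>An index through which the matrix unit at \<open>(p, q)\<close> is written as a bracket.\<close>

definition rr :: "('m, 'n) idx \<Rightarrow> ('m, 'n) idx \<Rightarrow> ('m, 'n) idx"
  where "rr p q = (SOME r. cl r \<noteq> cl p \<and> cl r \<noteq> cl q)"

lemma cl_rr: "cl (rr p q) \<noteq> cl p" "cl (rr p q) \<noteq> cl q"
proof -
  have "cl (rr p q) \<noteq> cl p \<and> cl (rr p q) \<noteq> cl q"
    unfolding rr_def by (rule someI_ex) (use ex_class2 in blast)
  then show "cl (rr p q) \<noteq> cl p" "cl (rr p q) \<noteq> cl q" by auto
qed

lemma rr_neq: "p \<noteq> rr p q" "rr p q \<noteq> q" "rr p q \<noteq> ip p" "rr p q \<noteq> ip q"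
  using cl_rr[of p q] by (auto simp: cl_eq_iff)

subsection \<open>Diagonal and off-diagonal parts\<close>

definition offd :: "('r, 'm, 'n) mat \<Rightarrow> ('r, 'm, 'n) mat"
  where "offd X = (\<Sum>p\<in>UNIV. \<Sum>q\<in>UNIV. if p = q then 0 else tt p q (sc hf (X $ p $ q)))"

lemma offd_L: "offd X \<in> L"
  unfolding offd_def by (intro L_sum) (simp add: tt_L)

lemma offd_eq:
  assumes "X \<in> K" "\<And>p. X $ p $ p = 0"
  shows "offd X = X"
proof -
  have "offd X = (\<Sum>p\<in>UNIV. \<Sum>q\<in>UNIV. tt p q (sc hf (X $ p $ q)))"
    unfolding offd_def by (intro sum.cong refl) (auto simp: assms(2))
  then show ?thesis using K_expand[OF assms(1)] by simp
qed

lemma diag_part: "X \<in> K \<Longrightarrow> X - offd X = (\<Sum>p\<in>UNIV. tt p p (sc hf (X $ p $ p)))"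
proof -
  assume "X \<in> K"
  have "X = (\<Sum>p\<in>UNIV. \<Sum>q\<in>UNIV. (if p = q then tt p p (sc hf (X $ p $ p)) else 0)
      + (if p = q then 0 else tt p q (sc hf (X $ p $ q))))"
    by (subst K_expand[OF \<open>X \<in> K\<close>]) (intro sum.cong refl, auto)
  also have "\<dots> = (\<Sum>p\<in>UNIV. tt p p (sc hf (X $ p $ p))) + offd X"
    by (simp add: sum.distrib offd_def)
  finally show ?thesis by (simp add: algebra_simps)
qed

lemma diag_part_nth: "X \<in> K \<Longrightarrow> p \<noteq> q \<Longrightarrow> (X - offd X) $ p $ q = 0"
proof -
  assume X: "X \<in> K" and pq: "p \<noteq> q"
  have "tt l l a $ p $ q = 0" for l a
    using pq by (auto intro!: tt_nth_0)
  then show ?thesis unfolding diag_part[OF X] by simp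
qed

lemma GG_sum: "(\<And>x. x \<in> A \<Longrightarrow> f x \<in> GG d) \<Longrightarrow> sum f A \<in> GG d"
  by (rule msc.subspace_sum[OF subspace_GG])

lemma offd_GG:
  assumes "X \<in> GG d"
  shows "offd X \<in> GG d"
proof -
  have "tt p q (sc hf (X $ p $ q)) \<in> GG d" for p q
  proof -
    have "sc hf (X $ p $ q) \<in> G (d + idx_deg p + idx_deg q)"
      using assms by (intro sc_G) (simp add: mat_grading_def)
    from tt_GG[OF this, of p q] show ?thesis
      by (cases "idx_deg p"; cases "idx_deg q") (simp_all add: add.assoc)
  qed
  then show ?thesis unfolding offd_def by (intro GG_sum) (simp add: GG.H_0)
qed

lemma mat_mult_diag_left:
  assumes "\<And>p q. p \<noteq> q \<Longrightarrow> D $ p $ q = 0"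
  shows "mat_mult D X $ p $ q = D $ p $ p * X $ p $ q"
proof -
  have "(\<Sum>k\<in>UNIV. D $ p $ k * X $ k $ q) = (\<Sum>k\<in>UNIV. if k = p then D $ p $ k * X $ k $ q else 0)"
    by (rule sum.cong) (auto simp: assms)
  then show ?thesis by (simp add: mat_mult_nth)
qed

lemma mat_mult_diag_right:
  assumes "\<And>p q. p \<noteq> q \<Longrightarrow> D $ p $ q = 0"
  shows "mat_mult X D $ p $ q = X $ p $ q * D $ q $ q"
proof -
  have "(\<Sum>k\<in>UNIV. X $ p $ k * D $ k $ q) = (\<Sum>k\<in>UNIV. if k = q then X $ p $ k * D $ k $ q else 0)"
    by (rule sum.cong) (auto simp: assms)
  then show ?thesis by (simp add: mat_mult_nth)
qed

lemma br_diag_nth: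
  assumes "\<And>p q. p \<noteq> q \<Longrightarrow> D $ p $ q = 0" "D \<in> GG d" "X \<in> GG e"
  shows "br D X $ p $ q = D $ p $ p * X $ p $ q - sgn_deg (d * e) (X $ p $ q * D $ q $ q)"
  by (simp add: GG.supercomm_homogeneous[OF assms(2,3)] mat_mult_diag_left[OF assms(1)]
      sgn_deg_def mat_mult_diag_right[OF assms(1)])

end

section \<open>Cocycle values determined by weights and paths\<close>

context cocycle
begin

lemma w_br_right:
  assumes X: "X \<in> L" "X \<in> GG d" and Y: "Y \<in> L" "Y \<in> GG e" and Z: "Z \<in> L" "Z \<in> GG f"
  shows "w X (br Y Z) = w (br X Y) Z + sgn_deg (d * e) (w Y (br X Z))"
  using w_br_left[OF assms] by simp

text \<open>The element \<open>hh k\<close> acts on \<open>L \<otimes> L\<close> modulo the relations both by the weight and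
  by \<open>hh k \<otimes> [\<cdot>, \<cdot>]\<close>.\<close>

lemma torus:
  assumes X: "X \<in> L" "X \<in> GG d" "X \<in> wsp k m" and Y: "Y \<in> L" "Y \<in> GG e" "Y \<in> wsp k n"
    and c: "c * of_int (m + n) = 1"
  shows "w X Y = w (hh k) (msc c (br X Y))"
proof -
  let ?X = "msc c X"
  have X': "?X \<in> L" "?X \<in> GG d" using X by (auto intro: L_msc msc_GG)
  have "?X \<in> wsp k m" using X(3) by (rule wsp_msc)
  then have 1: "br (hh k) ?X = msc (of_int m) ?X" by (rule br_hh)
  have 2: "br (hh k) Y = msc (of_int n) Y" using Y(3) by (rule br_hh)
  have "w (msc (of_int m) ?X) Y = w (hh k) (br ?X Y) - w ?X (msc (of_int n) Y)"
    using w_br_left[OF hh_L hh_GG X' Y(1,2), of k] by (simp add: 1 2)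
  \<comment> \<open>The balance rule moves the weight of Y to the first argument, so that the two
    weights add up to m + n, which c inverts.\<close>
  then have "w (hh k) (br ?X Y) = w (msc (of_int m) ?X) Y + w (msc (of_int n) ?X) Y"
    using w_msc[OF X'(1) Y(1), of "of_int n"] by (simp only: diff_add_cancel)
  also have "\<dots> = w (msc (of_int m) ?X + msc (of_int n) ?X) Y"
    using X Y by (intro w_add_left[symmetric] L_msc) auto
  also have "msc (of_int m) ?X + msc (of_int n) ?X = msc (c * of_int (m + n)) X"
    by (simp add: algebra_simps flip: msc.scale_left_distrib)
  finally show ?thesis using c by (simp add: br_msc_left)
qed

lemma torus_tt:
  assumes "p \<noteq> q" "r \<noteq> s" "c * of_int (wt k p - wt k q + (wt k r - wt k s)) = 1"
  shows "w (tt p q a) (tt r s b) = w (hh k) (msc c (br (tt p q a) (tt r s b)))"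
proof (induction a b rule: G.homogeneous_cases2)
  case (homogeneous d e a b)
  show ?case
    by (rule torus[OF tt_L[OF assms(1)] tt_GG[OF homogeneous(1)] tt_wsp
          tt_L[OF assms(2)] tt_GG[OF homogeneous(2)] tt_wsp assms(3)])
qed (use assms(1,2) hh_L in \<open>simp_all add: tt_add w_add_left w_add_right tt_L GG.supercomm_add_left
    GG.supercomm_add_right msc.scale_right_distrib L_msc br_L\<close>)

text \<open>The value of \<open>w\<close> on a chosen lift of the off-diagonal part of Y through the
  bracket. The lift does not refer to any weight, so results for different k can be
  combined.\<close>

definition Fw :: "('r, 'm, 'n) mat \<Rightarrow> 'v"
  where "Fw Y = (\<Sum>p\<in>UNIV. \<Sum>q\<in>UNIV. if p = q then 0
    else w (tt p (rr p q) (sc hf (Y $ p $ q))) (tt (rr p q) q un))"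

lemma Fw_add: "Fw (X + Y) = Fw X + Fw Y"
proof -
  have "(if p = q then 0 else w (tt p (rr p q) (sc hf ((X + Y) $ p $ q))) (tt (rr p q) q un))
    = (if p = q then 0 else w (tt p (rr p q) (sc hf (X $ p $ q))) (tt (rr p q) q un))
    + (if p = q then 0 else w (tt p (rr p q) (sc hf (Y $ p $ q))) (tt (rr p q) q un))" for p q
    using rr_neq[of p q] by (simp add: scale_right_distrib w_tt_add_left tt_L)
  then show ?thesis unfolding Fw_def by (simp only: sum.distrib)
qed

text \<open>Every path term of \<open>Fw Y\<close> has the same total weight n, so
  \<open>torus_tt\<close> applies to all of them with the same c.\<close>

lemma Fw_wsp:
  assumes Y: "Y \<in> K" "Y \<in> wsp k n" and n: "n \<noteq> 0" and c: "c * of_int n = 1"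
  shows "Fw Y = w (hh k) (msc c Y)"
proof -
  have diag: "Y $ p $ p = 0" for p using Y(2) n unfolding wsp_def by fastforce
  have "(if p = q then 0 else w (tt p (rr p q) (sc hf (Y $ p $ q))) (tt (rr p q) q un))
    = w (hh k) (if p = q then 0 else msc c (tt p q (sc hf (Y $ p $ q))))" for p q
  proof (cases "p = q \<or> Y $ p $ q = 0")
    case True
    then show ?thesis using hh_L rr_neq[of p q] by (auto simp: tt_L)
  next
    case False
    then have "wt k p - wt k q = n" using Y(2) by (simp add: wsp_def)
    then have "c * of_int (wt k p - wt k (rr p q) + (wt k (rr p q) - wt k q)) = 1" using c by simp
    then have "w (tt p (rr p q) (sc hf (Y $ p $ q))) (tt (rr p q) q un)
      = w (hh k) (msc c (br (tt p (rr p q) (sc hf (Y $ p $ q))) (tt (rr p q) q un)))"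
      using rr_neq[of p q] by (intro torus_tt) auto
    also have "br (tt p (rr p q) (sc hf (Y $ p $ q))) (tt (rr p q) q un) = tt p q (sc hf (Y $ p $ q))"
      using rr_neq[of p q] False by (subst br_tt_path) auto
    finally show ?thesis using False by simp
  qed
  then have "Fw Y = (\<Sum>p\<in>UNIV. \<Sum>q\<in>UNIV.
      w (hh k) (if p = q then 0 else msc c (tt p q (sc hf (Y $ p $ q)))))"
    unfolding Fw_def by simp
  also have "\<dots> = w (hh k) (\<Sum>p\<in>UNIV. \<Sum>q\<in>UNIV. if p = q then 0 else msc c (tt p q (sc hf (Y $ p $ q))))"
    by (simp add: w_sum_right hh_L L_sum L_msc tt_L)
  also have "(\<Sum>p\<in>UNIV. \<Sum>q\<in>UNIV. if p = q then 0 else msc c (tt p q (sc hf (Y $ p $ q))))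
    = msc c (offd Y)"
    unfolding offd_def msc.scale_sum_right by (intro sum.cong refl) simp
  finally show ?thesis using offd_eq[OF Y(1) diag] by simp
qed

lemma normal_unit_weight:
  assumes "p \<noteq> q" "r \<noteq> s" "unit_weight (wt k p - wt k q + (wt k r - wt k s))"
  shows "w (tt p q a) (tt r s b) = Fw (br (tt p q a) (tt r s b))"
proof -
  from assms(3) obtain c :: 'k where c: "c * of_int (wt k p - wt k q + (wt k r - wt k s)) = 1"
    unfolding unit_weight_def by blast
  have "w (tt p q a) (tt r s b) = w (hh k) (msc c (br (tt p q a) (tt r s b)))"
    by (rule torus_tt[OF assms(1,2) c])
  also have "\<dots> = Fw (br (tt p q a) (tt r s b))"
    using assms(3) unfolding unit_weight_def
    by (intro Fw_wsp[symmetric, OF br_K[OF tt_K tt_K] br_tt_wsp _ c]) blast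
  finally show ?thesis .
qed

text \<open>In the Jacobi relation for the two legs of the path and the third unit, only the
  required value is left.\<close>

lemma zero_by_path:
  assumes "p \<noteq> q" "cl r \<noteq> cl p" "cl r \<noteq> cl q" "s \<noteq> t"
    and "\<And>a b. br (tt p r a) (tt s t b) = 0" "\<And>a b. br (tt r q a) (tt s t b) = 0"
  shows "w (tt p q a) (tt s t b) = 0"
proof -
  have ne: "p \<noteq> r" "r \<noteq> q" "r \<noteq> ip p" "r \<noteq> ip q" using assms(2,3) by (auto simp: cl_eq_iff)
  show ?thesis
  proof (induction a b rule: G.homogeneous_cases2)
    case (homogeneous d e a b)
    have "br (tt p r a) (tt r q un) = tt p q a"
      using ne assms(1) by (subst br_tt_path) auto
    then show ?case
      using w_br_left[OF tt_L tt_GG[OF homogeneous(1)] tt_L tt_GG[OF un_G] tt_L tt_GG[OF homogeneous(2)],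
          of p r r q s t] ne assms
      by (simp add: tt_L)
  qed (use assms(1,4) in \<open>simp_all add: w_tt_add_left w_tt_add_right tt_L\<close>)
qed

text \<open>The weight at the class of k is 3 or -3 here, hence possibly not invertible. The first
  unit is written through a third class, and both legs commute with the second unit.\<close>

lemma zero_short_long:
  assumes k: "idx_deg k = 1"
  shows "w (tt k (ip k) b) (tt k (Inl i) a) = 0"
proof -
  have kk: "k \<noteq> ip k" "ip k \<noteq> k" "k \<noteq> Inl i" using k by (cases k rule: idx_cases; simp)+
  obtain r :: "('m, 'n) idx" where r: "cl r \<noteq> cl k" "cl r \<noteq> cl (Inl i)" by (rule ex_class2)
  then have "r \<noteq> k" "k \<noteq> r" "r \<noteq> ip k" "Inl i \<noteq> r" by (auto simp: cl_eq_iff)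
  then show ?thesis using kk r by (intro zero_by_path[of _ _ r]) (auto intro!: br_tt_0)
qed

text \<open>All weights vanish on orthogonal indices. A path through a symplectic class gives legs
  that commute with the second unit.\<close>

lemma zero_orth:
  assumes "i \<noteq> j" "k \<noteq> l" "{i, j} \<inter> {k, l} = {}"
  shows "w (tt (Inl i) (Inl j) a) (tt (Inl k) (Inl l) b) = 0"
  using assms by (intro zero_by_path[of _ _ "Inr (Inl k1)"]) (auto intro!: br_tt_0)

text \<open>Mirroring both units and swapping them turns the path from j to i through r into a path
  from i to j through \<open>ip r\<close>, to which \<open>path_orth\<close> applies.\<close>

lemma path_orth_reverse:
  assumes ij: "i \<noteq> j" and r: "cl r \<noteq> Inl i" "cl r \<noteq> Inl j" and s: "cl s \<noteq> Inl i" "cl s \<noteq> Inl j"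
  shows "w (tt (Inl j) r (- bar x)) (tt r (Inl i) un) = w (tt (Inl i) s x) (tt s (Inl j) un)"
proof -
  have ne: "Inl j \<noteq> r" "r \<noteq> Inl i" "Inl i \<noteq> s" "s \<noteq> Inl j" "Inl i \<noteq> ip r" "ip r \<noteq> Inl j"
    using r s by auto
  have hom: "w (tt (Inl j) r (- bar x)) (tt r (Inl i) un) = w (tt (Inl i) s x) (tt s (Inl j) un)"
    if x: "x \<in> G d" for x d
  proof -
    define y where "y = - bar x"
    have y: "y \<in> G d" unfolding y_def by (intro G.H_minus bar_degree x)
    define A B where "A = - dual d (Inl j) r y" and "B = - dual 0 r (Inl i) un"
    have A: "A \<in> G d" and B: "B \<in> G 0"
      unfolding A_def B_def by (auto intro!: G.H_minus dual_G y)
    have "w (tt (Inl j) r y) (tt r (Inl i) un) = w (tt (ip r) (Inl j) A) (tt (Inl i) (ip r) B)"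
      using tt_dual[OF y, of "Inl j" r] tt_dual[OF un_G, of r "Inl i"] by (simp add: A_def B_def)
    also have "\<dots> = - sgn_deg ((d + idx_deg r) * idx_deg r) (w (tt (Inl i) (ip r) B) (tt (ip r) (Inl j) A))"
      using w_swap[OF tt_L tt_GG[OF A] tt_L tt_GG[OF B], of "ip r" "Inl j" "Inl i" "ip r"] ne
      by simp
    also have "w (tt (Inl i) (ip r) B) (tt (ip r) (Inl j) A)
      = w (tt (Inl i) s (B * A)) (tt s (Inl j) un)"
      using r s by (intro path_orth ij) auto
    also have "B * A = - sgn_deg ((d + idx_deg r) * idx_deg r) x"
      unfolding A_def B_def y_def
      by (cases r rule: idx_cases; cases d)
        (simp_all add: dual_def star_sgn_def bar.neg bar_bar sgn_deg_minus)
    finally show ?thesis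
      unfolding y_def using ne
      by (cases "idx_deg r"; cases d) (simp_all add: tt_minus w_minus_left tt_L L_minus)
  qed
  show ?thesis
  proof (induction x rule: G.homogeneous_cases)
    case (add x y)
    have "- bar (x + y) = - bar x + - bar y" by (simp add: bar.add)
    then show ?case
      using add w_tt_add_left[OF ne(1) tt_L[OF ne(2)], of "- bar x" "- bar y"]
        w_tt_add_left[OF ne(3) tt_L[OF ne(4)]] by simp
  qed (use hom in blast)
qed

text \<open>The skew unit has the entry x at (i, j) and - \<open>bar x\<close> at (j, i). By the two
  path lemmas each entry contributes half of the value.\<close>

lemma Fw_tt_orth:
  assumes ij: "i \<noteq> j" and s: "cl s \<noteq> Inl i" "cl s \<noteq> Inl j"
  shows "Fw (tt (Inl i) (Inl j) x) = w (tt (Inl i) s x) (tt s (Inl j) un)"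
proof -
  let ?i = "Inl i :: ('m, 'n) idx" and ?j = "Inl j :: ('m, 'n) idx"
  have Y: "tt ?i ?j x $ p $ q = (if p = ?i \<and> q = ?j then x else if p = ?j \<and> q = ?i then - bar x else 0)" for p q
  proof -
    have "tt ?i ?j x $ ?i $ ?j = x" using ij by (intro tt_nth_1) simp
    moreover have "tt ?i ?j x $ ?j $ ?i = - bar x"
      unfolding tt_orth[of i j x] using ij by (simp add: tt_nth_1)
    ultimately show ?thesis by (auto intro!: tt_nth_0)
  qed
  let ?f = "\<lambda>p q. w (tt p (rr p q) (sc hf (tt ?i ?j x $ p $ q))) (tt (rr p q) q un)"
  let ?g = "\<lambda>s. w (tt ?i s x) (tt s ?j un)"
  have ne: "rr p q \<noteq> p" "p \<noteq> rr p q" "rr p q \<noteq> q" for p q :: "('m, 'n) idx"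
    using rr_neq[of p q] by auto
  have "(if p = q then 0 else ?f p q) = (if p = ?i then if q = ?j then ?f ?i ?j else 0 else 0)
      + (if p = ?j then if q = ?i then ?f ?j ?i else 0 else 0)" for p q
    using ij ne[of p q] ne[of q p] by (auto simp: Y tt_L)
  then have "Fw (tt ?i ?j x) = ?f ?i ?j + ?f ?j ?i"
    unfolding Fw_def by (simp only: sum.distrib sum_delta2)
  also have "?f ?i ?j = w (tt ?i s (sc hf x)) (tt s ?j un)"
    using path_orth[OF ij _ _ s, of "rr ?i ?j" "sc hf x" un] cl_rr[of ?i ?j] by (simp add: Y)
  also have "?f ?j ?i = w (tt ?i s (sc hf x)) (tt s ?j un)"
    using path_orth_reverse[OF ij _ _ s, of "rr ?j ?i" "sc hf x"] cl_rr[of ?j ?i] ij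
    by (simp add: Y bar.scale)
  also have "w (tt ?i s (sc hf x)) (tt s ?j un) + w (tt ?i s (sc hf x)) (tt s ?j un) = ?g s"
  proof -
    have "?i \<noteq> s" "s \<noteq> ?j" using s by auto
    then show ?thesis
      using w_tt_add_left[of ?i s "tt s ?j un" "sc hf x" "sc hf x"] by (simp add: sc_hf_add tt_L)
  qed
  finally show ?thesis .
qed

lemma normal_path_orth:
  assumes "i \<noteq> j" "cl r \<noteq> Inl i" "cl r \<noteq> Inl j"
  shows "w (tt (Inl i) r a) (tt r (Inl j) b) = Fw (tt (Inl i) (Inl j) (a * b))"
  using path_orth[OF assms assms(2,3)] Fw_tt_orth[OF assms] by simp

subsection \<open>Cocycles that vanish on off-diagonal matrix units\<close>

context
  assumes off: "\<And>p q r s a b. p \<noteq> q \<Longrightarrow> r \<noteq> s \<Longrightarrow> w (tt p q a) (tt r s b) = 0"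
begin

lemma w_offd_offd: "w (offd X) (offd Y) = 0"
proof -
  have "w (if p = q then 0 else tt p q a) (if r = s then 0 else tt r s b) = 0" for p q r s a b
    by (simp add: off tt_L)
  then show ?thesis
    unfolding offd_def by (simp add: w_sum_left w_sum_right L_sum tt_L)
qed

lemma w_off:
  assumes "X \<in> K" "\<And>p. X $ p $ p = 0" "Y \<in> K" "\<And>p. Y $ p $ p = 0"
  shows "w X Y = 0"
  using w_offd_offd[of X Y] offd_eq[OF assms(1,2)] offd_eq[OF assms(3,4)] by simp

lemma off_diag_L: "X \<in> K \<Longrightarrow> (\<And>p. X $ p $ p = 0) \<Longrightarrow> X \<in> L"
  using offd_eq offd_L by metis

context
  fixes D d
  assumes D: "D \<in> L" "D \<in> GG d" "\<And>p q. p \<noteq> q \<Longrightarrow> D $ p $ q = 0"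
begin

text \<open>Bracketing with the diagonal matrix D preserves off-diagonal matrices, so both terms of
  the derivation rule vanish by \<open>w_off\<close>.\<close>

lemma w_diag_br:
  assumes X: "X \<in> K" "X \<in> GG e" "\<And>p. X $ p $ p = 0" and Y: "Y \<in> K" "Y \<in> GG f" "\<And>p. Y $ p $ p = 0"
  shows "w D (br X Y) = 0"
proof -
  have br: "br D X \<in> K" "\<And>p. br D X $ p $ p = 0" if "X \<in> K" "X \<in> GG e" "\<And>p. X $ p $ p = 0" for X e
    using that L_K[OF D(1)] br_diag_nth[OF D(3,2) that(2)] by (auto intro: br_K)
  show ?thesis
    using w_br_right[OF D(1,2) off_diag_L[OF X(1,3)] X(2) off_diag_L[OF Y(1,3)] Y(2)]
      w_off[OF br[OF X] Y(1,3)] w_off[OF X(1,3) br[OF Y]] by simp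
qed

lemma tt_diag_0: "p \<noteq> q \<Longrightarrow> tt p q a $ l $ l = 0"
  by (rule tt_nth_0) auto

lemma w_diag_br_tt:
  assumes "p \<noteq> q" "r \<noteq> s"
  shows "w D (br (tt p q a) (tt r s b)) = 0"
proof (induction a b rule: G.homogeneous_cases2)
  case (homogeneous d e a b)
  show ?case
    by (rule w_diag_br[OF tt_K tt_GG[OF homogeneous(1)] tt_diag_0[OF assms(1)] tt_K
          tt_GG[OF homogeneous(2)] tt_diag_0[OF assms(2)]])
qed (use assms D(1) in \<open>simp_all add: tt_add GG.supercomm_add_left GG.supercomm_add_right
    w_add_right br_L tt_L\<close>)

lemma w_diag_tt: "p \<noteq> q \<Longrightarrow> w D (tt p q a) = 0"
proof -
  assume "p \<noteq> q"
  then have "br (tt p (rr p q) a) (tt (rr p q) q un) = tt p q a"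
    using rr_neq[of p q] by (subst br_tt_path) auto
  then show ?thesis using w_diag_br_tt[of p "rr p q" "rr p q" q a un] rr_neq[of p q] by simp
qed

lemma w_diag_offd: "w D (offd X) = 0"
  unfolding offd_def using D(1)
  by (simp add: w_sum_right L_sum tt_L w_diag_tt if_distrib[of "w D"] cong: if_cong)

lemma w_diag_off: "X \<in> K \<Longrightarrow> (\<And>p. X $ p $ p = 0) \<Longrightarrow> w D X = 0"
  using w_diag_offd[of X] offd_eq[of X] by simp

text \<open>The diagonal entries of a bracket of diagonal elements are supercommutators, and these
  are also produced by brackets of opposite off-diagonal matrix units.\<close>

lemma tt_diag_comm:
  assumes x: "x \<in> G e" and y: "y \<in> G f"
  shows "tt p p (x * y) - sgn_deg (e * f) (tt p p (y * x))
    = br (tt p (rr p p) x) (tt (rr p p) p y) - sgn_deg (e * f) (br (tt p (rr p p) un) (tt (rr p p) p (y * x)))"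
proof -
  let ?r = "rr p p"
  have "?r \<noteq> p" "?r \<noteq> ip p" using rr_neq[of p p] by auto
  then have ne: "p \<noteq> ?r" "p \<noteq> ip ?r" by (metis, metis ip_ip)
  have yx: "y * x \<in> G (f + e)" using x y by (auto intro: grading_mult)
  \<comment> \<open>The two brackets contribute the same diagonal term at \<open>rr p p\<close>, and
    these terms cancel.\<close>
  show ?thesis
    unfolding br_tt_opposite[OF ne x y] br_tt_opposite[OF ne un_G yx]
    by (cases "idx_deg p"; cases "idx_deg ?r"; cases e; cases f) simp_all
qed

lemma w_diag_tt_comm:
  assumes x: "x \<in> G e" and y: "y \<in> G f"
  shows "tt p p (x * y - sgn_deg (e * f) (y * x)) \<in> L"
    and "w D (tt p p (x * y - sgn_deg (e * f) (y * x))) = 0"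
proof -
  have ne: "p \<noteq> rr p p" "rr p p \<noteq> p" using rr_neq[of p p] by auto
  have L1: "br (tt p (rr p p) a) (tt (rr p p) p b) \<in> L" for a b
    by (intro br_K_L tt_K)
  show "tt p p (x * y - sgn_deg (e * f) (y * x)) \<in> L"
    unfolding tt_diff tt_sgn_deg tt_diag_comm[OF assms] by (intro L_diff L_sgn_deg L1)
  have "w D (X - Y) = w D X - w D Y" if "X \<in> L" "Y \<in> L" for X Y
    using w_add_right[OF D(1) that(1) L_minus[OF that(2)]] w_minus_right[OF D(1) that(2)] by simp
  then show "w D (tt p p (x * y - sgn_deg (e * f) (y * x))) = 0"
    unfolding tt_diff tt_sgn_deg tt_diag_comm[OF assms]
    using ne D(1) by (simp add: L1 L_sgn_deg w_sgn_right w_diag_br_tt)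
qed

lemma w_diag_br_diag:
  assumes X: "X \<in> K" "X \<in> GG e" "\<And>p q. p \<noteq> q \<Longrightarrow> X $ p $ q = 0"
    and Y: "Y \<in> K" "Y \<in> GG f" "\<And>p q. p \<noteq> q \<Longrightarrow> Y $ p $ q = 0"
  shows "w D (br X Y) = 0"
proof -
  have entry: "Z $ p $ p \<in> G e" if "Z \<in> GG e" for Z :: "('r, 'm, 'n) mat" and p e
  proof -
    have "Z $ p $ p \<in> G (e + idx_deg p + idx_deg p)" using that unfolding mat_grading_def by blast
    then show ?thesis by (simp add: add.assoc)
  qed
  have nth: "br X Y $ p $ q = (if p = q then X $ p $ p * Y $ p $ p - sgn_deg (e * f) (Y $ p $ p * X $ p $ p) else 0)" for p q
    using br_diag_nth[OF X(3,2) Y(2), of p q] Y(3)[of p q] by auto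
  let ?c = "\<lambda>p. X $ p $ p * sc hf (Y $ p $ p) - sgn_deg (e * f) (sc hf (Y $ p $ p) * X $ p $ p)"
  have "br X Y = (\<Sum>p\<in>UNIV. tt p p (sc hf (br X Y $ p $ p)))"
  proof -
    have "offd (br X Y) = 0" unfolding offd_def by (intro sum.neutral ballI) (simp add: nth)
    then show ?thesis using diag_part[OF br_K[OF X(1) Y(1)]] by simp
  qed
  also have "\<dots> = (\<Sum>p\<in>UNIV. tt p p (?c p))"
    by (intro sum.cong refl arg_cong[where f = "tt _ _"])
      (simp add: nth scale_right_diff_distrib scale_mult_left scale_mult_right sgn_deg_def)
  finally have eq: "br X Y = (\<Sum>p\<in>UNIV. tt p p (?c p))" .
  have c: "tt p p (?c p) \<in> L" "w D (tt p p (?c p)) = 0" for p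
    using w_diag_tt_comm[OF entry[OF X(2)] sc_G[OF entry[OF Y(2)]]] by auto
  show ?thesis unfolding eq using D(1) c by (simp add: w_sum_right)
qed

lemma offd_diag: "offd X $ l $ l = 0"
  unfolding offd_def by (simp add: tt_diag_0 if_distrib[of "\<lambda>Z. Z $ l $ l"] cong: if_cong)

lemma w_diag_br_K:
  assumes X: "X \<in> K" "X \<in> GG e" and Y: "Y \<in> K" "Y \<in> GG f"
  shows "w D (br X Y) = 0"
proof -
  define X0 X1 Y0 Y1 where "X0 = offd X" and "X1 = X - offd X" and "Y0 = offd Y" and "Y1 = Y - offd Y"
  have K: "X0 \<in> K" "X1 \<in> K" "Y0 \<in> K" "Y1 \<in> K"
    using X Y L_K[OF offd_L] by (simp_all add: X0_def X1_def Y0_def Y1_def msc.subspace_diff[OF subspace_K])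
  have G: "X0 \<in> GG e" "X1 \<in> GG e" "Y0 \<in> GG f" "Y1 \<in> GG f"
    using X Y by (auto simp: X0_def X1_def Y0_def Y1_def intro!: offd_GG GG.H_diff)
  have d0: "X0 $ p $ p = 0" "Y0 $ p $ p = 0" for p
    by (simp_all add: X0_def Y0_def offd_diag)
  have d1: "p \<noteq> q \<Longrightarrow> X1 $ p $ q = 0" "p \<noteq> q \<Longrightarrow> Y1 $ p $ q = 0" for p q
    unfolding X1_def Y1_def by (rule diag_part_nth[OF X(1)], assumption, rule diag_part_nth[OF Y(1)], assumption)
  have 1: "w D (br X0 Y0) = 0" by (rule w_diag_br[OF K(1) G(1) d0(1) K(3) G(3) d0(2)])
  have 2: "w D (br X1 Y0) = 0"
    by (rule w_diag_off) (auto intro: br_K K simp: br_diag_nth[OF d1(1) G(2,3)] d0)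
  have "w D (br Y1 X0) = 0"
    by (rule w_diag_off) (auto intro: br_K K simp: br_diag_nth[OF d1(2) G(4,1)] d0)
  then have 3: "w D (br X0 Y1) = 0"
    unfolding br_skew[OF G(1,4)] using D(1) K
    by (simp add: w_minus_right w_sgn_right br_K_L L_sgn_deg)
  have 4: "w D (br X1 Y1) = 0" by (rule w_diag_br_diag[OF K(2) G(2) d1(1) K(4) G(4) d1(2)])
  have "X = X0 + X1" "Y = Y0 + Y1" by (simp_all add: X0_def X1_def Y0_def Y1_def)
  then have "br X Y = br X0 Y0 + br X1 Y0 + (br X0 Y1 + br X1 Y1)"
    by (simp only: GG.supercomm_add_left GG.supercomm_add_right)
  then show ?thesis using 1 2 3 4 D(1) K by (simp add: w_add_right br_K_L L_add)
qed

end

lemma w_diag_L: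
  assumes "Z \<in> L" "D \<in> L" "D \<in> GG d" "\<And>p q. p \<noteq> q \<Longrightarrow> D $ p $ q = 0"
  shows "w D Z = 0"
proof -
  let ?P = "\<lambda>D d. D \<in> L \<and> D \<in> GG d \<and> (\<forall>p q. p \<noteq> q \<longrightarrow> D $ p $ q = 0)"
  \<comment> \<open>Quantifying over D inside the set makes it closed under scalars: a scalar on Z
    is moved to D by the balance rule.\<close>
  let ?Q = "{Z \<in> L. \<forall>D d. ?P D d \<longrightarrow> w D Z = 0}"
  have "L \<subseteq> ?Q"
  proof (rule L_subset_subspace)
    show "msc.subspace ?Q"
    proof (rule msc.subspaceI)
      fix c Z
      assume Z: "Z \<in> ?Q"
      have "w D (msc c Z) = 0" if "?P D d" for D d
      proof -
        have "?P (msc c D) d" using that by (simp add: L_msc msc_GG)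
        then have "w (msc c D) Z = 0" using Z by blast
        then show ?thesis using w_msc[of D Z c] that Z by simp
      qed
      then show "msc c Z \<in> ?Q" using Z L_msc by blast
    qed (auto simp: w_add_right L_add)
    show "br X Y \<in> ?Q" if "X \<in> K" "X \<in> GG d" "Y \<in> K" "Y \<in> GG e" for X Y d e
      using that w_diag_br_K by (auto intro: br_K_L)
  qed
  then show ?thesis using assms by blast
qed

text \<open>The dual form of the statement that off-diagonal tensors span: a cocycle is determined
  by its values on them.\<close>

lemma w_vanishes:
  assumes "X \<in> L" "Y \<in> L"
  shows "w X Y = 0"
  using assms(1)
proof (induction X rule: L_homogeneous_induct)
  case X: (homogeneous d X)
  from \<open>Y \<in> L\<close> show ?case
  proof (induction Y rule: L_homogeneous_induct)
    case Y: (homogeneous e Y)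
    define X1 Y1 where "X1 = X - offd X" and "Y1 = Y - offd Y"
    have L: "X1 \<in> L" "Y1 \<in> L" using X Y by (auto simp: X1_def Y1_def intro!: L_diff offd_L)
    have G: "X1 \<in> GG d" "Y1 \<in> GG e" using X Y by (auto simp: X1_def Y1_def intro!: GG.H_diff offd_GG)
    have 1: "w X1 Y = 0"
      by (rule w_diag_L[OF Y(2) L(1) G(1)]) (unfold X1_def, rule diag_part_nth[OF L_K[OF X(2)]])
    have "w Y1 (offd X) = 0"
      by (rule w_diag_L[OF offd_L L(2) G(2)]) (unfold Y1_def, rule diag_part_nth[OF L_K[OF Y(2)]])
    then have 2: "w (offd X) Y1 = 0"
      using w_swap[OF offd_L offd_GG[OF X(1)] L(2) G(2)] by simp
    have "X = offd X + X1" "Y = offd Y + Y1" by (simp_all add: X1_def Y1_def)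
    then have "w X Y = w (offd X) (offd Y) + w (offd X) Y1 + w X1 Y"
      using L Y(2) offd_L w_add_left[of "offd X" X1 Y] w_add_right[of "offd X" "offd Y" Y1] by simp
    then show ?case using 1 2 w_offd_offd by simp
  next
    case (add Y Z)
    then show ?case using X by (simp add: w_add_right)
  qed
next
  case (add X Z)
  then show ?case using assms(2) by (simp add: w_add_left)
qed

end

end

context osp_setup
begin

section \<open>The normal form of elements of the tensor square\<close>

type_synonym ('c, 'r1, 'm1, 'n1) tsq = "('r1, 'm1, 'n1) mat \<times> ('r1, 'm1, 'n1) mat \<Rightarrow>\<^sub>0 'c"

abbreviation W :: "('k, 'r, 'm, 'n) tsq set"
  where "W \<equiv> H2_rels msc GG br L"

lemma subspace_W: "free.subspace W"
  unfolding H2_rels_def by (rule free.subspace_span)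

lemma tensor_rels_W: "tensor_rels msc L \<subseteq> W"
  unfolding H2_rels_def by (intro subset_trans[OF _ free.span_superset]) blast

lemma skew_W: "X \<in> L \<Longrightarrow> X \<in> GG d \<Longrightarrow> Y \<in> L \<Longrightarrow> Y \<in> GG e \<Longrightarrow> gen X Y + sgn_deg (d * e) (gen Y X) \<in> W"
  unfolding H2_rels_def by (rule free.span_base) blast

lemma jacobi_W:
  assumes "X \<in> L" "X \<in> GG d" "Y \<in> L" "Y \<in> GG e" "Z \<in> L" "Z \<in> GG f"
  shows "sgn_deg (d * f) (gen (br X Y) Z) + sgn_deg (e * d) (gen (br Y Z) X)
    + sgn_deg (f * e) (gen (br Z X) Y) \<in> W"
  unfolding H2_rels_def by (rule free.span_base) (use assms in blast)

lemma cocycle_of_hom: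
  assumes f: "additive f" and W: "\<And>u. u \<in> W \<Longrightarrow> f u = 0"
  shows "cocycle sc G bar (\<lambda>X Y. f (gen X Y))"
proof (intro cocycle.intro osp_setup_axioms cocycle_axioms.intro)
  interpret f: additive f by (rule f)
  note rels = tensor_rels_add[OF tensor_rels_W, THEN W] tensor_rels_scale[OF tensor_rels_W, THEN W]
  show "f (gen (X + X') Y) = f (gen X Y) + f (gen X' Y)" if "X \<in> L" "X' \<in> L" "Y \<in> L" for X X' Y
    using rels(1)[OF that] by (simp add: f.diff f.add diff_diff_eq)
  show "f (gen X (Y + Y')) = f (gen X Y) + f (gen X Y')" if "X \<in> L" "Y \<in> L" "Y' \<in> L" for X Y Y'
    using rels(2)[OF that(2,3,1)] by (simp add: f.diff f.add diff_diff_eq)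
  show "f (gen (msc c X) Y) = f (gen X (msc c Y))" if "X \<in> L" "Y \<in> L" for X Y c
    using rels(3,4)[OF that] by (simp add: f.diff)
  show "f (gen X Y) + sgn_deg (d * e) (f (gen Y X)) = 0"
    if "X \<in> L" "X \<in> GG d" "Y \<in> L" "Y \<in> GG e" for X Y d e
    using W[OF skew_W[OF that]] by (simp add: f.add f.sgn_deg)
  show "sgn_deg (d * g) (f (gen (br X Y) Z)) + sgn_deg (e * d) (f (gen (br Y Z) X))
      + sgn_deg (g * e) (f (gen (br Z X) Y)) = 0"
    if "X \<in> L" "X \<in> GG d" "Y \<in> L" "Y \<in> GG e" "Z \<in> L" "Z \<in> GG g" for X d Y e Z g
    using W[OF jacobi_W[OF that]] by (simp add: f.add f.sgn_deg)
qed

lemma W_by_cocycles: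
  assumes "\<And>f :: ('k, 'r, 'm, 'n) tsq \<Rightarrow> circle. additive f \<Longrightarrow>
    cocycle sc G bar (\<lambda>X Y. f (gen X Y)) \<Longrightarrow> f z = 0"
  shows "z \<in> W"
  by (rule mem_subspace_by_homs[OF module_free_scale subspace_W])
    (use assms cocycle_of_hom in blast)

abbreviation q0 :: "('m, 'n) idx"
  where "q0 \<equiv> Inr (Inl k1)"

definition gF :: "('r, 'm, 'n) mat \<Rightarrow> ('k, 'r, 'm, 'n) tsq"
  where "gF Y = (\<Sum>p\<in>UNIV. \<Sum>q\<in>UNIV. if p = q then 0
    else gen (tt p (rr p q) (sc hf (Y $ p $ q))) (tt (rr p q) q un))"

definition gM :: "('m, 'n) idx \<Rightarrow> 'r \<Rightarrow> 'r \<Rightarrow> ('k, 'r, 'm, 'n) tsq"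
  where "gM q a b = gen (tt o1 q a) (tt q o1 b)"

definition glam :: "bit \<Rightarrow> bit \<Rightarrow> 'r \<Rightarrow> 'r \<Rightarrow> ('k, 'r, 'm, 'n) tsq"
  where "glam d e a b = gM q0 a b - sgn_deg (d * e) (gM q0 un (b * a))"

definition Lam :: "('r \<times> 'r \<Rightarrow>\<^sub>0 'k) \<Rightarrow> ('k, 'r, 'm, 'n) tsq"
  where "Lam = free_lift free_scale
    (\<lambda>(a, b). \<Sum>d\<in>UNIV. \<Sum>e\<in>UNIV. glam d e (hcomp G d a) (hcomp G e b))"

text \<open>One index from each class other than that of \<open>o1\<close>.\<close>

definition P :: "('m, 'n) idx set"
  where "P = {p. p \<noteq> o1 \<and> tau p = 0}"

text \<open>The summands carry the off-diagonal part of the bracket, its diagonal part at the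
  classes other than that of \<open>o1\<close>, and the candidates for the kernel.\<close>

definition nf :: "('r, 'm, 'n) mat \<Rightarrow> (('m, 'n) idx \<Rightarrow> 'r) \<Rightarrow> ('r \<times> 'r \<Rightarrow>\<^sub>0 'k) \<Rightarrow> ('k, 'r, 'm, 'n) tsq"
  where "nf X a t = gF X + (\<Sum>p\<in>P. gM p un (a p)) + Lam t"

text \<open>The diagonal of X has to vanish because \<open>gF\<close> sees only off-diagonal
  entries; this makes \<open>bmap (gF X)\<close> equal to X.\<close>

definition N :: "('k, 'r, 'm, 'n) tsq set"
  where "N = {z. \<exists>X a t. X \<in> L \<and> (\<forall>p. X $ p $ p = 0) \<and> z - nf X a t \<in> W}"

lemma Lam_additive: "additive Lam"
  unfolding Lam_def by standard (rule free_lift_add[OF module_free_scale])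

end

locale hom_cocycle = osp_setup sc G bar i1 k1 + f: additive f +
    cocycle sc G bar i1 k1 "\<lambda>X Y. f (gen X Y)"
  for sc :: "'k::comm_ring_1 \<Rightarrow> 'r::ring \<Rightarrow> 'r"
    and G :: "bit \<Rightarrow> 'r set"
    and bar :: "'r \<Rightarrow> 'r"
    and i1 :: "'m::finite" and k1 :: "'n::finite"
    and f :: "(('r, 'm, 'n) mat \<times> ('r, 'm, 'n) mat \<Rightarrow>\<^sub>0 'k) \<Rightarrow> 'v::ab_group_add"
begin

lemma f_gF: "f (gF Y) = Fw Y"
  by (simp add: gF_def Fw_def f.sum if_distrib[of f] f.zero cong: if_cong)

lemma f_gM: "f (gM q a b) = M q a b"
  by (simp add: gM_def M_def)

lemma f_glam: "f (glam d e a b) = lam q0 d e a b"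
  by (simp add: glam_def lam_def f.diff f.sgn_deg f_gM)

lemma f_Lam_gen: "f (Lam (gen a b)) = (\<Sum>d\<in>UNIV. \<Sum>e\<in>UNIV. lam q0 d e (hcomp G d a) (hcomp G e b))"
  by (simp add: Lam_def free_lift_gen[OF module_free_scale] f.sum f_glam)

lemma lam_zero: "q \<noteq> o1 \<Longrightarrow> lam q d e 0 b = 0" "q \<noteq> o1 \<Longrightarrow> lam q d e a 0 = 0"
  using M_add_left[of q 0 0] M_add_right[of q _ 0 0] by (simp_all add: lam_def)

lemma f_Lam_gen_homogeneous:
  assumes "a \<in> G d" "b \<in> G e"
  shows "f (Lam (gen a b)) = lam q0 d e a b"
  by (cases d; cases e)
    (simp_all add: f_Lam_gen sum_bit G.hcomp_homogeneous[OF assms(1)] G.hcomp_homogeneous[OF assms(2)] lam_zero)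

lemma f_nf: "f (nf X a t) = Fw X + (\<Sum>p\<in>P. M p un (a p)) + f (Lam t)"
  by (simp add: nf_def f.add f.sum f_gF f_gM)

lemma f_nf_0: "f (nf X (\<lambda>_. 0) 0) = Fw X"
proof -
  have "M p un 0 = 0" if "p \<in> P" for p
    using M_add_right[of p un 0 0] that by (simp add: P_def)
  then show ?thesis by (simp add: f_nf additive.zero[OF Lam_additive] f.zero)
qed

end

section \<open>The subgroup of elements that have a normal form\<close>

context osp_setup
begin

abbreviation circle_cocycle :: "(('k, 'r, 'm, 'n) tsq \<Rightarrow> circle) \<Rightarrow> bool"
  where "circle_cocycle \<equiv> hom_cocycle sc G bar"

lemma W_by_homs:
  assumes "\<And>f. circle_cocycle f \<Longrightarrow> f z = 0"
  shows "z \<in> W"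
  by (rule W_by_cocycles) (use assms hom_cocycle.intro osp_setup_axioms in blast)

lemma W_subset_N: "W \<subseteq> N"
proof
  fix z assume z: "z \<in> W"
  have "nf 0 (\<lambda>_. 0) 0 \<in> W"
  proof (rule W_by_homs)
    fix f
    assume "circle_cocycle f"
    then interpret hom_cocycle sc G bar i1 k1 f .
    show "f (nf 0 (\<lambda>_. 0) 0) = 0"
      using Fw_add[of 0 0] by (simp add: f_nf_0)
  qed
  then have "z - nf 0 (\<lambda>_. 0) 0 \<in> W" using z free.subspace_diff[OF subspace_W] by blast
  then show "z \<in> N"
    unfolding N_def by (intro CollectI exI conjI allI) (rule L_0, simp, assumption)
qed

lemma N_diff: "y \<in> N \<Longrightarrow> z \<in> N \<Longrightarrow> y - z \<in> N"
proof -
  assume "y \<in> N" "z \<in> N"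
  then obtain X a t Y b s where X: "X \<in> L" "\<forall>p. X $ p $ p = 0" "y - nf X a t \<in> W"
    and Y: "Y \<in> L" "\<forall>p. Y $ p $ p = 0" "z - nf Y b s \<in> W"
    unfolding N_def by blast
  have "nf X a t - nf Y b s - nf (X - Y) (\<lambda>p. a p - b p) (t - s) \<in> W"
  proof (rule W_by_homs)
    fix f
    assume "circle_cocycle f"
    then interpret hom_cocycle sc G bar i1 k1 f .
    have "M p un (a p - b p) = M p un (a p) - M p un (b p)" if "p \<in> P" for p
      using that by (intro additive.diff[OF M_right_additive]) (simp add: P_def)
    moreover have "Fw (X - Y) = Fw X - Fw Y"
      by (rule additive.diff) (standard, rule Fw_add)
    ultimately show "f (nf X a t - nf Y b s - nf (X - Y) (\<lambda>p. a p - b p) (t - s)) = 0"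
      by (simp add: f.diff f_nf additive.diff[OF Lam_additive] sum_subtractf)
  qed
  from free.subspace_add[OF subspace_W this free.subspace_diff[OF subspace_W X(3) Y(3)]]
  have "y - z - nf (X - Y) (\<lambda>p. a p - b p) (t - s) \<in> W" by (simp add: algebra_simps)
  then show ?thesis using X Y unfolding N_def by (auto intro!: exI[of _ "X - Y"] L_diff)
qed

lemma N_0: "0 \<in> N"
  using W_subset_N free.subspace_0[OF subspace_W] by blast

lemma N_minus: "z \<in> N \<Longrightarrow> - z \<in> N"
  using N_diff[OF N_0, of z] by simp

lemma N_add: "y \<in> N \<Longrightarrow> z \<in> N \<Longrightarrow> y + z \<in> N"
  using N_diff[of y "- z"] N_minus by simp

lemma N_sgn_deg: "z \<in> N \<Longrightarrow> sgn_deg d z \<in> N"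
  by (simp add: sgn_deg_def N_minus)

lemma N_cong:
  assumes "y \<in> N"
    and "\<And>f. circle_cocycle f \<Longrightarrow> f z = f y"
  shows "z \<in> N"
proof -
  have "z - y \<in> W"
  proof (rule W_by_homs)
    fix f
    assume f: "circle_cocycle f"
    then interpret f: additive f by (simp add: hom_cocycle_def)
    show "f (z - y) = 0" using assms(2)[OF f] by (simp add: f.diff)
  qed
  then have "(z - y) + y \<in> N" by (rule N_add[OF subsetD[OF W_subset_N] assms(1)])
  then show ?thesis by simp
qed

lemma N_I:
  assumes "X \<in> L" "\<And>p. X $ p $ p = 0" "\<And>f. circle_cocycle f \<Longrightarrow> f z = f (nf X a t)"
  shows "z \<in> N"
proof (rule N_cong)
  show "nf X a t \<in> N"
    unfolding N_def using assms(1,2) free.subspace_0[OF subspace_W]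
    by (intro CollectI exI[of _ X] exI[of _ a] exI[of _ t]) simp
qed (rule assms(3))

lemma N_zero:
  assumes "\<And>f. circle_cocycle f \<Longrightarrow> f z = 0"
  shows "z \<in> N"
proof (rule N_cong[OF N_0])
  fix f
  assume f: "circle_cocycle f"
  then have "f 0 = 0" by (simp add: hom_cocycle_def additive.zero)
  then show "f z = f 0" using assms[OF f] by simp
qed

section \<open>Reduction of off-diagonal tensors to normal form\<close>

definition good :: "('m, 'n) idx \<Rightarrow> ('m, 'n) idx \<Rightarrow> ('m, 'n) idx \<Rightarrow> ('m, 'n) idx \<Rightarrow> bool"
  where "good p q r s \<longleftrightarrow> (\<forall>a b. gen (tt p q a) (tt r s b) \<in> N)"

lemma goodI:
  assumes pq: "p \<noteq> q" and rs: "r \<noteq> s"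
    and hom: "\<And>a b d e. a \<in> G d \<Longrightarrow> b \<in> G e \<Longrightarrow> gen (tt p q a) (tt r s b) \<in> N"
  shows "good p q r s"
proof -
  have "gen (tt p q a) (tt r s b) \<in> N" for a b
  proof (induction a b rule: G.homogeneous_cases2)
    case (add_left x x' y)
    show ?case
    proof (rule N_cong[OF N_add[OF add_left]])
      fix f
      assume "circle_cocycle f"
      then interpret hom_cocycle sc G bar i1 k1 f .
      show "f (gen (tt p q (x + x')) (tt r s y)) = f (gen (tt p q x) (tt r s y) + gen (tt p q x') (tt r s y))"
        using pq rs by (simp add: f.add w_tt_add_left tt_L)
    qed
  next
    case (add_right x y y')
    show ?case
    proof (rule N_cong[OF N_add[OF add_right]])
      fix f
      assume "circle_cocycle f"
      then interpret hom_cocycle sc G bar i1 k1 f .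
      show "f (gen (tt p q x) (tt r s (y + y'))) = f (gen (tt p q x) (tt r s y) + gen (tt p q x) (tt r s y'))"
        using pq rs by (simp add: f.add w_tt_add_right tt_L)
    qed
  qed (rule hom)
  then show ?thesis by (simp add: good_def)
qed

lemma good_swap:
  assumes "p \<noteq> q" "r \<noteq> s" "good r s p q"
  shows "good p q r s"
proof (rule goodI[OF assms(1,2)])
  fix a b d e
  assume a: "a \<in> G d" and b: "b \<in> G e"
  have "gen (tt r s b) (tt p q a) \<in> N" using assms(3) by (simp add: good_def)
  then show "gen (tt p q a) (tt r s b) \<in> N"
  proof (rule N_cong[OF N_minus[OF N_sgn_deg]])
    fix f
    assume "circle_cocycle f"
    then interpret hom_cocycle sc G bar i1 k1 f .
    show "f (gen (tt p q a) (tt r s b))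
      = f (- sgn_deg ((d + idx_deg p + idx_deg q) * (e + idx_deg r + idx_deg s)) (gen (tt r s b) (tt p q a)))"
      using w_swap[OF tt_L tt_GG[OF a] tt_L tt_GG[OF b], of p q r s] assms(1,2)
      by (simp add: f.minus f.sgn_deg)
  qed
qed

lemma good_star1:
  assumes "p \<noteq> q" "r \<noteq> s" "good (ip q) (ip p) r s"
  shows "good p q r s"
proof (rule goodI[OF assms(1,2)])
  fix a b d e
  assume "a \<in> G d"
  then show "gen (tt p q a) (tt r s b) \<in> N"
    using tt_dual[of a d p q] assms(3) by (simp add: good_def)
qed

lemma good_star2:
  assumes "p \<noteq> q" "r \<noteq> s" "good p q (ip s) (ip r)"
  shows "good p q r s"
proof (rule goodI[OF assms(1,2)])
  fix a b d e
  assume "b \<in> G e"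
  then show "gen (tt p q a) (tt r s b) \<in> N"
    using tt_dual[of b e r s] assms(3) by (simp add: good_def)
qed

lemma good_unit:
  assumes "p \<noteq> q" "r \<noteq> s" and n: "wt k p - wt k q + (wt k r - wt k s) \<in> {1, -1, 2, -2, 4, -4}"
  shows "good p q r s"
proof -
  note u = unit_weightI[OF n]
  have "gen (tt p q a) (tt r s b) \<in> N" for a b
  proof (rule N_I)
    let ?X = "br (tt p q a) (tt r s b)"
    show "?X \<in> L" by (rule br_K_L[OF tt_K tt_K])
    show "?X $ l $ l = 0" for l
      using br_tt_wsp[of p q a r s b k] u unfolding wsp_def unit_weight_def by fastforce
    fix f
    assume "circle_cocycle f"
    then interpret hom_cocycle sc G bar i1 k1 f .
    show "f (gen (tt p q a) (tt r s b)) = f (nf ?X (\<lambda>_. 0) 0)"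
      using normal_unit_weight[OF assms(1,2) u] by (simp add: f_nf_0)
  qed
  then show ?thesis by (simp add: good_def)
qed

lemma good_path_orth:
  assumes "i \<noteq> j" "cl r \<noteq> Inl i" "cl r \<noteq> Inl j"
  shows "good (Inl i) r r (Inl j)"
proof -
  have "gen (tt (Inl i) r a) (tt r (Inl j) b) \<in> N" for a b
  proof (rule N_I)
    let ?X = "tt (Inl i) (Inl j) (a * b)"
    show "?X \<in> L" using assms by (simp add: tt_L)
    show "?X $ l $ l = 0" for l
      using assms by (intro tt_nth_0) auto
    fix f
    assume "circle_cocycle f"
    then interpret hom_cocycle sc G bar i1 k1 f .
    show "f (gen (tt (Inl i) r a) (tt r (Inl j) b)) = f (nf ?X (\<lambda>_. 0) 0)"
      using normal_path_orth[OF assms] by (simp add: f_nf_0)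
  qed
  then show ?thesis by (simp add: good_def)
qed

lemma good_short_long: "idx_deg k = 1 \<Longrightarrow> good k (ip k) k (Inl i)"
  unfolding good_def
proof (intro allI N_zero)
  fix a b f
  assume k: "idx_deg k = 1" and "circle_cocycle f"
  then interpret hom_cocycle sc G bar i1 k1 f by simp
  show "f (gen (tt k (ip k) a) (tt k (Inl i) b)) = 0"
    by (rule zero_short_long[OF k])
qed

lemma good_orth_disjoint:
  assumes "i \<noteq> j" "k \<noteq> l" "{i, j} \<inter> {k, l} = {}"
  shows "good (Inl i) (Inl j) (Inl k) (Inl l)"
  unfolding good_def
proof (intro allI N_zero)
  fix a b f
  assume "circle_cocycle f"
  then interpret hom_cocycle sc G bar i1 k1 f .
  show "f (gen (tt (Inl i) (Inl j) a) (tt (Inl k) (Inl l) b)) = 0"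
    by (rule zero_orth[OF assms])
qed

text \<open>By the definition of \<open>lam\<close>, the pair (a, b) at q is the pair of
  \<open>un\<close> and b a, up to sign, plus a \<open>lam\<close> term, and \<open>lam\<close> may
  be evaluated at \<open>q0\<close> instead of q.\<close>

lemma gM_P:
  assumes q: "q \<in> P" and a: "a \<in> G d" and b: "b \<in> G e"
  shows "gM q a b \<in> N"
proof (rule N_I)
  let ?c = "\<lambda>p. if p = q then sgn_deg (d * e) (b * a) else 0"
  fix f
  assume "circle_cocycle f"
  then interpret hom_cocycle sc G bar i1 k1 f .
  have q1: "q \<noteq> o1" using q by (simp add: P_def)
  have "M p un (?c p) = (if p = q then M q un (sgn_deg (d * e) (b * a)) else 0)" if "p \<in> P" for p
    using M_add_right[of p un 0 0] that by (simp add: P_def)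
  then have "(\<Sum>p\<in>P. M p un (?c p)) = (\<Sum>p\<in>P. if p = q then M q un (sgn_deg (d * e) (b * a)) else 0)"
    by (intro sum.cong refl)
  also have "\<dots> = M q un (sgn_deg (d * e) (b * a))"
    using q by simp
  finally have "(\<Sum>p\<in>P. M p un (?c p)) = sgn_deg (d * e) (M q un (b * a))"
    by (simp add: M_sgn_right[OF q1])
  moreover have "Fw 0 = 0" using Fw_add[of 0 0] by simp
  moreover have "f (Lam (gen a b)) = lam q d e a b"
    unfolding f_Lam_gen_homogeneous[OF a b] by (rule lam_indep[OF _ q1 a b]) simp
  ultimately show "f (gM q a b) = f (nf 0 ?c (gen a b))"
    by (simp add: f_nf f_gM lam_def)
qed simp_all

text \<open>An index outside \<open>P\<close> is the mirror image of a symplectic index in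
  \<open>P\<close>; \<open>M_dual\<close> passes from one to the other.\<close>

lemma gM_N:
  assumes q: "q \<noteq> o1" and a: "a \<in> G d" and b: "b \<in> G e"
  shows "gM q a b \<in> N"
proof (cases q rule: idx_cases)
  case (sympl' k)
  have "gM (Inr (Inl k)) (bar b) (bar a) \<in> N"
    by (rule gM_P[OF _ bar_degree[OF b] bar_degree[OF a]]) (simp add: P_def)
  then show ?thesis
  proof (rule N_cong[OF N_minus[OF N_sgn_deg]])
    fix f
    assume "circle_cocycle f"
    then interpret hom_cocycle sc G bar i1 k1 f .
    show "f (gM q a b) = f (- sgn_deg (e * d) (gM (Inr (Inl k)) (bar b) (bar a)))"
      using M_dual[OF bar_degree[OF b] bar_degree[OF a], of k]
      by (simp add: sympl' f_gM f.minus f.sgn_deg bar_bar sgn_deg_minus)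
  qed
qed (use assms in \<open>auto intro: gM_P simp: P_def\<close>)

lemma good_opposite:
  assumes pq: "p \<noteq> q"
  shows "good p q q p"
proof (rule goodI)
  fix a b d e
  assume a: "a \<in> G d" and b: "b \<in> G e"
  have left: "gen (tt p o1 a) (tt o1 p b) \<in> N" if "p \<noteq> o1" "a \<in> G d" "b \<in> G e" for p a b d e
  proof (rule N_cong[OF N_minus[OF N_sgn_deg[OF gM_N[OF that(1,3,2)]]]])
    fix f
    assume "circle_cocycle f"
    then interpret hom_cocycle sc G bar i1 k1 f .
    show "f (gen (tt p o1 a) (tt o1 p b))
      = f (- sgn_deg ((e + idx_deg p) * (d + idx_deg p)) (gM p b a))"
      using M_swap[OF that(1,3,2)] by (simp add: f.minus f.sgn_deg f_gM)
  qed
  show "gen (tt p q a) (tt q p b) \<in> N"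
  proof (cases "p = o1 \<or> q = o1")
    case True
    then show ?thesis using left[OF _ a b, of p] gM_N[OF _ a b, of q] pq by (auto simp: gM_def)
  next
    case False
    define b' where "b' = tt q p b $ q $ p"
    have b': "b' \<in> G e" unfolding b'_def using b by (rule tt_nth_G)
    have "gen (tt p o1 un) (tt o1 p (a * b')) \<in> N"
      using False by (intro left[OF _ un_G grading_mult[OF a b']]) simp
    moreover have "gM q a b' \<in> N"
      using False by (intro gM_N[OF _ a b']) simp
    ultimately show ?thesis
    proof (rule N_cong[OF N_add[OF _ N_sgn_deg]])
      fix f
      assume "circle_cocycle f"
      then interpret hom_cocycle sc G bar i1 k1 f .
      show "f (gen (tt p q a) (tt q p b)) = f (gen (tt p o1 un) (tt o1 p (a * b'))
        + sgn_deg (idx_deg p * (d + e + idx_deg p)) (gM q a b'))"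
        using opposite_via_o1[OF _ _ pq a b] False by (simp add: b'_def f.add f.sgn_deg f_gM)
    qed
  qed
qed (use pq in auto)

text \<open>The remaining cases are distinguished by weights: a total weight other than \<open>0\<close>,
  \<open>3\<close> and \<open>-3\<close> is a unit of the base ring.\<close>

lemma orth_index: "idx_deg p = 0 \<Longrightarrow> \<exists>i. p = Inl i"
  by (cases p rule: idx_cases) simp_all

lemma ip_orth: "idx_deg p = 0 \<Longrightarrow> ip p = p"
  by (cases p rule: idx_cases) simp_all

text \<open>The weight that sees only the class of p, with the sign e depending on the block that
  contains p.\<close>

lemma sympl_weight:
  assumes "idx_deg p = 1"
  obtains k e where "e = 1 \<or> e = -1" "p \<noteq> ip p"
    "\<And>t. wt k t = (if t = p then e else if t = ip p then - e else 0)"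
proof (cases p rule: idx_cases)
  case (sympl k)
  have "wt k t = (if t = p then 1 else if t = ip p then -1 else 0)" for t
    by (cases t rule: idx_cases) (auto simp: sympl)
  then show ?thesis using that[of 1 k] sympl by simp
next
  case (sympl' k)
  have "wt k t = (if t = p then -1 else if t = ip p then - (-1) else 0)" for t
    by (cases t rule: idx_cases) (auto simp: sympl')
  then show ?thesis using that[of "-1" k] sympl' by simp
qed (use assms in simp)

lemma weight_diff:
  fixes r s :: "('m, 'n) idx"
  assumes "r \<noteq> s" "idx_deg r = 1 \<or> idx_deg s = 1"
  obtains k where "wt k r - wt k s \<in> {1, -1, 2, -2}"
proof -
  have *: "\<exists>k. wt k r - wt k s \<in> {1, -1, 2, -2}"
    if rs: "r \<noteq> s" and r: "idx_deg r = 1" for r s :: "('m, 'n) idx"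
  proof -
    obtain k e where e: "e = 1 \<or> e = -1"
      and wt: "\<And>t. wt k t = (if t = r then e else if t = ip r then - e else 0)"
      by (rule sympl_weight[OF r]) (rule that)
    have "wt k r - wt k s \<in> {1, -1, 2, -2}"
      unfolding wt[of r] wt[of s] using rs e by auto
    then show ?thesis by blast
  qed
  from assms(2) consider k where "wt k r - wt k s \<in> {1, -1, 2, -2}" | k where "wt k s - wt k r \<in> {1, -1, 2, -2}"
    using *[OF assms(1)] *[OF assms(1)[symmetric]] by blast
  then show ?thesis
  proof cases
    case (2 k)
    then have "wt k r - wt k s \<in> {1, -1, 2, -2}" by auto
    then show ?thesis by (rule that)
  qed (rule that)
qed

text \<open>The weights of p cancel, leaving \<open>wt k r - wt k q\<close>. Some k makes this
  invertible unless q = r, an opposite pair, or q and r are different orthogonal indices, which is a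
  path of weight 0.\<close>

lemma good_same_end:
  assumes p: "idx_deg p = 1" and q: "q \<noteq> p" and r: "r \<noteq> p"
  shows "good p q r p"
proof -
  have pq: "p \<noteq> q" using q by simp
  consider "q = r" | "q \<noteq> r" "idx_deg q = 0" "idx_deg r = 0"
    | "q \<noteq> r" "idx_deg r = 1 \<or> idx_deg q = 1"
    by (cases "idx_deg q = 0"; cases "idx_deg r = 0") auto
  then show ?thesis
  proof cases
    case 1
    then show ?thesis using good_opposite[OF pq] by simp
  next
    case 2
    obtain i where i: "q = Inl i" using orth_index[OF 2(2)] by blast
    obtain j where j: "r = Inl j" using orth_index[OF 2(3)] by blast
    have ij: "q = Inl i" "r = Inl j" "j \<noteq> i" using 2 i j by auto
    have "cl p \<noteq> Inl j" "cl p \<noteq> Inl i" using p by (cases p rule: idx_cases; simp)+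
    then have "good r p p q" unfolding ij(1,2) by (intro good_path_orth ij(3))
    then show ?thesis using pq r by (rule good_swap[rotated 2])
  next
    case 3
    obtain k where "wt k r - wt k q \<in> {1, -1, 2, -2}"
      by (rule weight_diff[OF 3(1)[symmetric] 3(2)])
    then show ?thesis using pq r by (intro good_unit[of _ _ _ _ k]) auto
  qed
qed

text \<open>Weight 0 at the class of p requires s = p or r = \<open>ip p\<close>; both reduce to a
  common end, the second after mirroring. Otherwise 3 is the only critical absolute value of this
  weight.\<close>

lemma good_sympl:
  assumes p: "idx_deg p = 1" and s: "idx_deg s = 1" and pq: "p \<noteq> q" and rs: "r \<noteq> s"
  shows "good p q r s"
proof -
  \<comment> \<open>If exactly one of q, r, s lies outside the class of p and is symplectic, the
    weight at its class is 1 or -1 in total, since p and the other two indices have weight 0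
    there.\<close>
  have far: "good p q r s"
    if t: "idx_deg t = 1" "t \<noteq> p" "t \<noteq> ip p"
      and c: "{q, r, s} - {p, ip p} = {t}"
      and one: "(if q = t then 1 else 0) + (if r = t then 1 else 0) + (if s = t then 1 else (0::nat)) = 1"
    for t
  proof -
    obtain k e where e: "e = 1 \<or> e = -1" "t \<noteq> ip t"
      and wt: "\<And>u. wt k u = (if u = t then e else if u = ip t then - e else 0)"
      by (rule sympl_weight[OF t(1)]) (rule that)
    have pt: "p \<noteq> ip t" "ip p \<noteq> ip t" "p \<noteq> t" "ip p \<noteq> t" using t by auto
    have zero: "wt k u = 0" if "u \<in> {p, ip p}" for u
      unfolding wt[of u] using that pt by auto
    have "wt k t = e" unfolding wt[of t] by simp
    have "q \<in> {p, ip p, t}" "r \<in> {p, ip p, t}" "s \<in> {p, ip p, t}" using c by blast+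
    then have "wt k p - wt k q + (wt k r - wt k s) \<in> {1, -1}"
      using one e(1) zero[of p] zero[of q] zero[of r] zero[of s] \<open>wt k t = e\<close> t by (auto split: if_splits)
    then show ?thesis by (intro good_unit[OF pq rs, of k]) blast
  qed
  consider "s = p" | "r = ip p" | "s \<noteq> p" "r \<noteq> ip p" by blast
  then show ?thesis
  proof cases
    case 1
    then show ?thesis using good_same_end[OF p pq[symmetric]] rs by simp
  next
    case 2
    then have "ip s \<noteq> p" using rs by auto
    then have "good p q (ip s) p" by (rule good_same_end[OF p pq[symmetric]])
    then show ?thesis using good_star2[OF pq rs] 2 by simp
  next
    case 3
    obtain k e where e: "e = 1 \<or> e = -1" "p \<noteq> ip p"
      and wt: "\<And>u. wt k u = (if u = p then e else if u = ip p then - e else 0)"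
      by (rule sympl_weight[OF p]) (rule that)
    have three: "good p (ip p) p u" if "u \<noteq> p" "u \<noteq> ip p"
      "idx_deg u = 0 \<or> good p (ip p) p u" for u
      using that good_short_long[OF p] orth_index[of u] by blast
    show ?thesis
    proof (cases "wt k p - wt k q + (wt k r - wt k s) \<in> {1, -1, 2, -2, 4, -4}")
      case True
      then show ?thesis by (rule good_unit[OF pq rs])
    next
      case False
      \<comment> \<open>Each of -q, r, -s now contributes 0 or e, so the total weight is e, 2 e, 3 e
        or 4 e. The non-unit 3 e means that exactly two of the three contribute.\<close>
      then consider "q = ip p" "r \<noteq> p" "s = ip p" | "q \<noteq> ip p" "r = p" "s = ip p" | "q = ip p" "r = p" "s \<noteq> ip p"
        unfolding wt[of p] wt[of q] wt[of r] wt[of s] using e pq rs 3 by (auto split: if_splits)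
      then show ?thesis
      proof cases
        case 1
        show ?thesis
        proof (cases "idx_deg r = 0")
          case True
          then have "good p q (ip s) (ip r)" using three[of r] 1 3 ip_orth[OF True] by auto
          then show ?thesis by (rule good_star2[OF pq rs])
        qed (use far[of r] 1 3 e in auto)
      next
        case 2
        show ?thesis
        proof (cases "idx_deg q = 0")
          case True
          then have "good r s p q" using three[of q] 2 pq by auto
          then show ?thesis by (rule good_swap[OF pq rs])
        qed (use far[of q] 2 3 e pq in auto)
      next
        case 3
        then show ?thesis using far[of s] s \<open>s \<noteq> p\<close> e by auto
      qed
    qed
  qed
qed

lemma good_orth:
  assumes ij: "i \<noteq> j" and kl: "k \<noteq> l"
  shows "good (Inl i) (Inl j) (Inl k) (Inl l)"
proof -
  have path: "good (Inl i) (Inl j) (Inl j) (Inl l)" if "i \<noteq> j" "j \<noteq> l" for i j l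
  proof (cases "i = l")
    case True
    then show ?thesis using that by (auto intro: good_opposite)
  next
    case False
    then show ?thesis using that by (intro good_path_orth) auto
  qed
  consider "{i, j} \<inter> {k, l} = {}" | "j = k" | "j = l" | "i = k" | "i = l" by blast
  then show ?thesis
  proof cases
    case 1
    then show ?thesis by (rule good_orth_disjoint[OF ij kl])
  next
    case 2
    then show ?thesis using path ij kl by simp
  next
    case 3
    show ?thesis by (rule good_star2) (use 3 path[of i j k] ij kl in auto)
  next
    case 4
    show ?thesis by (rule good_star1) (use 4 path[of j i l] ij kl in auto)
  next
    case 5
    then have "good (Inl j) (Inl i) (Inl l) (Inl k)" using path[of j i k] ij kl by auto
    then have *: "good (Inl i) (Inl j) (Inl l) (Inl k)"
      using good_star1[of "Inl i" "Inl j" "Inl l" "Inl k"] ij kl by simp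
    show ?thesis by (rule good_star2) (use * ij kl in simp_all)
  qed
qed

lemma good_all:
  assumes pq: "p \<noteq> q" and rs: "r \<noteq> s"
  shows "good p q r s"
proof -
  consider "idx_deg p = 0" "idx_deg q = 0" "idx_deg r = 0" "idx_deg s = 0"
    | "idx_deg p = 0" "idx_deg q = 0" "idx_deg r = 1 \<or> idx_deg s = 1"
    | "idx_deg p = 1 \<or> idx_deg q = 1" "idx_deg r = 0" "idx_deg s = 0"
    | "idx_deg p = 1 \<or> idx_deg q = 1" "idx_deg r = 1 \<or> idx_deg s = 1"
    by (cases "idx_deg p = 0"; cases "idx_deg q = 0"; cases "idx_deg r = 0"; cases "idx_deg s = 0") auto
  then show ?thesis
  proof cases
    case 1
    then show ?thesis
      using orth_index[of p] orth_index[of q] orth_index[of r] orth_index[of s] good_orth pq rs by blast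
  next
    case 2
    obtain k where k: "wt k r - wt k s \<in> {1, -1, 2, -2}" by (rule weight_diff[OF rs 2(3)])
    have "wt k p = 0" "wt k q = 0" using orth_index[OF 2(1)] orth_index[OF 2(2)] by auto
    then show ?thesis using k by (intro good_unit[OF pq rs, of k]) auto
  next
    case 3
    obtain k where k: "wt k p - wt k q \<in> {1, -1, 2, -2}" by (rule weight_diff[OF pq 3(1)])
    have "wt k r = 0" "wt k s = 0" using orth_index[OF 3(2)] orth_index[OF 3(3)] by auto
    then show ?thesis using k by (intro good_unit[OF pq rs, of k]) auto
  next
    case 4
    \<comment> \<open>Mirroring a unit exchanges its two ends, so a symplectic index can be brought
      to the place of p in the first unit and of s in the second, as \<open>good_sympl\<close>
      expects.\<close>
    have second: "good p q r s" if p: "idx_deg p = 1" "p \<noteq> q" for p q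
    proof (cases "idx_deg s = 1")
      case False
      then have "idx_deg (ip r) = 1" using 4 by simp
      then have "good p q (ip s) (ip r)" using rs by (intro good_sympl[OF p(1) _ p(2)]) auto
      then show ?thesis by (rule good_star2[OF p(2) rs])
    qed (use good_sympl[OF p(1) _ p(2) rs] in blast)
    show ?thesis
    proof (cases "idx_deg p = 1")
      case False
      then have "idx_deg (ip q) = 1" using 4 by simp
      then have "good (ip q) (ip p) r s" using pq by (intro second) auto
      then show ?thesis by (rule good_star1[OF pq rs])
    qed (use second pq in blast)
  qed
qed

text \<open>A homomorphism that vanishes on the subgroup \<open>N\<close> is a cocycle that kills
  all off-diagonal tensors, hence zero by \<open>w_vanishes\<close>; so nothing can be separated
  from \<open>N\<close>.\<close>

lemma gen_N:
  assumes "X \<in> L" "Y \<in> L"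
  shows "gen X Y \<in> N"
proof (rule ccontr)
  assume notin: "gen X Y \<notin> N"
  obtain f :: "('k, 'r, 'm, 'n) tsq \<Rightarrow> circle"
    where f: "additive f" "\<And>u. u \<in> N \<Longrightarrow> f u = 0" "f (gen X Y) \<noteq> 0"
    by (rule separating_hom_ex[OF module_free_scale N_0 _ notin], erule (1) N_diff, rule that)
  interpret cocycle sc G bar i1 k1 "\<lambda>X Y. f (gen X Y)"
    by (rule cocycle_of_hom[OF f(1) f(2)[OF subsetD[OF W_subset_N]]])
  have "f (gen (tt p q a) (tt r s b)) = 0" if "p \<noteq> q" "r \<noteq> s" for p q r s a b
    using good_all[OF that] by (intro f(2)) (simp add: good_def)
  then have "f (gen X Y) = 0" by (rule w_vanishes[OF _ assms])
  then show False using f(3) by simp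
qed

lemma free_module_N:
  assumes "z \<in> free_module (L \<times> L)"
  shows "z \<in> N"
proof (rule free_module_mod_tensor_rels_induct[where P = "\<lambda>z. z \<in> N",
      OF assms msc.module_axioms subspace_L subspace_W tensor_rels_W])
  fix p q
  assume "p \<in> N" "q - p \<in> W"
  then have "p + (q - p) \<in> N" by (rule N_add[OF _ subsetD[OF W_subset_N]])
  then show "q \<in> N" by simp
next
  fix X Y
  assume "X \<in> L" "Y \<in> L"
  then show "gen X Y \<in> N" by (rule gen_N)
next
  fix p q
  assume "p \<in> N" "q \<in> N"
  then show "p + q \<in> N" by (rule N_add)
qed

end

section \<open>Comparison with the skew-dihedral homology\<close>

lemma (in module) coset_eq_iff:
  assumes "subspace U"
  shows "x +o U = y +o U \<longleftrightarrow> x - y \<in> U"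
proof
  assume "x +o U = y +o U"
  then have "x + 0 \<in> y +o U" using subspace_0[OF assms] by blast
  then show "x - y \<in> U" by (simp add: set_minus_plus)
next
  assume xy: "x - y \<in> U"
  then have yx: "y - x \<in> U" using subspace_neg[OF assms, of "x - y"] by simp
  have "a +o U \<subseteq> b +o U" if "a - b \<in> U" for a b
  proof
    fix z
    assume "z \<in> a +o U"
    then have "z - a \<in> U" by (simp add: set_minus_plus)
    then have "(z - a) + (a - b) \<in> U" using that by (rule subspace_add[OF assms])
    then show "z \<in> b +o U" by (simp add: set_minus_plus[symmetric])
  qed
  then show "x +o U = y +o U" using xy yx by blast
qed

lemma (in module) subspace_plus: "subspace U \<Longrightarrow> U + U = U"
proof
  assume U: "subspace U"
  show "U + U \<subseteq> U" using subspace_add[OF U] by (auto elim!: set_plus_elim)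
  show "U \<subseteq> U + U" using subspace_0[OF U] by (rule set_zero_plus2)
qed

lemma (in module) coset_add: "subspace U \<Longrightarrow> (x +o U) + (y +o U) = (x + y) +o U"
  by (simp add: set_plus_rearrange subspace_plus)

text \<open>The image of a coset of U may be a proper subset of a coset of \<open>U'\<close>; adding
  \<open>U'\<close> completes it.\<close>

lemma coset_image:
  fixes h :: "'a::ab_group_add \<Rightarrow> 'b::ab_group_add"
  assumes s': "module s'" and U': "module.subspace s' U'" and h: "additive h"
    and "\<And>u. u \<in> U \<Longrightarrow> h u \<in> U'" "u0 \<in> U"
  shows "h ` (x +o U) + U' = h x +o U'"
proof -
  interpret s': module s' by (rule s')
  interpret h: additive h by (rule h)
  show ?thesis
  proof (intro subset_antisym subsetI)
    fix z
    assume "z \<in> h ` (x +o U) + U'"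
    then obtain u v where "u \<in> U" "v \<in> U'" "z = h (x + u) + v"
      by (auto elim!: set_plus_elim simp: elt_set_plus_def)
    then have "z = h x + (h u + v)" "h u + v \<in> U'"
      using assms(4) by (auto simp: h.add algebra_simps intro!: s'.subspace_add[OF U'])
    then show "z \<in> h x +o U'" by auto
  next
    fix z
    assume "z \<in> h x +o U'"
    then obtain v where v: "v \<in> U'" "z = h x + v" by (auto simp: elt_set_plus_def)
    then have "v - h u0 \<in> U'" using assms(4,5) by (auto intro!: s'.subspace_diff[OF U'])
    moreover have "z = h (x + u0) + (v - h u0)" using v by (simp add: h.add)
    ultimately show "z \<in> h ` (x +o U) + U'" using assms(5) by blast
  qed
qed

lemma coset_scale_coset:
  assumes "module s" "module.subspace s U"
  shows "coset_scale s U c (x +o U) = s c x +o U"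
proof -
  interpret module s by (rule assms(1))
  have "additive (s c)" by standard (rule scale_right_distrib)
  then show ?thesis
    unfolding coset_scale_def
    using subspace_scale[OF assms(2)] subspace_0[OF assms(2)] by (rule coset_image[OF assms])
qed

text \<open>The isomorphism is induced by \<Phi>. All of A comes from \<Lambda>, and \<Phi> after
  \<Lambda> is multiplication by 2 modulo \<open>U'\<close>. Halving therefore gives injectivity,
  and it gives \<Lambda> of t/2 as a preimage of the class of t.\<close>

lemma coset_modules_isomorphicI:
  fixes s :: "'k::comm_ring_1 \<Rightarrow> 'a::ab_group_add \<Rightarrow> 'a" and s' :: "'k \<Rightarrow> 'b::ab_group_add \<Rightarrow> 'b"
  assumes \<Lambda>: "module_hom s' s \<Lambda>" and \<Phi>: "module_hom s s' \<Phi>"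
    and U: "module.subspace s U" and U': "module.subspace s' U'" and S: "module.subspace s' S"
    and \<Lambda>U: "\<And>t. t \<in> U' \<Longrightarrow> \<Lambda> t \<in> U" and \<Phi>U: "\<And>z. z \<in> U \<Longrightarrow> \<Phi> z \<in> U'"
    and \<Phi>\<Lambda>: "\<And>t. \<Phi> (\<Lambda> t) - (t + t) \<in> U'" and half: "h + h = (1 :: 'k)"
    and A: "A = {\<Lambda> t +o U | t. t \<in> S}" and A': "A' = {t +o U' | t. t \<in> S}"
  shows "coset_modules_isomorphic s U A s' U' A'"
proof -
  have mod: "module s" "module s'" using \<Phi> by (simp_all add: module_hom_iff)
  interpret s: module s by (rule mod(1))
  interpret s': module s' by (rule mod(2))
  interpret \<Lambda>: module_hom s' s \<Lambda> by (rule \<Lambda>)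
  interpret \<Phi>: module_hom s s' \<Phi> by (rule \<Phi>)
  let ?f = "\<lambda>X. \<Phi> ` X + U'"
  have add: "additive \<Phi>" by standard (rule \<Phi>.add)
  have f: "?f (\<Lambda> t +o U) = (t + t) +o U'" for t
  proof -
    have "?f (\<Lambda> t +o U) = \<Phi> (\<Lambda> t) +o U'"
      by (rule coset_image[OF mod(2) U' add \<Phi>U s.subspace_0[OF U]])
    also have "\<dots> = (t + t) +o U'"
      using \<Phi>\<Lambda> by (simp add: s'.coset_eq_iff[OF U'])
    finally show ?thesis .
  qed
  have hf: "s' h t + s' h t = t" for t
    using s'.scale_left_distrib[of h h t] half by simp
  show ?thesis
    unfolding coset_modules_isomorphic_def
  proof (intro exI conjI ballI allI)
    show "bij_betw ?f A A'"
      unfolding bij_betw_def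
    proof
      show "inj_on ?f A"
      proof (rule inj_onI)
        fix X Y
        assume "X \<in> A" "Y \<in> A" and eq: "?f X = ?f Y"
        then obtain t u where X: "X = \<Lambda> t +o U" and Y: "Y = \<Lambda> u +o U" unfolding A by blast
        have "(t + t) - (u + u) \<in> U'"
          using eq unfolding X Y f s'.coset_eq_iff[OF U'] .
        then have "s' h ((t + t) - (u + u)) \<in> U'" by (rule s'.subspace_scale[OF U'])
        also have "s' h ((t + t) - (u + u)) = t - u"
          using hf[of t] hf[of u]
          by (simp only: s'.scale_right_diff_distrib s'.scale_right_distrib)
        finally have "\<Lambda> (t - u) \<in> U" by (rule \<Lambda>U)
        then show "X = Y"
          unfolding X Y by (simp add: s.coset_eq_iff[OF U] \<Lambda>.diff)
      qed
      show "?f ` A = A'"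
      proof
        show "?f ` A \<subseteq> A'"
          unfolding A A' using f s'.subspace_add[OF S] by auto
        show "A' \<subseteq> ?f ` A"
        proof
          fix Y
          assume "Y \<in> A'"
          then obtain t where t: "t \<in> S" "Y = t +o U'" unfolding A' by blast
          have "Y = ?f (\<Lambda> (s' h t) +o U)" unfolding f t(2) by (simp add: hf)
          moreover have "\<Lambda> (s' h t) +o U \<in> A"
            unfolding A using s'.subspace_scale[OF S t(1)] by blast
          ultimately show "Y \<in> ?f ` A" by blast
        qed
      qed
    qed
  next
    fix X Y
    assume "X \<in> A" "Y \<in> A"
    then obtain t u where X: "X = \<Lambda> t +o U" and Y: "Y = \<Lambda> u +o U" unfolding A by blast
    have "X + Y = \<Lambda> (t + u) +o U"
      unfolding X Y by (simp add: s.coset_add[OF U] \<Lambda>.add)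
    then show "?f (X + Y) = ?f X + ?f Y"
      unfolding X Y f by (simp only: f s'.coset_add[OF U']) (simp add: algebra_simps)
  next
    fix c X
    assume "X \<in> A"
    then obtain t where X: "X = \<Lambda> t +o U" unfolding A by blast
    have "coset_scale s U c X = \<Lambda> (s' c t) +o U"
      unfolding X by (simp add: coset_scale_coset[OF mod(1) U] \<Lambda>.scale)
    then show "?f (coset_scale s U c X) = coset_scale s' U' c (?f X)"
      unfolding X f
      by (simp only: f coset_scale_coset[OF mod(2) U'] s'.scale_right_distrib)
  qed
qed

section \<open>The relations of the skew-dihedral homology\<close>

context superalgebra_superinvolution
begin

abbreviation HR :: "('r \<times> 'r \<Rightarrow>\<^sub>0 'k) set"
  where "HR \<equiv> HD1_rels sc G bar"

lemma subspace_HR: "free.subspace HR"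
  unfolding HD1_rels_def by (rule free.subspace_span)

lemma tensor_rels_HR: "tensor_rels sc UNIV \<subseteq> HR"
  unfolding HD1_rels_def by (intro subset_trans[OF _ free.span_superset]) blast

lemma bar_HR: "gen a b - gen (bar a) (bar b) \<in> HR"
  unfolding HD1_rels_def by (rule free.span_base) blast

lemma skew_HR: "a \<in> G d \<Longrightarrow> b \<in> G e \<Longrightarrow> gen a b + sgn_deg (d * e) (gen b a) \<in> HR"
  unfolding HD1_rels_def by (rule free.span_base) blast

lemma cyclic_HR:
  assumes "a \<in> G d" "b \<in> G e" "c \<in> G f"
  shows "sgn_deg (d * f) (gen (a * b) c) + sgn_deg (d * e) (gen (b * c) a)
    + sgn_deg (e * f) (gen (c * a) b) \<in> HR"
  unfolding HD1_rels_def by (rule free.span_base) (use assms in blast)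

lemma HR_by_homs:
  assumes "\<And>g :: ('r \<times> 'r \<Rightarrow>\<^sub>0 'k) \<Rightarrow> circle. additive g \<Longrightarrow> (\<And>u. u \<in> HR \<Longrightarrow> g u = 0) \<Longrightarrow> g t = 0"
  shows "t \<in> HR"
  by (rule mem_subspace_by_homs[OF module_free_scale subspace_HR]) (use assms in blast)

lemma HR_subset:
  assumes "free.subspace S" "tensor_rels sc UNIV \<subseteq> S"
    and "\<And>a b. gen a b - gen (bar a) (bar b) \<in> S"
    and "\<And>a b d e. a \<in> G d \<Longrightarrow> b \<in> G e \<Longrightarrow> gen a b + sgn_deg (d * e) (gen b a) \<in> S"
    and "\<And>a b c d e f. a \<in> G d \<Longrightarrow> b \<in> G e \<Longrightarrow> c \<in> G f \<Longrightarrow> sgn_deg (d * f) (gen (a * b) c)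
      + sgn_deg (d * e) (gen (b * c) a) + sgn_deg (e * f) (gen (c * a) b) \<in> S"
  shows "HR \<subseteq> S"
  unfolding HD1_rels_def by (rule free.span_minimal[OF _ assms(1)]) (use assms(2-) in blast)

definition cm :: "('r \<times> 'r \<Rightarrow>\<^sub>0 'k) \<Rightarrow> 'r"
  where "cm = free_lift sc (\<lambda>(a, b). supercomm G (*) a b)"

lemma cm_gen: "cm (gen a b) = supercomm G (*) a b"
  by (simp add: cm_def free_lift_gen[OF module_axioms])

lemma cm_hom: "module_hom free_scale sc cm"
  unfolding cm_def by (rule module_hom_free_lift[OF module_axioms])

text \<open>Coefficients are absorbed into the first factor. This reconciles \<open>HD1\<close>,
  which is built from sums of pure tensors, with arbitrary elements of the free module.\<close>

lemma sum_gens: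
  obtains N :: nat and a b where "t - (\<Sum>i<N. gen (a i) (b i)) \<in> HR"
proof -
  let ?S = "Poly_Mapping.keys t"
  obtain h where h: "bij_betw h {..<card ?S} ?S"
    using ex_bij_betw_nat_finite[OF finite_keys, of t] by (auto simp: atLeast0LessThan)
  let ?a = "\<lambda>i. sc (Poly_Mapping.lookup t (h i)) (fst (h i))" and ?b = "\<lambda>i. snd (h i)"
  have "(\<Sum>i<card ?S. free_scale (Poly_Mapping.lookup t (h i)) (gen (fst (h i)) (snd (h i)))) = t"
    using sum.reindex_bij_betw[OF h, of "\<lambda>u. free_scale (Poly_Mapping.lookup t u) (Poly_Mapping.single u 1)"]
      free_module_expand[of t] by (simp add: gen_def)
  then have "t - (\<Sum>i<card ?S. gen (?a i) (?b i)) = (\<Sum>i<card ?S.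
      - (gen (?a i) (?b i) - free_scale (Poly_Mapping.lookup t (h i)) (gen (fst (h i)) (?b i))))"
    by (simp add: sum_subtractf)
  also have "\<dots> \<in> HR"
    by (intro free.subspace_sum[OF subspace_HR] free.subspace_neg[OF subspace_HR]
        tensor_rels_scale[OF tensor_rels_HR] UNIV_I)
  finally show ?thesis by (rule that)
qed

end

context osp_setup
begin

subsection \<open>The map from the skew-dihedral side\<close>

lemma Lam_hom: "module_hom free_scale free_scale Lam"
  unfolding Lam_def by (rule module_hom_free_lift[OF module_free_scale])

lemma Lam_gen: "Lam (gen a b) = (\<Sum>d\<in>UNIV. \<Sum>e\<in>UNIV. glam d e (hcomp G d a) (hcomp G e b))"
  by (simp add: Lam_def free_lift_gen[OF module_free_scale])

lemma gM_sc: "q \<noteq> o1 \<Longrightarrow> gM q (sc c a) b - free_scale c (gM q a b) \<in> W"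
  "q \<noteq> o1 \<Longrightarrow> gM q a (sc c b) - free_scale c (gM q a b) \<in> W"
  by (simp_all add: gM_def tt_sc tensor_rels_scale[OF tensor_rels_W] tt_L)

lemma free_scale_sgn_deg: "free_scale c (sgn_deg d x) = sgn_deg d (free_scale c x)"
  by (simp add: sgn_deg_def)

lemma W_sgn_deg: "z \<in> W \<Longrightarrow> sgn_deg d z \<in> W"
  by (simp add: sgn_deg_def free.subspace_neg[OF subspace_W])

text \<open>Scalar relations are verified inside \<open>W\<close>, because the values of an additive
  homomorphism do not determine those on scalar multiples.\<close>

lemma glam_sc: "glam d e (sc c a) b - free_scale c (glam d e a b) \<in> W"
  "glam d e a (sc c b) - free_scale c (glam d e a b) \<in> W"
proof -
  have q: "q0 \<noteq> o1" by simp
  have *: "(x' - sgn_deg k y') - free_scale c (x - sgn_deg k y) \<in> W"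
    if "x' - free_scale c x \<in> W" "y' - free_scale c y \<in> W" for x x' y y' k
  proof -
    have "(x' - free_scale c x) - sgn_deg k (y' - free_scale c y) \<in> W"
      by (intro free.subspace_diff[OF subspace_W] W_sgn_deg that)
    also have "(x' - free_scale c x) - sgn_deg k (y' - free_scale c y)
      = (x' - sgn_deg k y') - free_scale c (x - sgn_deg k y)"
      by (simp add: sgn_deg_diff free.scale_right_diff_distrib free_scale_sgn_deg algebra_simps)
    finally show ?thesis .
  qed
  show "glam d e (sc c a) b - free_scale c (glam d e a b) \<in> W"
    unfolding glam_def using gM_sc(1)[OF q, of c a b] gM_sc(2)[OF q, of un c "b * a"]
    by (intro *) (simp_all add: scale_mult_right)
  show "glam d e a (sc c b) - free_scale c (glam d e a b) \<in> W"
    unfolding glam_def using gM_sc(2)[OF q, of a c b] gM_sc(2)[OF q, of un c "b * a"]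
    by (intro *) (simp_all add: scale_mult_left)
qed

lemma hcomp_bar: "hcomp G d (bar a) = bar (hcomp G d a)"
  by (rule G.hcomp_commute[OF bar_additive bar_degree])

lemma Lam_HR: "t \<in> HR \<Longrightarrow> Lam t \<in> W"
proof -
  interpret Lam: module_hom free_scale free_scale Lam by (rule Lam_hom)
  let ?S = "{t. Lam t \<in> W}"
  have scale: "Lam (gen a' b') - free_scale c (Lam (gen a b)) \<in> W"
    if "\<And>d e. glam d e (hcomp G d a') (hcomp G e b') - free_scale c (glam d e (hcomp G d a) (hcomp G e b)) \<in> W"
    for a a' b b' c
    unfolding Lam_gen free.scale_sum_right sum_subtractf[symmetric]
    by (intro free.subspace_sum[OF subspace_W] that)
  have "HR \<subseteq> ?S"
  proof (rule HR_subset)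
    show "free.subspace ?S"
      by (rule free.subspaceI)
        (simp_all add: Lam.zero Lam.add Lam.scale free.subspace_0[OF subspace_W]
          free.subspace_add[OF subspace_W] free.subspace_scale[OF subspace_W])
    have add: "Lam (gen (a + a') b - gen a b - gen a' b) \<in> W" "Lam (gen a (b + b') - gen a b - gen a b') \<in> W" for a a' b b'
    proof -
      have "f (Lam (gen (a + a') b - gen a b - gen a' b)) = 0 \<and> f (Lam (gen a (b + b') - gen a b - gen a b')) = 0"
        if "circle_cocycle f" for f
      proof -
        interpret hom_cocycle sc G bar i1 k1 f by (rule that)
        have "lam q0 d e (x + x') y = lam q0 d e x y + lam q0 d e x' y"
          "lam q0 d e x (y + y') = lam q0 d e x y + lam q0 d e x y'" for d e x x' y y'
          by (simp_all add: lam_def M_add_left M_add_right distrib_left distrib_right sgn_deg_add algebra_simps)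
        then show ?thesis
          by (simp add: Lam.diff f.diff f_Lam_gen G.hcomp_add sum.distrib)
      qed
      then show "Lam (gen (a + a') b - gen a b - gen a' b) \<in> W" "Lam (gen a (b + b') - gen a b - gen a b') \<in> W"
        by (auto intro: W_by_homs)
    qed
    have sc: "Lam (gen (sc c a) b - free_scale c (gen a b)) \<in> W" "Lam (gen a (sc c b) - free_scale c (gen a b)) \<in> W" for a b c
      unfolding Lam.diff Lam.scale by (intro scale; simp add: hcomp_sc glam_sc)+
    show "tensor_rels sc UNIV \<subseteq> ?S"
      unfolding tensor_rels_def using add sc by blast
    show "gen a b - gen (bar a) (bar b) \<in> ?S" for a b
    proof (rule CollectI, rule W_by_homs)
      fix f
      assume "circle_cocycle f"
      then interpret hom_cocycle sc G bar i1 k1 f .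
      have "lam q0 d e (bar (hcomp G d a)) (bar (hcomp G e b)) = lam q0 d e (hcomp G d a) (hcomp G e b)" for d e
        by (intro lam_bar) simp_all
      then show "f (Lam (gen a b - gen (bar a) (bar b))) = 0"
        by (simp add: Lam.diff f.diff f_Lam_gen hcomp_bar)
    qed
    show "gen a b + sgn_deg (d * e) (gen b a) \<in> ?S" if "a \<in> G d" "b \<in> G e" for a b d e
    proof (rule CollectI, rule W_by_homs)
      fix f
      assume "circle_cocycle f"
      then interpret hom_cocycle sc G bar i1 k1 f .
      show "f (Lam (gen a b + sgn_deg (d * e) (gen b a))) = 0"
        using lam_skew[OF _ that, of q0] that
        by (simp add: Lam.add f.add additive.sgn_deg[OF Lam_additive] f.sgn_deg f_Lam_gen_homogeneous)
    qed
    show "sgn_deg (d * f) (gen (a * b) c) + sgn_deg (d * e) (gen (b * c) a) + sgn_deg (e * f) (gen (c * a) b) \<in> ?S"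
      if a: "a \<in> G d" and b: "b \<in> G e" and c: "c \<in> G f" for a b c d e f
    proof (rule CollectI, rule W_by_homs)
      fix g :: "('k, 'r, 'm, 'n) tsq \<Rightarrow> circle"
      assume "hom_cocycle sc G bar g"
      then interpret g: hom_cocycle sc G bar i1 k1 g .
      show "g (Lam (sgn_deg (d * f) (gen (a * b) c) + sgn_deg (d * e) (gen (b * c) a) + sgn_deg (e * f) (gen (c * a) b))) = 0"
        using g.lam_jacobi[OF _ a b c, of q0]
        by (simp add: Lam.add g.f.add additive.sgn_deg[OF Lam_additive] g.f.sgn_deg
            g.f_Lam_gen_homogeneous[OF grading_mult[OF a b] c] g.f_Lam_gen_homogeneous[OF grading_mult[OF b c] a]
            g.f_Lam_gen_homogeneous[OF grading_mult[OF c a] b])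
    qed
  qed
  then show "t \<in> HR \<Longrightarrow> Lam t \<in> W" by blast
qed

subsection \<open>The supertrace map to the skew-dihedral side\<close>

text \<open>The supertrace of the matrix product of \<open>X\<close> and \<open>Y\<close>, with products of entries
  replaced by tensors.\<close>

definition phi :: "('r, 'm, 'n) mat \<Rightarrow> ('r, 'm, 'n) mat \<Rightarrow> ('r \<times> 'r \<Rightarrow>\<^sub>0 'k)"
  where "phi X Y = (\<Sum>d\<in>UNIV. \<Sum>e\<in>UNIV. \<Sum>p\<in>UNIV. \<Sum>q\<in>UNIV.
    sgn_deg (idx_deg p * (1 + d + e)) (gen (hcomp GG d X $ p $ q) (hcomp GG e Y $ q $ p)))"

definition Phi :: "('k, 'r, 'm, 'n) tsq \<Rightarrow> ('r \<times> 'r \<Rightarrow>\<^sub>0 'k)"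
  where "Phi = free_lift free_scale (\<lambda>(X, Y). phi X Y)"

lemma Phi_gen: "Phi (gen X Y) = phi X Y"
  by (simp add: Phi_def free_lift_gen[OF module_free_scale])

lemma Phi_hom: "module_hom free_scale free_scale Phi"
  unfolding Phi_def by (rule module_hom_free_lift[OF module_free_scale])

context
  fixes g :: "('r \<times> 'r \<Rightarrow>\<^sub>0 'k) \<Rightarrow> 'v::ab_group_add"
  assumes g: "additive g" and g_HR: "\<And>u. u \<in> HR \<Longrightarrow> g u = 0"
begin

interpretation g: additive g
  by (rule g)

abbreviation v :: "'r \<Rightarrow> 'r \<Rightarrow> 'v"
  where "v a b \<equiv> g (gen a b)"

lemma v_add_left: "v (a + a') b = v a b + v a' b"
  using g_HR[OF tensor_rels_add(1)[OF tensor_rels_HR], of a a' b] by (simp add: g.diff diff_diff_eq g.add)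

lemma v_add_right: "v a (b + b') = v a b + v a b'"
  using g_HR[OF tensor_rels_add(2)[OF tensor_rels_HR], of b b' a] by (simp add: g.diff diff_diff_eq g.add)

lemma v_left_additive: "additive (\<lambda>a. v a b)"
  by standard (rule v_add_left)

lemma v_right_additive: "additive (v a)"
  by standard (rule v_add_right)

lemmas v_zero_left [simp] = additive.zero[OF v_left_additive]
lemmas v_zero_right [simp] = additive.zero[OF v_right_additive]
lemmas v_sum_left = additive.sum[OF v_left_additive]
lemmas v_sum_right = additive.sum[OF v_right_additive]

lemma v_swap: "a \<in> G d \<Longrightarrow> b \<in> G e \<Longrightarrow> v a b = - sgn_deg (d * e) (v b a)"
  using g_HR[OF skew_HR, of a d b e] by (simp add: g.add g.sgn_deg eq_neg_iff_add_eq_0)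

lemma v_cyclic:
  assumes "a \<in> G d" "b \<in> G e" "c \<in> G f"
  shows "sgn_deg (d * f) (v (a * b) c) + sgn_deg (d * e) (v (b * c) a) + sgn_deg (e * f) (v (c * a) b) = 0"
  using g_HR[OF cyclic_HR[OF assms]] by (simp add: g.add g.sgn_deg)

lemma v_bar: "v (bar a) (bar b) = v a b"
  using g_HR[OF bar_HR, of a b] by (simp add: g.diff)

text \<open>The cyclic relation for \<open>un\<close>, \<open>un\<close>, a expresses the value at
  (un, a) as -2 times the value at (a, un), while skew-symmetry makes it -1 times that value. So
  both are 0.\<close>

lemma v_un_left: "v un a = 0"
proof (induction a rule: G.homogeneous_cases)
  case (homogeneous d a)
  have "v un a + v a un + v a un = 0"
    using v_cyclic[OF un_G un_G homogeneous] by simp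
  moreover have "v un a = - v a un"
    using v_swap[OF un_G homogeneous] by simp
  ultimately show ?case by simp
qed (simp add: v_add_right)

text \<open>The parameter t stands for the total degree of all matrices in an identity, so that the
  supertrace sign stays the same under cyclic permutation.\<close>

definition trv :: "bit \<Rightarrow> ('r, 'm, 'n) mat \<Rightarrow> ('r, 'm, 'n) mat \<Rightarrow> 'v"
  where "trv t X Y = (\<Sum>p\<in>UNIV. \<Sum>q\<in>UNIV. sgn_deg (idx_deg p * (1 + t)) (v (X $ p $ q) (Y $ q $ p)))"

lemma g_phi: "g (phi X Y) = (\<Sum>d\<in>UNIV. \<Sum>e\<in>UNIV. trv (d + e) (hcomp GG d X) (hcomp GG e Y))"
  by (simp add: phi_def trv_def g.sum g.sgn_deg add.assoc)

lemma trv_zero: "trv t 0 Y = 0" "trv t X 0 = 0"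
  by (simp_all add: trv_def)

lemma g_phi_homogeneous:
  assumes "X \<in> GG d" "Y \<in> GG e"
  shows "g (phi X Y) = trv (d + e) X Y"
  by (cases d; cases e)
    (simp_all add: g_phi sum_bit GG.hcomp_homogeneous[OF assms(1)] GG.hcomp_homogeneous[OF assms(2)] trv_zero)

lemma trv_add_left: "trv t (X + X') Y = trv t X Y + trv t X' Y"
  and trv_add_right: "trv t X (Y + Y') = trv t X Y + trv t X Y'"
  by (simp_all add: trv_def v_add_left v_add_right sgn_deg_add sum.distrib)

lemma trv_diff_left: "trv t (X - X') Y = trv t X Y - trv t X' Y"
  by (rule additive.diff) (standard, rule trv_add_left)

lemma trv_sgn_left: "trv t (sgn_deg d X) Y = sgn_deg d (trv t X Y)"
  by (rule additive.sgn_deg) (standard, rule trv_add_left)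

lemma trv_swap:
  assumes "X \<in> GG d" "Y \<in> GG e"
  shows "trv (d + e) X Y = - sgn_deg (d * e) (trv (d + e) Y X)"
proof -
  have "sgn_deg (idx_deg p * (1 + (d + e))) (v (X $ p $ q) (Y $ q $ p))
    = - sgn_deg (d * e) (sgn_deg (idx_deg q * (1 + (d + e))) (v (Y $ q $ p) (X $ p $ q)))" for p q
  proof -
    have "X $ p $ q \<in> G (d + idx_deg p + idx_deg q)" "Y $ q $ p \<in> G (e + idx_deg q + idx_deg p)"
      using assms unfolding mat_grading_def by blast+
    from v_swap[OF this] show ?thesis
      by (cases "idx_deg p"; cases "idx_deg q"; cases d; cases e) simp_all
  qed
  then have "trv (d + e) X Y = - sgn_deg (d * e)
      (\<Sum>p\<in>UNIV. \<Sum>q\<in>UNIV. sgn_deg (idx_deg q * (1 + (d + e))) (v (Y $ q $ p) (X $ p $ q)))"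
    by (simp add: trv_def sum_negf sgn_deg_sum)
  also have "(\<Sum>p\<in>UNIV. \<Sum>q\<in>UNIV. sgn_deg (idx_deg q * (1 + (d + e))) (v (Y $ q $ p) (X $ p $ q)))
    = trv (d + e) Y X"
    unfolding trv_def by (rule sum.swap)
  finally show ?thesis .
qed

text \<open>After renaming the summation indices, the three sums run over the same closed paths p,
  r, q, and each path contributes one cyclic relation between the three entries.\<close>

lemma trv_cyclic:
  assumes X: "X \<in> GG d" and Y: "Y \<in> GG e" and Z: "Z \<in> GG f"
  shows "sgn_deg (d * f) (trv (d + e + f) (mat_mult X Y) Z) + sgn_deg (d * e) (trv (d + e + f) (mat_mult Y Z) X)
    + sgn_deg (e * f) (trv (d + e + f) (mat_mult Z X) Y) = 0"
proof -
  let ?s = "\<lambda>p. sgn_deg (idx_deg p * (1 + (d + e + f)))"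
  have 1: "trv (d + e + f) (mat_mult X Y) Z
    = (\<Sum>p\<in>UNIV. \<Sum>q\<in>UNIV. \<Sum>r\<in>UNIV. ?s p (v (X $ p $ r * Y $ r $ q) (Z $ q $ p)))"
    by (simp add: trv_def mat_mult_nth v_sum_left sgn_deg_sum)
  have 2: "trv (d + e + f) (mat_mult Y Z) X
    = (\<Sum>p\<in>UNIV. \<Sum>q\<in>UNIV. \<Sum>r\<in>UNIV. ?s r (v (Y $ r $ q * Z $ q $ p) (X $ p $ r)))"
    by (simp add: trv_def mat_mult_nth v_sum_left sgn_deg_sum, subst sum.swap)
      (rule sum.cong[OF refl], rule sum.swap)
  have 3: "trv (d + e + f) (mat_mult Z X) Y
    = (\<Sum>p\<in>UNIV. \<Sum>q\<in>UNIV. \<Sum>r\<in>UNIV. ?s q (v (Z $ q $ p * X $ p $ r) (Y $ r $ q)))"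
    by (simp add: trv_def mat_mult_nth v_sum_left sgn_deg_sum, rule trans[OF _ sum.swap])
      (rule sum.cong[OF refl], rule sum.swap)
  have "sgn_deg (d * f) (?s p (v (X $ p $ r * Y $ r $ q) (Z $ q $ p)))
      + sgn_deg (d * e) (?s r (v (Y $ r $ q * Z $ q $ p) (X $ p $ r)))
      + sgn_deg (e * f) (?s q (v (Z $ q $ p * X $ p $ r) (Y $ r $ q))) = 0" for p q r
  proof -
    have "X $ p $ r \<in> G (d + idx_deg p + idx_deg r)" "Y $ r $ q \<in> G (e + idx_deg r + idx_deg q)"
      "Z $ q $ p \<in> G (f + idx_deg q + idx_deg p)"
      using X Y Z unfolding mat_grading_def by blast+
    note cyc = v_cyclic[OF this]
    \<comment> \<open>The common sign by which the matrix identity differs from the cyclic relation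
      of the entries; it is read off from the first of the three terms.\<close>
    let ?k = "(d + idx_deg p + idx_deg r) * (f + idx_deg q + idx_deg p) + d * f + idx_deg p * (1 + (d + e + f))"
    have "sgn_deg (d * f) (?s p x) + sgn_deg (d * e) (?s r y) + sgn_deg (e * f) (?s q z)
      = sgn_deg ?k (sgn_deg ((d + idx_deg p + idx_deg r) * (f + idx_deg q + idx_deg p)) x
        + sgn_deg ((d + idx_deg p + idx_deg r) * (e + idx_deg r + idx_deg q)) y
        + sgn_deg ((e + idx_deg r + idx_deg q) * (f + idx_deg q + idx_deg p)) z)" for x y z :: 'v
      by (cases "idx_deg p"; cases "idx_deg q"; cases "idx_deg r"; cases d; cases e; cases f) simp_all
    then show ?thesis by (simp only: cyc sgn_deg_zero)
  qed
  then show ?thesis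
    unfolding 1 2 3 sgn_deg_sum sum.distrib[symmetric] by simp
qed

text \<open>Expanding the supercommutators gives the difference, up to a sign, of the cyclic
  identities for (X, Y, Z) and (Y, X, Z).\<close>

lemma trv_jacobi:
  assumes X: "X \<in> GG d" and Y: "Y \<in> GG e" and Z: "Z \<in> GG f"
  shows "sgn_deg (d * f) (trv (d + e + f) (br X Y) Z) + sgn_deg (e * d) (trv (d + e + f) (br Y Z) X)
    + sgn_deg (f * e) (trv (d + e + f) (br Z X) Y) = 0"
proof -
  have eq: "d + e + f = e + d + f" by (simp add: add.commute)
  have 2: "sgn_deg (e * f) (trv (d + e + f) (mat_mult Y X) Z) + sgn_deg (e * d) (trv (d + e + f) (mat_mult X Z) Y)
    + sgn_deg (d * f) (trv (d + e + f) (mat_mult Z Y) X) = 0"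
    unfolding eq by (rule trv_cyclic[OF Y X Z])
  note 1 = trv_cyclic[OF X Y Z]
  have "br X Y = mat_mult X Y - sgn_deg (d * e) (mat_mult Y X)"
    "br Y Z = mat_mult Y Z - sgn_deg (e * f) (mat_mult Z Y)"
    "br Z X = mat_mult Z X - sgn_deg (f * d) (mat_mult X Z)"
    using assms by (simp_all only: GG.supercomm_homogeneous)
  then have br: "trv t (br X Y) Z = trv t (mat_mult X Y) Z - sgn_deg (d * e) (trv t (mat_mult Y X) Z)"
    "trv t (br Y Z) X = trv t (mat_mult Y Z) X - sgn_deg (e * f) (trv t (mat_mult Z Y) X)"
    "trv t (br Z X) Y = trv t (mat_mult Z X) Y - sgn_deg (f * d) (trv t (mat_mult X Z) Y)" for t
    by (simp_all only: trv_diff_left trv_sgn_left)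
    have "sgn_deg (d * f) (x1 - sgn_deg (d * e) y1) + sgn_deg (e * d) (x2 - sgn_deg (e * f) y2)
        + sgn_deg (f * e) (x3 - sgn_deg (f * d) y3)
      = (sgn_deg (d * f) x1 + sgn_deg (d * e) x2 + sgn_deg (e * f) x3)
        - sgn_deg (d * f + d * e + e * f) (sgn_deg (e * f) y1 + sgn_deg (e * d) y3 + sgn_deg (d * f) y2)"
      for x1 x2 x3 y1 y2 y3 :: 'v
      by (cases d; cases e; cases f) simp_all
  then show ?thesis by (simp only: br 1 2 sgn_deg_zero diff_0_right)
qed

end

lemma HR_sgn_deg: "z \<in> HR \<Longrightarrow> sgn_deg d z \<in> HR"
  by (simp add: sgn_deg_def free.subspace_neg[OF subspace_HR])

lemma phi_msc: "phi (msc c X) Y - free_scale c (phi X Y) \<in> HR" "phi X (msc c Y) - free_scale c (phi X Y) \<in> HR"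
proof -
  have "phi (msc c X) Y - free_scale c (phi X Y) = (\<Sum>d\<in>UNIV. \<Sum>e\<in>UNIV. \<Sum>p\<in>UNIV. \<Sum>q\<in>UNIV.
    sgn_deg (idx_deg p * (1 + d + e)) (gen (sc c (hcomp GG d X $ p $ q)) (hcomp GG e Y $ q $ p)
      - free_scale c (gen (hcomp GG d X $ p $ q) (hcomp GG e Y $ q $ p))))"
    by (simp add: phi_def free.scale_sum_right sum_subtractf sgn_deg_diff free_scale_sgn_deg hcomp_msc)
  also have "\<dots> \<in> HR"
    by (intro free.subspace_sum[OF subspace_HR] HR_sgn_deg tensor_rels_scale[OF tensor_rels_HR] UNIV_I)
  finally show "phi (msc c X) Y - free_scale c (phi X Y) \<in> HR" .
  have "phi X (msc c Y) - free_scale c (phi X Y) = (\<Sum>d\<in>UNIV. \<Sum>e\<in>UNIV. \<Sum>p\<in>UNIV. \<Sum>q\<in>UNIV.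
    sgn_deg (idx_deg p * (1 + d + e)) (gen (hcomp GG d X $ p $ q) (sc c (hcomp GG e Y $ q $ p))
      - free_scale c (gen (hcomp GG d X $ p $ q) (hcomp GG e Y $ q $ p))))"
    by (simp add: phi_def free.scale_sum_right sum_subtractf sgn_deg_diff free_scale_sgn_deg hcomp_msc)
  also have "\<dots> \<in> HR"
    by (intro free.subspace_sum[OF subspace_HR] HR_sgn_deg tensor_rels_scale[OF tensor_rels_HR] UNIV_I)
  finally show "phi X (msc c Y) - free_scale c (phi X Y) \<in> HR" .
qed

lemma W_subset:
  assumes "free.subspace S" "tensor_rels msc L \<subseteq> S"
    and "\<And>X Y d e. X \<in> GG d \<Longrightarrow> Y \<in> GG e \<Longrightarrow> gen X Y + sgn_deg (d * e) (gen Y X) \<in> S"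
    and "\<And>X Y Z d e f. X \<in> GG d \<Longrightarrow> Y \<in> GG e \<Longrightarrow> Z \<in> GG f \<Longrightarrow> sgn_deg (d * f) (gen (br X Y) Z)
      + sgn_deg (e * d) (gen (br Y Z) X) + sgn_deg (f * e) (gen (br Z X) Y) \<in> S"
  shows "W \<subseteq> S"
  unfolding H2_rels_def by (rule free.span_minimal[OF _ assms(1)]) (use assms(2-) in blast)

lemma Phi_W: "z \<in> W \<Longrightarrow> Phi z \<in> HR"
proof -
  interpret Phi: module_hom free_scale free_scale Phi by (rule Phi_hom)
  have Phi_add: "additive Phi" by standard (rule Phi.add)
  let ?S = "{z. Phi z \<in> HR}"
  have "W \<subseteq> ?S"
  proof (rule W_subset)
    show "free.subspace ?S"
      by (rule free.subspaceI)
        (simp_all add: Phi.zero Phi.add Phi.scale free.subspace_0[OF subspace_HR]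
          free.subspace_add[OF subspace_HR] free.subspace_scale[OF subspace_HR])
    have add: "Phi (gen (X + X') Y - gen X Y - gen X' Y) \<in> HR" "Phi (gen X (Y + Y') - gen X Y - gen X Y') \<in> HR" for X X' Y Y'
    proof -
      have "g (Phi (gen (X + X') Y - gen X Y - gen X' Y)) = 0" "g (Phi (gen X (Y + Y') - gen X Y - gen X Y')) = 0"
        if g: "additive g" "\<And>u. u \<in> HR \<Longrightarrow> g u = 0" for g :: "('r \<times> 'r \<Rightarrow>\<^sub>0 'k) \<Rightarrow> circle"
      proof -
        have "g (phi (X + X') Y) = g (phi X Y) + g (phi X' Y)" "g (phi X (Y + Y')) = g (phi X Y) + g (phi X Y')"
          by (simp_all only: g_phi[OF g] GG.hcomp_add trv_add_left[OF g] trv_add_right[OF g] sum.distrib)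
        then show "g (Phi (gen (X + X') Y - gen X Y - gen X' Y)) = 0" "g (Phi (gen X (Y + Y') - gen X Y - gen X Y')) = 0"
          by (simp_all add: Phi.diff additive.diff[OF g(1)] Phi_gen)
      qed
      then show "Phi (gen (X + X') Y - gen X Y - gen X' Y) \<in> HR" "Phi (gen X (Y + Y') - gen X Y - gen X Y') \<in> HR"
        using HR_by_homs[of "Phi (gen (X + X') Y - gen X Y - gen X' Y)"]
          HR_by_homs[of "Phi (gen X (Y + Y') - gen X Y - gen X Y')"] by blast+
    qed
    have "Phi (gen (msc c X) Y - free_scale c (gen X Y)) \<in> HR" "Phi (gen X (msc c Y) - free_scale c (gen X Y)) \<in> HR" for X Y c
      unfolding Phi.diff Phi.scale Phi_gen by (rule phi_msc)+
    then show "tensor_rels msc L \<subseteq> ?S"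
      unfolding tensor_rels_def using add by blast
    show "gen X Y + sgn_deg (d * e) (gen Y X) \<in> ?S" if "X \<in> GG d" "Y \<in> GG e" for X Y d e
    proof (rule CollectI, rule HR_by_homs)
      fix g :: "('r \<times> 'r \<Rightarrow>\<^sub>0 'k) \<Rightarrow> circle"
      assume g: "additive g" "\<And>u. u \<in> HR \<Longrightarrow> g u = 0"
      show "g (Phi (gen X Y + sgn_deg (d * e) (gen Y X))) = 0"
        using trv_swap[OF g that] g_phi_homogeneous[OF g that] g_phi_homogeneous[OF g that(2,1)]
        by (simp add: Phi.add additive.add[OF g(1)] additive.sgn_deg[OF Phi_add] additive.sgn_deg[OF g(1)]
            Phi_gen add.commute[of e d])
    qed
    show "sgn_deg (d * f) (gen (br X Y) Z) + sgn_deg (e * d) (gen (br Y Z) X) + sgn_deg (f * e) (gen (br Z X) Y) \<in> ?S"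
      if X: "X \<in> GG d" and Y: "Y \<in> GG e" and Z: "Z \<in> GG f" for X Y Z d e f
    proof (rule CollectI, rule HR_by_homs)
      fix g :: "('r \<times> 'r \<Rightarrow>\<^sub>0 'k) \<Rightarrow> circle"
      assume g: "additive g" "\<And>u. u \<in> HR \<Longrightarrow> g u = 0"
      have "e + f + d = d + e + f" "f + d + e = d + e + f" by (simp_all add: ac_simps)
      then show "g (Phi (sgn_deg (d * f) (gen (br X Y) Z) + sgn_deg (e * d) (gen (br Y Z) X)
          + sgn_deg (f * e) (gen (br Z X) Y))) = 0"
        using trv_jacobi[OF g X Y Z]
        by (simp only: Phi.add additive.add[OF g(1)] additive.sgn_deg[OF Phi_add] additive.sgn_deg[OF g(1)]
            Phi_gen g_phi_homogeneous[OF g br_GG[OF X Y] Z] g_phi_homogeneous[OF g br_GG[OF Y Z] X]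
            g_phi_homogeneous[OF g br_GG[OF Z X] Y])
    qed
  qed
  then show "z \<in> W \<Longrightarrow> Phi z \<in> HR" by blast
qed

end

context osp_setup
begin

text \<open>The origin of the factor 2: the units also meet at their mirrored positions, with barred
  entries, and \<open>v_bar\<close> identifies that contribution with the first.\<close>

lemma trv_tt:
  assumes g: "additive g" "\<And>u. u \<in> HR \<Longrightarrow> g u = 0" and a: "a \<in> G d" and b: "b \<in> G e"
  shows "trv g (d + e) (tt o1 q0 a) (tt q0 o1 b) = g (gen a b) + g (gen a b)"
proof -
  let ?o = o1 and ?q' = "Inr (Inr k1) :: ('m, 'n) idx"
  let ?X = "tt ?o q0 a" and ?Y = "tt q0 ?o b"
  have X: "?X $ p $ q = (if p = ?o then if q = q0 then a else 0 else 0)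
      + (if p = ?q' then if q = ?o then sgn_deg d (bar a) else 0 else 0)" for p q
    unfolding tt_nth[OF a] by (cases d) (auto simp: dual_def star_sgn_def)
  have Y: "?Y $ q0 $ ?o = b" "?Y $ ?o $ ?q' = sgn_deg (e + 1) (bar b)"
    unfolding tt_nth[OF b] by (cases e; auto simp: dual_def star_sgn_def)+
  have v0: "g (gen 0 y) = 0" for y by (rule v_zero_left[OF g])
  have "sgn_deg (idx_deg p * (1 + (d + e))) (g (gen (?X $ p $ q) (?Y $ q $ p)))
    = (if p = ?o then if q = q0 then g (gen a b) else 0 else 0)
      + (if p = ?q' then if q = ?o then g (gen a b) else 0 else 0)" for p q
  proof -
    have "sgn_deg (1 + (d + e)) (g (gen (sgn_deg d (bar a)) (sgn_deg (e + 1) (bar b)))) = g (gen a b)"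
      using additive.minus[OF v_left_additive[OF g], of "bar a"] additive.minus[OF v_right_additive[OF g], of _ "bar b"]
      by (cases d; cases e) (simp_all add: v_bar[OF g])
    then show ?thesis by (auto simp: X Y v0)
  qed
  then have "trv g (d + e) ?X ?Y = (\<Sum>p\<in>UNIV. \<Sum>q\<in>UNIV. (if p = ?o then if q = q0 then g (gen a b) else 0 else 0)
      + (if p = ?q' then if q = ?o then g (gen a b) else 0 else 0))"
    by (simp only: trv_def[OF g])
  also have "\<dots> = g (gen a b) + g (gen a b)"
    by (simp only: sum.distrib sum_delta2)
  finally show ?thesis .
qed

text \<open>Composing \<open>Phi\<close> with a homomorphism that kills \<open>HR\<close> gives a
  cocycle. Its \<open>lam\<close> is computed by \<open>trv_tt\<close>, and the correction term with
  a unit entry vanishes by \<open>v_un_left\<close>.\<close>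

lemma Phi_Lam: "Phi (Lam t) - (t + t) \<in> HR"
proof -
  interpret Lam: module_hom free_scale free_scale Lam by (rule Lam_hom)
  interpret Phi: module_hom free_scale free_scale Phi by (rule Phi_hom)
  have gen: "Phi (Lam (gen a b)) - (gen a b + gen a b) \<in> HR" for a b
  proof (rule HR_by_homs)
    fix g :: "('r \<times> 'r \<Rightarrow>\<^sub>0 'k) \<Rightarrow> circle"
    assume g: "additive g" "\<And>u. u \<in> HR \<Longrightarrow> g u = 0"
    interpret g: additive g by (rule g(1))
    have add: "additive (\<lambda>z. g (Phi z))" by standard (simp add: Phi.add g.add)
    have "cocycle sc G bar (\<lambda>X Y. g (Phi (gen X Y)))"
      by (rule cocycle_of_hom[OF add]) (simp add: Phi_W g(2))
    then interpret hom_cocycle sc G bar i1 k1 "\<lambda>z. g (Phi z)"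
      by (intro hom_cocycle.intro add osp_setup_axioms)
    have M: "M q0 x y = g (gen x y) + g (gen x y)" if x: "x \<in> G d" and y: "y \<in> G e" for x y d e
    proof -
      have "M q0 x y = trv g (d + 1 + (e + 1)) (tt o1 q0 x) (tt q0 o1 y)"
        unfolding M_def unfolding Phi_gen
        using g_phi_homogeneous[OF g tt_GG[OF x, of "o1" q0] tt_GG[OF y, of q0 "o1"]] by simp
      also have "d + 1 + (e + 1) = d + e" by (cases d; cases e) simp_all
      finally show ?thesis using trv_tt[OF g x y] by simp
    qed
    have hom: "lam q0 d e x y = g (gen x y) + g (gen x y)" if x: "x \<in> G d" and y: "y \<in> G e" for x y d e
      using M[OF x y] M[OF un_G grading_mult[OF y x]] v_un_left[OF g] by (simp add: lam_def)
    have "g (Phi (Lam (gen a b))) = (\<Sum>d\<in>UNIV. \<Sum>e\<in>UNIV. g (gen (hcomp G d a) (hcomp G e b)) + g (gen (hcomp G d a) (hcomp G e b)))"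
      unfolding f_Lam_gen by (intro sum.cong refl hom) simp_all
    also have "\<dots> = g (gen (\<Sum>d\<in>UNIV. hcomp G d a) (\<Sum>e\<in>UNIV. hcomp G e b))
        + g (gen (\<Sum>d\<in>UNIV. hcomp G d a) (\<Sum>e\<in>UNIV. hcomp G e b))"
      by (simp only: v_sum_left[OF g]) (simp only: v_sum_right[OF g] sum.distrib)
    also have "\<dots> = g (gen a b) + g (gen a b)"
      by (simp add: sum_bit G.hcomp_decomp)
    finally show "g (Phi (Lam (gen a b)) - (gen a b + gen a b)) = 0"
      by (simp only: g.diff g.add diff_self)
  qed
  have "t \<in> free_module (UNIV \<times> UNIV)" by (simp add: free_module_def)
  then show ?thesis
  proof (induction t rule: free_module_induct)
    case zero
    then show ?case by (simp add: Lam.zero Phi.zero free.subspace_0[OF subspace_HR])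
  next
    case (gen c x y)
    have "free_scale c (Phi (Lam (Defs.gen x y)) - (Defs.gen x y + Defs.gen x y)) \<in> HR"
      by (rule free.subspace_scale[OF subspace_HR \<open>\<And>a b. Phi (Lam (Defs.gen a b)) - (Defs.gen a b + Defs.gen a b) \<in> HR\<close>])
    then show ?case
      by (simp only: Lam.scale Phi.scale free.scale_right_diff_distrib free.scale_right_distrib)
  next
    case (add p q)
    have "Phi (Lam (p + q)) - (p + q + (p + q)) = (Phi (Lam p) - (p + p)) + (Phi (Lam q) - (q + q))"
      by (simp add: Lam.add Phi.add algebra_simps)
    then show ?case using free.subspace_add[OF subspace_HR add] by (simp only:)
  qed
qed

subsection \<open>The kernel of the bracket\<close>

definition bmap :: "('k, 'r, 'm, 'n) tsq \<Rightarrow> ('r, 'm, 'n) mat"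
  where "bmap = free_lift msc (\<lambda>(X, Y). br X Y)"

lemma bmap_gen: "bmap (gen X Y) = br X Y"
  by (simp add: bmap_def free_lift_gen[OF msc.module_axioms])

lemma bmap_hom: "module_hom free_scale msc bmap"
  unfolding bmap_def by (rule module_hom_free_lift[OF msc.module_axioms])

sublocale bmap: module_hom free_scale msc bmap
  by (rule bmap_hom)

lemma bmap_additive: "additive bmap"
  by standard (rule bmap.add)

lemma bmap_sgn_deg: "bmap (sgn_deg d z) = sgn_deg d (bmap z)"
  by (rule additive.sgn_deg[OF bmap_additive])

lemma bmap_W: "z \<in> W \<Longrightarrow> bmap z = 0"
proof -
  let ?S = "{z. bmap z = 0}"
  have "W \<subseteq> ?S"
  proof (rule W_subset)
    show "free.subspace ?S"
      by (rule free.subspaceI) (simp_all add: bmap.zero bmap.add bmap.scale)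
    show "tensor_rels msc L \<subseteq> ?S"
      unfolding tensor_rels_def
      by (auto simp: bmap.diff bmap.scale bmap_gen GG.supercomm_add_left GG.supercomm_add_right br_msc_left br_msc_right)
    show "gen X Y + sgn_deg (d * e) (gen Y X) \<in> ?S" if "X \<in> GG d" "Y \<in> GG e" for X Y d e
      using br_skew[OF that] by (simp add: bmap.add bmap_sgn_deg bmap_gen)
    show "sgn_deg (d * f) (gen (br X Y) Z) + sgn_deg (e * d) (gen (br Y Z) X) + sgn_deg (f * e) (gen (br Z X) Y) \<in> ?S"
      if "X \<in> GG d" "Y \<in> GG e" "Z \<in> GG f" for X Y Z d e f
      using br_jacobi[OF that] by (simp add: bmap.add bmap_sgn_deg bmap_gen)
  qed
  then show "z \<in> W \<Longrightarrow> bmap z = 0" by blast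
qed

lemma bmap_gF:
  assumes "X \<in> L" "\<And>p. X $ p $ p = 0"
  shows "bmap (gF X) = X"
proof -
  have "bmap (if p = q then 0 else gen (tt p (rr p q) (sc hf (X $ p $ q))) (tt (rr p q) q un))
    = (if p = q then 0 else tt p q (sc hf (X $ p $ q)))" for p q
    using rr_neq[of p q] by (auto simp: bmap.zero bmap_gen br_tt_path)
  then have "bmap (gF X) = offd X" by (simp add: gF_def offd_def bmap.sum)
  then show ?thesis using offd_eq[OF L_K[OF assms(1)] assms(2)] by simp
qed

lemma bmap_gM:
  assumes "p \<noteq> o1" "a \<in> G d" "b \<in> G e"
  shows "bmap (gM p a b) = tt o1 o1 (a * b) - sgn_deg ((d + idx_deg p) * (e + idx_deg p)) (tt p p (b * a))"
  using br_tt_opposite[OF _ _ assms(2,3), of "o1" p] assms(1)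
  by (auto simp: gM_def bmap_gen)

text \<open>The two brackets in \<open>glam\<close> have the same diagonal term at
  \<open>q0\<close>; it cancels and leaves the supercommutator at \<open>o1\<close>.\<close>

lemma bmap_Lam: "bmap (Lam t) = tt o1 o1 (cm t)"
proof -
  interpret Lam: module_hom free_scale free_scale Lam by (rule Lam_hom)
  interpret cm: module_hom free_scale sc cm by (rule cm_hom)
  have glam: "bmap (glam d e a b) = tt o1 o1 (a * b - sgn_deg (d * e) (b * a))"
    if a: "a \<in> G d" and b: "b \<in> G e" for a b d e
    unfolding glam_def bmap.diff bmap_sgn_deg
    by (subst bmap_gM[OF _ a b], simp, subst bmap_gM[OF _ un_G grading_mult[OF b a]], simp)
      (cases d; cases e; simp add: tt_diff tt_add tt_sgn_deg)
  have "bmap (Lam (gen a b)) = tt o1 o1 (cm (gen a b))" for a b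
    by (simp add: Lam_gen bmap.sum glam cm_gen supercomm_def additive.sum[OF tt_additive])
  note gen = this
  have "t \<in> free_module (UNIV \<times> UNIV)" by (simp add: free_module_def)
  then show ?thesis
    by (induction t rule: free_module_induct)
      (simp_all add: Lam.zero Lam.add Lam.scale cm.zero cm.add cm.scale bmap.zero bmap.add bmap.scale tt_add tt_sc gen)
qed

lemma tt_o1_nth: "tt o1 o1 a $ p $ q = (if p = o1 \<and> q = o1 then a - bar a else 0)"
proof (induction a rule: G.homogeneous_cases)
  case (homogeneous d a)
  show ?case unfolding tt_nth[OF homogeneous] by (auto simp: dual_def star_sgn_def)
qed (auto simp: tt_add bar.add)

text \<open>This turns the vanishing of the bracket into the condition that defines the
  skew-dihedral homology inside its ambient quotient.\<close>

lemma tt_o1_eq_0_iff: "tt o1 o1 a = 0 \<longleftrightarrow> a = bar a"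
  by (auto simp: mat_eq_iff tt_o1_nth)

lemma bmap_gM_un:
  assumes "p \<noteq> o1"
  shows "bmap (gM p un a) = tt o1 o1 a - (if idx_deg p = 0 then tt p p a else - tt p p (rho G a))"
proof -
  have add: "bmap (gM p un (x + y)) = bmap (gM p un x) + bmap (gM p un y)" for x y
    by (simp add: gM_def bmap_gen tt_add GG.supercomm_add_right)
  show ?thesis
  proof (induction a rule: G.homogeneous_cases)
    case (homogeneous d a)
    then show ?case
      using bmap_gM[OF assms un_G homogeneous]
      by (cases d) (auto simp: G.rho_homogeneous[OF homogeneous] tt_minus)
  next
    case (add x y)
    then show ?case
      by (auto simp: \<open>\<And>x y. bmap (gM p un (x + y)) = bmap (gM p un x) + bmap (gM p un y)\<close> tt_add G.rho_add)
  qed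
qed

lemma bmap_gM_nth:
  assumes p: "p \<in> P" and ij: "\<not> (i = j \<and> (i = o1 \<or> cl i = cl p))"
  shows "bmap (gM p un a) $ i $ j = 0"
proof -
  have "tt p p x $ i $ j = 0" for x
    using ij by (intro tt_nth_0) auto
  moreover have "tt o1 o1 a $ i $ j = 0" using ij by (auto simp: tt_o1_nth)
  ultimately show ?thesis using p by (simp add: bmap_gM_un P_def)
qed

lemma rho_eq_0: "rho G a = 0 \<Longrightarrow> a = 0"
proof -
  assume "rho G a = 0"
  then have "hcomp G 0 a + - hcomp G 1 a = 0" by (simp add: rho_def sum_bit)
  then have "hcomp G 0 a = 0" "- hcomp G 1 a = 0"
    using G.homogeneous_disjoint[OF G.hcomp_mem G.H_minus[OF G.hcomp_mem]] by blast+
  then show "a = 0" using G.hcomp_decomp[of a] by simp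
qed

text \<open>The entries of the bracket of a normal form are read off separately. Off the diagonal
  they force X = 0. At p in \<open>P\<close> they force \<open>a p\<close> to be 0, or bar-symmetric
  for orthogonal p, and then the summand at p lies in \<open>W\<close>. What remains is
  \<open>Lam t\<close>.\<close>

lemma kernel_normal_form:
  assumes z: "z \<in> free_module (L \<times> L)" and pz: "bmap z = 0"
  obtains t where "z - Lam t \<in> W" "cm t = bar (cm t)"
proof -
  from free_module_N[OF z] obtain X a t where X: "X \<in> L" "\<And>p. X $ p $ p = 0" and W: "z - nf X a t \<in> W"
    unfolding N_def by blast
  have "bmap z = bmap (nf X a t)" using bmap_W[OF W] by (simp add: bmap.diff)
  then have sum: "X + (\<Sum>p\<in>P. bmap (gM p un (a p))) + tt o1 o1 (cm t) = 0"
    using pz bmap_gF[OF X] by (simp add: nf_def bmap.add bmap.sum bmap_Lam)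
  have entry: "X $ i $ j + (\<Sum>p\<in>P. bmap (gM p un (a p)) $ i $ j) + tt o1 o1 (cm t) $ i $ j = 0" for i j
    using arg_cong[OF sum, of "\<lambda>Z. Z $ i $ j"] by simp
  have "X = 0"
  proof -
    have "X $ i $ j = 0" for i j
    proof (cases "i = j")
      case False
      then have "tt o1 o1 (cm t) $ i $ j = 0" by (auto simp: tt_o1_nth)
      then show ?thesis using entry[of i j] False by (simp add: bmap_gM_nth)
    qed (use X(2) in simp)
    then show ?thesis by (simp add: mat_eq_iff)
  qed
  have diag: "bmap (gM p un (a p)) $ p $ p = 0" if p: "p \<in> P" for p
  proof -
    have "bmap (gM q un (a q)) $ p $ p = (if q = p then bmap (gM p un (a p)) $ p $ p else 0)" if q: "q \<in> P" for q
    proof (cases "q = p")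
      case False
      have "q \<noteq> ip p" using p q False unfolding P_def by (cases p rule: idx_cases) auto
      then have "cl p \<noteq> cl q" using False by (auto simp: cl_eq_iff)
      then show ?thesis using bmap_gM_nth[OF q] False p by (simp add: P_def)
    qed simp
    then have "(\<Sum>q\<in>P. bmap (gM q un (a q)) $ p $ p) = (\<Sum>q\<in>P. if q = p then bmap (gM p un (a p)) $ p $ p else 0)"
      by (intro sum.cong refl)
    then have "(\<Sum>q\<in>P. bmap (gM q un (a q)) $ p $ p) = bmap (gM p un (a p)) $ p $ p" using p by simp
    then show ?thesis using entry[of p p] \<open>X = 0\<close> p by (simp add: P_def tt_o1_nth)
  qed
  have M0: "circle_cocycle f \<Longrightarrow> p \<in> P \<Longrightarrow> f (gM p un (a p)) = 0" for f p
  proof -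
    assume "circle_cocycle f" and p: "p \<in> P"
    then interpret hom_cocycle sc G bar i1 k1 f by simp
    have p1: "p \<noteq> o1" using p by (simp add: P_def)
    have nth: "bmap (gM p un (a p)) $ p $ p = - (if idx_deg p = 0 then tt p p (a p) else - tt p p (rho G (a p))) $ p $ p"
      using p1 by (simp add: bmap_gM_un tt_o1_nth)
    show "f (gM p un (a p)) = 0"
    proof (cases p rule: idx_cases)
      case (orth i)
      have ai: "i \<noteq> i1" using orth p1 by simp
      have e: "tt (Inl i) (Inl i) x $ Inl i $ Inl i = x - bar x" for x
      proof (induction x rule: G.homogeneous_cases)
        case (homogeneous d x)
        show ?case unfolding tt_nth[OF homogeneous] by (simp add: dual_def star_sgn_def)
      qed (simp add: tt_add bar.add)
      have "a p = bar (a p)" using nth diag[OF p] by (simp add: orth e)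
      \<comment> \<open>The halving takes place in the argument, since the circle has 2-torsion and
        M = - M alone would not give M = 0.\<close>
      then have "M p un (sc hf (a p)) = - M p un (sc hf (a p))"
        using M_orth_skew[OF ai, of "sc hf (a p)"] by (simp add: orth bar.scale)
      then have "M p un (sc hf (a p)) + M p un (sc hf (a p)) = 0"
        by (simp only: eq_neg_iff_add_eq_0)
      then show ?thesis
        using M_add_right[OF p1, of un "sc hf (a p)" "sc hf (a p)"] by (simp add: sc_hf_add f_gM)
    next
      case (sympl k)
      have "tt p p x $ p $ p = x" for x
        by (rule tt_nth_1) (simp add: sympl)
      then have "rho G (a p) = 0" using nth diag[OF p] by (simp add: sympl)
      then have "a p = 0" by (rule rho_eq_0)
      then show ?thesis
        using M_add_right[OF p1, of un 0 0] by (simp add: f_gM)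
    qed (use p in \<open>simp add: P_def\<close>)
  qed
  have "nf X a t - Lam t \<in> W"
  proof (rule W_by_homs)
    fix f
    assume f: "circle_cocycle f"
    then interpret hom_cocycle sc G bar i1 k1 f .
    have "(\<Sum>p\<in>P. M p un (a p)) = 0"
      using M0[OF f] by (intro sum.neutral ballI) (simp only: f_gM)
    then show "f (nf X a t - Lam t) = 0"
      using Fw_add[of 0 0] \<open>X = 0\<close> by (simp add: f.diff f_nf)
  qed
  from free.subspace_add[OF subspace_W W this] have "z - Lam t \<in> W" by simp
  moreover have "bmap (Lam t) = 0"
    using bmap_W[OF calculation] pz by (simp add: bmap.diff)
  then have "cm t = bar (cm t)" by (simp add: bmap_Lam tt_o1_eq_0_iff)
  ultimately show ?thesis by (rule that)
qed

subsection \<open>The two homology modules\<close>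

lemma Lam_free_module: "Lam t \<in> free_module (L \<times> L)"
proof -
  note sub = subspace_free_module[of "L \<times> L"]
  have "gM q0 a b \<in> free_module (L \<times> L)" for a b
    unfolding gM_def by (intro gen_in_free_module tt_L) simp_all
  then have "glam d e a b \<in> free_module (L \<times> L)" for d e a b
    unfolding glam_def sgn_deg_def by (simp add: free.subspace_diff[OF sub] free.subspace_add[OF sub])
  then show ?thesis
    unfolding Lam_def free_lift_def
    by (intro free.subspace_sum[OF sub] free.subspace_scale[OF sub])
      (simp add: case_prod_beta free.subspace_sum[OF sub])
qed

lemma HD1_eq: "HD1 sc G bar = {t +o HR | t. t \<in> {t. cm t = bar (cm t)}}"
proof -
  interpret cm: module_hom free_scale sc cm by (rule cm_hom)
  \<comment> \<open>\<open>cm\<close> need not vanish on the relations: the relation for the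
    involution is sent to [a, b] + bar [a, b]. Being fixed by \<open>bar\<close> is what the kernel
    condition needs, and it is inherited from the bracket of \<open>Lam u\<close>.\<close>
  have cm_HR: "cm u = bar (cm u)" if "u \<in> HR" for u
    using bmap_W[OF Lam_HR[OF that]] by (simp add: bmap_Lam tt_o1_eq_0_iff)
  have sums: "cm (\<Sum>i<(n::nat). gen (a i) (b i)) = (\<Sum>i<n. supercomm G (*) (a i) (b i))" for n a b
    by (simp add: cm.sum cm_gen)
  show ?thesis
  proof (intro subset_antisym subsetI)
    fix Z
    assume "Z \<in> HD1 sc G bar"
    then obtain n :: nat and a b where Z: "Z = (\<Sum>i<n. gen (a i) (b i)) +o HR"
      and eq: "(\<Sum>i<n. supercomm G (*) (a i) (b i)) = (\<Sum>i<n. bar (supercomm G (*) (a i) (b i)))"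
      unfolding HD1_def by blast
    have "cm (\<Sum>i<n. gen (a i) (b i)) = bar (cm (\<Sum>i<n. gen (a i) (b i)))"
      unfolding sums bar.sum by (rule eq)
    then show "Z \<in> {t +o HR | t. t \<in> {t. cm t = bar (cm t)}}" using Z by blast
  next
    fix Z
    assume "Z \<in> {t +o HR | t. t \<in> {t. cm t = bar (cm t)}}"
    then obtain t where Z: "Z = t +o HR" and t: "cm t = bar (cm t)" by blast
    obtain n :: nat and a b where n: "t - (\<Sum>i<n. gen (a i) (b i)) \<in> HR" (is "t - ?s \<in> HR")
      by (rule sum_gens)
    have "cm t - cm ?s = bar (cm t - cm ?s)" using cm_HR[OF n] by (simp add: cm.diff)
    then have "cm ?s = bar (cm ?s)" using t by (simp add: bar.diff)
    then have "(\<Sum>i<n. supercomm G (*) (a i) (b i)) = (\<Sum>i<n. bar (supercomm G (*) (a i) (b i)))"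
      unfolding sums bar.sum .
    moreover have "Z = ?s +o HR" unfolding Z free.coset_eq_iff[OF subspace_HR] by (rule n)
    ultimately show "Z \<in> HD1 sc G bar" unfolding HD1_def by blast
  qed
qed

lemma H2_eq: "H2 msc GG br L = {Lam t +o W | t. t \<in> {t. cm t = bar (cm t)}}"
proof -
  \<comment> \<open>The bracket is constant on cosets of \<open>W\<close>, so
    \<open>the_elem\<close> returns its value at any representative.\<close>
  have "bmap ` (z +o W) = {bmap z}" for z
    using free.subspace_0[OF subspace_W] by (force simp: elt_set_plus_def bmap.add bmap_W)
  then have H2: "H2 msc GG br L = {z +o W | z. z \<in> free_module (L \<times> L) \<and> bmap z = 0}"
    unfolding H2_def cosets_def bmap_def[symmetric] by auto
  show ?thesis
    unfolding H2
  proof (intro subset_antisym subsetI)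
    fix Z
    assume "Z \<in> {z +o W | z. z \<in> free_module (L \<times> L) \<and> bmap z = 0}"
    then obtain z where z: "Z = z +o W" "z \<in> free_module (L \<times> L)" "bmap z = 0" by blast
    obtain t where t: "z - Lam t \<in> W" "cm t = bar (cm t)" by (rule kernel_normal_form[OF z(2,3)])
    have "Z = Lam t +o W" unfolding z(1) free.coset_eq_iff[OF subspace_W] by (rule t(1))
    then show "Z \<in> {Lam t +o W | t. t \<in> {t. cm t = bar (cm t)}}" using t(2) by blast
  next
    fix Z
    assume "Z \<in> {Lam t +o W | t. t \<in> {t. cm t = bar (cm t)}}"
    then obtain t where "Z = Lam t +o W" "cm t = bar (cm t)" by blast
    moreover from this(2) have "bmap (Lam t) = 0" by (simp add: bmap_Lam tt_o1_eq_0_iff)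
    ultimately show "Z \<in> {z +o W | z. z \<in> free_module (L \<times> L) \<and> bmap z = 0}"
      using Lam_free_module by blast
  qed
qed

theorem H2_isomorphic_HD1:
  "coset_modules_isomorphic free_scale W (H2 msc GG br L) free_scale HR (HD1 sc G bar)"
proof (rule coset_modules_isomorphicI[OF Lam_hom Phi_hom subspace_W subspace_HR])
  interpret cm: module_hom free_scale sc cm by (rule cm_hom)
  show "free.subspace {t. cm t = bar (cm t)}"
    by (rule free.subspaceI) (simp_all add: cm.zero cm.add cm.scale bar.add bar.scale)
qed (fact Lam_HR Phi_W Phi_Lam hf_hf H2_eq HD1_eq)+

end

theorem corollary5p4:
  fixes sc :: "'k::comm_ring_1 \<Rightarrow> 'r::ring \<Rightarrow> 'r"
    and G :: "bit \<Rightarrow> 'r set"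
    and bar :: "'r \<Rightarrow> 'r"
    and L :: "('r, 'm::finite, 'n::finite) mat set"
  assumes "(2::'k) dvd 1"
    and "superalgebra_superinvolution sc G bar"
    and "(CARD('m), CARD('n)) \<notin> {(1, 1), (2, 1)}"
    and "L = osp sc G bar"
  shows "coset_modules_isomorphic
    free_scale (H2_rels (mat_scale sc) (mat_grading G) (mat_bracket G) L)
      (H2 (mat_scale sc) (mat_grading G) (mat_bracket G) L)
    free_scale (HD1_rels sc G bar) (HD1 sc G bar)"
proof -
  \<comment> \<open>Types are nonempty, which expresses that m and n are at least 1; any elements
    can serve as \<open>i1\<close> and \<open>k1\<close>.\<close>
  interpret osp_setup sc G bar "undefined :: 'm" "undefined :: 'n"
    by (intro osp_setup.intro osp_setup_axioms.intro assms(1-3))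
  show ?thesis unfolding assms(4) by (rule H2_isomorphic_HD1)
qed

end
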